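(* Let ${\cal N}: {\cal B}({\cal H}_A)\to{\cal B}({\cal H}_B)$ be a quantum channel with Stinespring isometry $U:{\cal H}_A\to{\cal H}_B\otimes{\cal H}_C$ (finite dimensions). For every input state $\rho$ on ${\cal H}_A$: (i) if $S(A)\le S(B)$ then $C_A^\rightarrow({\cal N})\ge S(A)$, and in general $C_A^\rightarrow({\cal N})\ge \tfrac12 I(A:B)$; (ii) for any input states $\rho$ with $S(B)<S(C)$ and $\rho'$ with $S(B')<S(A')$, $$C_A^\rightarrow({\cal N}) \ge \frac{S(C)-S(B)+\frac{S(B)}{S(A')-S(B')}S(A')}{1+\frac{S(B)}{S(A')-S(B')}};$$ (iii) in particular, if a single input state $\rho=\rho'$ satisfies $S(B)<S(C)$ and $S(B)<S(A)$, then $$C_A^\rightarrow({\cal N}) \ge \Bigl[1-\tfrac{S(B)}{S(A)}\Bigr]S(C)+\tfrac{S(B)}{S(A)}S(B).$$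
   Context: All logarithms are base 2; $S$ is von Neumann entropy. The channel is ${\cal N}(X)=\tr_C(UXU^* )$, and its complementary channel is $\overline{{\cal N}}(X)=\tr_B(UXU^* )$; the output system $C$ (the "environment") is held by a helper Charlie, $B$ by the receiver Bob. Let ${\cal S}=U{\cal H}_A\subset{\cal H}_B\otimes{\cal H}_C$. A classical code of blocklength $n$ is a family $(\varphi_i,M_i)_{i=1}^N$ of pure states $\ket{\varphi_i}\in{\cal S}^{\otimes n}$ and a POVM $(M_i)_{i=1}^N$ on ${\cal H}_B^{\otimes n}\otimes{\cal H}_C^{\otimes n}$; it has error $\epsilon$ if $\tr(\varphi_i M_i)\ge1-\epsilon$ for all $i$. It is environment-assisted if the POVM is implementable by one-way LOCC from Charlie ($C^n$) to Bob ($B^n$). $N_A^\rightarrow(n,\epsilon)$ is the largest $N$ of such a code, and the (pessimistic) environment-assisted classical capacity is $C_A^\rightarrow({\cal N})=\inf_{\epsilon>0}\liminf_{n\to\infty}\frac1n\log N_A^\rightarrow(n,\epsilon)$. For an input state $\rho$, let $\phi$ be a purification of $\rho$ on ${\cal H}_A\otimes{\cal H}_A$ and $\ket{\psi}_{ABC}=(\1\otimes U)\ket{\phi}$; write $S(A)=S(\rho)$, $S(B)=S({\cal N}(\rho))$, $S(C)=S(\overline{{\cal N}}(\rho))$, and $I(A:B)=S(A)+S(B)-S(C)$. For a second input state $\rho'$ the corresponding quantities are denoted $S(A'),S(B'),S(C')$. *)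

theory Defs
  imports "Jordan_Normal_Form.Schur_Decomposition" "Jordan_Normal_Form.Char_Poly"
    "HOL-Library.Extended_Real" "HOL-Library.Liminf_Limsup"
begin

abbreviation adj :: "complex mat \<Rightarrow> complex mat" where
  "adj A \<equiv> mat_adjoint A"

definition mtrace :: "complex mat \<Rightarrow> complex" where
  "mtrace A = (\<Sum>i<dim_row A. A $$ (i, i))"

definition qform :: "complex mat \<Rightarrow> complex vec \<Rightarrow> complex" where
  "qform A v = scalar_prod (conjugate v) (A *\<^sub>v v)"

definition psd :: "nat \<Rightarrow> complex mat \<Rightarrow> bool" where
  "psd d A \<longleftrightarrow> A \<in> carrier_mat d d \<and>
     (\<forall>v \<in> carrier_vec d. Im (qform A v) = 0 \<and> 0 \<le> Re (qform A v))"

definition density :: "nat \<Rightarrow> complex mat \<Rightarrow> bool" where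
  "density d \<rho> \<longleftrightarrow> psd d \<rho> \<and> mtrace \<rho> = 1"

definition eigs :: "complex mat \<Rightarrow> complex multiset" where
  "eigs A = proots (char_poly A)"

definition eta :: "real \<Rightarrow> real" where
  "eta x = (if x \<le> 0 then 0 else x * log 2 x)"

definition vn_entropy :: "complex mat \<Rightarrow> real" where
  "vn_entropy \<rho> = - (\<Sum>\<^sub># (image_mset (\<lambda>z. eta (Re z)) (eigs \<rho>)))"

text \<open>Kronecker (tensor) product; index of (i,k) is i * dim B + k.\<close>
definition kron :: "complex mat \<Rightarrow> complex mat \<Rightarrow> complex mat" where
  "kron A B = mat (dim_row A * dim_row B) (dim_col A * dim_col B)
     (\<lambda>(i, j). A $$ (i div dim_row B, j div dim_col B) * B $$ (i mod dim_row B, j mod dim_col B))"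

text \<open>Basis index of |b> (x) |c> in H_B (x) H_C is b * dC + c.\<close>
definition isometry :: "nat \<Rightarrow> nat \<Rightarrow> nat \<Rightarrow> complex mat \<Rightarrow> bool" where
  "isometry dA dB dC U \<longleftrightarrow> U \<in> carrier_mat (dB * dC) dA \<and> adj U * U = 1\<^sub>m dA"

definition ptrace_C :: "nat \<Rightarrow> nat \<Rightarrow> complex mat \<Rightarrow> complex mat" where
  "ptrace_C dB dC Y = mat dB dB (\<lambda>(i, j). \<Sum>k<dC. Y $$ (i * dC + k, j * dC + k))"

definition ptrace_B :: "nat \<Rightarrow> nat \<Rightarrow> complex mat \<Rightarrow> complex mat" where
  "ptrace_B dB dC Y = mat dC dC (\<lambda>(i, j). \<Sum>k<dB. Y $$ (k * dC + i, k * dC + j))"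

definition chan :: "nat \<Rightarrow> nat \<Rightarrow> complex mat \<Rightarrow> complex mat \<Rightarrow> complex mat" where
  "chan dB dC U X = ptrace_C dB dC (U * X * adj U)"

definition cchan :: "nat \<Rightarrow> nat \<Rightarrow> complex mat \<Rightarrow> complex mat \<Rightarrow> complex mat" where
  "cchan dB dC U X = ptrace_B dB dC (U * X * adj U)"

text \<open>k-th base-d digit; a basis index x < d^n of (C^d)^(x)n encodes (digit d 0 x, ..., digit d (n-1) x).\<close>
definition digit :: "nat \<Rightarrow> nat \<Rightarrow> nat \<Rightarrow> nat" where
  "digit d k x = x div d ^ k mod d"

text \<open>U^(x)n : H_A^(x)n -> (H_B (x) H_C)^(x)n, followed by the canonical reordering to
  H_B^(x)n (x) H_C^(x)n (output index iB * dC^n + iC).  Its range is S^(x)n.\<close>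
definition Utens :: "nat \<Rightarrow> nat \<Rightarrow> nat \<Rightarrow> complex mat \<Rightarrow> nat \<Rightarrow> complex mat" where
  "Utens dA dB dC U n = mat (dB ^ n * dC ^ n) (dA ^ n)
     (\<lambda>(i, j). \<Prod>k<n. U $$ (digit dB k (i div dC ^ n) * dC + digit dC k (i mod dC ^ n), digit dA k j))"

definition povm :: "nat \<Rightarrow> (nat \<Rightarrow> complex mat) \<Rightarrow> nat \<Rightarrow> bool" where
  "povm D M N \<longleftrightarrow> (\<forall>i<N. psd D (M i)) \<and>
     (\<forall>r<D. \<forall>c<D. (\<Sum>i<N. M i $$ (r, c)) = (if r = c then 1 else 0))"

text \<open>One-way LOCC implementable from Charlie (C^n) to Bob (B^n): Charlie measures a POVM
  (P j), sends j, Bob measures a POVM (Q j i) depending on j; M i = sum_j Q j i (x) P j.\<close>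
definition oneway_locc :: "nat \<Rightarrow> nat \<Rightarrow> nat \<Rightarrow> (nat \<Rightarrow> complex mat) \<Rightarrow> nat \<Rightarrow> bool" where
  "oneway_locc dB dC n M N \<longleftrightarrow>
     (\<exists>m P Q. povm (dC ^ n) P m \<and> (\<forall>j<m. povm (dB ^ n) (Q j) N) \<and>
        (\<forall>i<N. M i = mat (dB ^ n * dC ^ n) (dB ^ n * dC ^ n)
            (\<lambda>(r, c). \<Sum>j<m. kron (Q j i) (P j) $$ (r, c))))"

text \<open>Environment-assisted classical code of blocklength n, size N, error eps:
  pure states psi_i = U^(x)n a_i in S^(x)n (a_i unit vectors), and a one-way LOCC POVM M with
  tr(psi_i M_i) >= 1 - eps.\<close>
definition ea_code :: "nat \<Rightarrow> nat \<Rightarrow> nat \<Rightarrow> complex mat \<Rightarrow> nat \<Rightarrow> real \<Rightarrow> nat \<Rightarrow> bool" where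
  "ea_code dA dB dC U n \<epsilon> N \<longleftrightarrow>
     (\<exists>a M. (\<forall>i<N. a i \<in> carrier_vec (dA ^ n) \<and> scalar_prod (conjugate (a i)) (a i) = 1) \<and>
        povm (dB ^ n * dC ^ n) M N \<and> oneway_locc dB dC n M N \<and>
        (\<forall>i<N. Re (qform (M i) (Utens dA dB dC U n *\<^sub>v a i)) \<ge> 1 - \<epsilon>))"

definition NA :: "nat \<Rightarrow> nat \<Rightarrow> nat \<Rightarrow> complex mat \<Rightarrow> nat \<Rightarrow> real \<Rightarrow> ereal" where
  "NA dA dB dC U n \<epsilon> = Sup {ereal (real N) | N. ea_code dA dB dC U n \<epsilon> N}"

definition elog2 :: "ereal \<Rightarrow> ereal" where
  "elog2 x = (if x = \<infinity> then \<infinity> else if x \<le> 0 then - \<infinity> else ereal (log 2 (real_of_ereal x)))"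

definition CA :: "nat \<Rightarrow> nat \<Rightarrow> nat \<Rightarrow> complex mat \<Rightarrow> ereal" where
  "CA dA dB dC U = (INF \<epsilon>\<in>{0<..}. liminf (\<lambda>n. elog2 (NA dA dB dC U n \<epsilon>) / ereal (real n)))"

end

theory Submission
  imports Defs "HOL-Analysis.L2_Norm" "HOL-Library.FuncSet" "HOL-Real_Asymp.Real_Asymp"
begin

text \<open>
  Work in the eigenbases of the input state and of its two channel outputs. A code is built
  greedily, one codeword at a time, by Gram-Schmidt: the error of a new codeword is its weight
  in the span of the earlier ones, so only the average of the ensemble enters, and
  Cauchy-Schwarz bounds that weight by the square root of (number of codewords) times
  (purity of the average). Charlie's measurement consists of all vectors with entries
  in \<open>{1, \<i>, -1, -\<i>}\<close>; a second moment computation over these phases shows that on average the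
  purity of Bob's post-measurement ensemble is at most the sum of the purities of the \<open>B\<close> and
  \<open>BC\<close> marginals. Restricted to typical subspaces, this gives rate \<open>min S(A) S(B)\<close>.

  For the two-state bound Alice uses random-phase superpositions on \<open>n1\<close> copies of the first
  state and eigenvectors on \<open>n2\<close> copies of the second. Charlie first identifies one of about
  \<open>2^(n1 (S(C) - S(B)))\<close> superpositions by a projection of rank about \<open>2^(n1 S(B))\<close>; the
  entanglement that survives contributes \<open>n1 S(B)\<close> to the entropy of Bob's side in the second
  stage, so that \<open>2^(n2 S(A'))\<close> further messages can be decoded once
  \<open>n2 (S(A') - S(B'))\<close> is at most \<open>n1 S(B)\<close>.
\<close>

section \<open>Orthonormal families and Hilbert-Schmidt norms\<close>

text \<open>Purities do the work of entropies because decoding errors are estimated only through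
  tr(M Q) <= ||M|| ||Q|| in Hilbert-Schmidt norm, and the norm of a projection is the root of its
  rank. Cutting to typical sets turns purities into 2^(-n S) and ranks into 2^(n S), so Chebyshev's
  inequality with deviations linear in n is precise enough. The obstacle is the one-way rule:
  Charlie's measurement may not depend on the message, and Alice does not know its outcome. Hence
  Bob keeps one orthonormal family per outcome, all of them extended together, and a codeword is
  judged by its error averaged over the outcomes. Every codeword is bounded at the moment it is
  added, so the maximal error is controlled without expurgation. All bounds come from one two-stage
  code on n1 + n2 copies: n1 = 0 gives the minimum of S(A) and S(B), which subadditivity compares
  with I(A:B)/2, and the ratio n2/n1 = S(B) / (S(A') - S(B')) balances the two limits on the second
  stage and gives (ii). Coding takes place in eigenbasis coordinates, as finite sums; matrices enter
  for the spectral theorem and for the final POVMs.\<close>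

definition ip :: "'a set \<Rightarrow> ('a \<Rightarrow> complex) \<Rightarrow> ('a \<Rightarrow> complex) \<Rightarrow> complex" where
  "ip S f g = (\<Sum>s\<in>S. cnj (f s) * g s)"

definition nsq :: "'a set \<Rightarrow> ('a \<Rightarrow> complex) \<Rightarrow> real" where
  "nsq S f = (\<Sum>s\<in>S. (cmod (f s))\<^sup>2)"

text \<open>Null vectors are allowed, so that a Gram-Schmidt step exists for every vector.\<close>
definition pons :: "'a set \<Rightarrow> 'j set \<Rightarrow> ('j \<Rightarrow> 'a \<Rightarrow> complex) \<Rightarrow> bool" where
  "pons S J f \<longleftrightarrow> (\<forall>i\<in>J. ip S (f i) (f i) \<in> {0, 1}) \<and> (\<forall>i\<in>J. \<forall>j\<in>J. i \<noteq> j \<longrightarrow> ip S (f i) (f j) = 0)"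

lemma cmod_sum_mult_sq_le:
  "(cmod (\<Sum>i\<in>I. a i * b i))\<^sup>2 \<le> (\<Sum>i\<in>I. (cmod (a i))\<^sup>2) * (\<Sum>i\<in>I. (cmod (b i))\<^sup>2)"
proof -
  have "cmod (\<Sum>i\<in>I. a i * b i) \<le> (\<Sum>i\<in>I. \<bar>cmod (a i)\<bar> * \<bar>cmod (b i)\<bar>)"
    by (rule order_trans[OF norm_sum]) (simp add: norm_mult)
  also have "\<dots> \<le> L2_set (\<lambda>i. cmod (a i)) I * L2_set (\<lambda>i. cmod (b i)) I"
    by (rule L2_set_mult_ineq)
  finally have "(cmod (\<Sum>i\<in>I. a i * b i))\<^sup>2 \<le> (L2_set (\<lambda>i. cmod (a i)) I * L2_set (\<lambda>i. cmod (b i)) I)\<^sup>2"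
    by (rule power_mono) simp
  also have "\<dots> = (\<Sum>i\<in>I. (cmod (a i))\<^sup>2) * (\<Sum>i\<in>I. (cmod (b i))\<^sup>2)"
    by (simp add: power_mult_distrib L2_set_def sum_nonneg)
  finally show ?thesis .
qed

lemma of_real_cmod_sum_sq:
  "complex_of_real ((cmod (\<Sum>i\<in>I. f i))\<^sup>2) = (\<Sum>i\<in>I. \<Sum>j\<in>I. f i * cnj (f j))"
  by (simp add: complex_norm_square sum_product del: of_real_power)

lemma ip_cnj: "cnj (ip S f g) = ip S g f"
  by (simp add: ip_def mult.commute)

lemma ip_nsq: "ip S f f = complex_of_real (nsq S f)"
  by (simp add: ip_def nsq_def complex_norm_square mult.commute del: of_real_power)

lemma nsq_nonneg [simp]: "nsq S f \<ge> 0"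
  by (simp add: nsq_def sum_nonneg)

lemma nsq_0_iff: "finite S \<Longrightarrow> nsq S f = 0 \<longleftrightarrow> (\<forall>s\<in>S. f s = 0)"
  by (simp add: nsq_def sum_nonneg_eq_0_iff)

lemma ip_sum_right: "ip S f (\<lambda>s. \<Sum>i\<in>I. c i * g i s) = (\<Sum>i\<in>I. c i * ip S f (g i))"
proof -
  have "ip S f (\<lambda>s. \<Sum>i\<in>I. c i * g i s) = (\<Sum>s\<in>S. \<Sum>i\<in>I. c i * (cnj (f s) * g i s))"
    by (simp add: ip_def sum_distrib_left mult.left_commute)
  also have "\<dots> = (\<Sum>i\<in>I. c i * ip S f (g i))"
    by (subst sum.swap) (simp add: ip_def sum_distrib_left)
  finally show ?thesis .
qed

lemma ip_cong: "(\<And>s. s \<in> S \<Longrightarrow> f s = f' s) \<Longrightarrow> (\<And>s. s \<in> S \<Longrightarrow> g s = g' s) \<Longrightarrow> ip S f g = ip S f' g'"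
  by (simp add: ip_def)

lemma ip_add_right: "ip S f (\<lambda>s. g s + h s) = ip S f g + ip S f h"
  by (simp add: ip_def algebra_simps sum.distrib)

lemma ip_diff_right: "ip S f (\<lambda>s. g s - h s) = ip S f g - ip S f h"
  by (simp add: ip_def algebra_simps sum_subtractf)

lemma ip_scale_right: "ip S f (\<lambda>s. c * g s) = c * ip S f g"
  by (simp add: ip_def sum_distrib_left mult.left_commute)

lemma ip_scale_left: "ip S (\<lambda>s. c * f s) g = cnj c * ip S f g"
  by (simp add: ip_def sum_distrib_left mult.assoc)

lemma pons_null:
  assumes "finite S" "pons S J f" "i \<in> J" "ip S (f i) (f i) \<noteq> 1" "s \<in> S"
  shows "f i s = 0"
proof -
  have "ip S (f i) (f i) = 0"
    using assms by (auto simp: pons_def)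
  then show ?thesis
    using assms by (simp add: ip_nsq nsq_0_iff)
qed

text \<open>A unit member makes the factor 1 and a null member makes both sides vanish; this is what
  lets projection formulas tolerate zero vectors.\<close>

lemma pons_scale_self:
  assumes "finite S" "pons S J f" "i \<in> J"
  shows "ip S (f i) (f i) * ip S (f i) v = ip S (f i) v"
proof (cases "ip S (f i) (f i) = 1")
  case False
  then have "\<And>s. s \<in> S \<Longrightarrow> f i s = 0"
    using pons_null[OF assms] by simp
  then have "ip S (f i) v = 0" by (simp add: ip_def)
  then show ?thesis by simp
qed simp

lemma pons_coeff:
  assumes "finite S" "finite J" "pons S J f" "i \<in> J"
  shows "ip S (f i) (\<lambda>s. \<Sum>j\<in>J. ip S (f j) v * f j s) = ip S (f i) v"
proof -
  have "ip S (f i) (\<lambda>s. \<Sum>j\<in>J. ip S (f j) v * f j s) = (\<Sum>j\<in>J. ip S (f j) v * ip S (f i) (f j))"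
    by (rule ip_sum_right)
  also have "\<dots> = (\<Sum>j\<in>J. if j = i then ip S (f i) v else 0)"
  proof (rule sum.cong[OF refl])
    fix j assume "j \<in> J"
    then show "ip S (f j) v * ip S (f i) (f j) = (if j = i then ip S (f i) v else 0)"
      using pons_scale_self[OF assms(1,3,4), of v] assms(3,4)
      by (cases "j = i") (simp_all add: mult.commute pons_def)
  qed
  also have "\<dots> = ip S (f i) v" using assms by simp
  finally show ?thesis .
qed

lemma pons_pythagoras:
  assumes "finite S" "finite J" "pons S J f"
  shows "nsq S (\<lambda>s. v s - (\<Sum>j\<in>J. ip S (f j) v * f j s)) = nsq S v - (\<Sum>j\<in>J. (cmod (ip S (f j) v))\<^sup>2)"
    (is "nsq S (\<lambda>s. v s - ?P s) = _")
proof -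
  have 1: "ip S g ?P = (\<Sum>j\<in>J. ip S (f j) v * ip S g (f j))" for g
    by (rule ip_sum_right)
  have vP: "ip S v ?P = of_real (\<Sum>j\<in>J. (cmod (ip S (f j) v))\<^sup>2)"
    unfolding 1 of_real_sum
    by (intro sum.cong) (simp_all add: complex_norm_square ip_cnj del: of_real_power)
  have PP: "ip S ?P ?P = ip S v ?P"
  proof -
    have "ip S ?P ?P = (\<Sum>j\<in>J. ip S (f j) v * ip S ?P (f j))" by (rule 1)
    also have "\<dots> = (\<Sum>j\<in>J. ip S (f j) v * ip S v (f j))"
    proof (rule sum.cong[OF refl])
      fix j assume "j \<in> J"
      then have "cnj (ip S (f j) ?P) = cnj (ip S (f j) v)"
        using pons_coeff[OF assms] by simp
      then show "ip S (f j) v * ip S ?P (f j) = ip S (f j) v * ip S v (f j)"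
        unfolding ip_cnj by simp
    qed
    also have "\<dots> = ip S v ?P" by (simp add: 1)
    finally show ?thesis .
  qed
  have Pv: "ip S ?P v = ip S v ?P"
    using ip_cnj[of S v "\<lambda>s. \<Sum>j\<in>J. ip S (f j) v * f j s"] unfolding vP by simp
  have "complex_of_real (nsq S (\<lambda>s. v s - ?P s)) = ip S v v - ip S v ?P - ip S ?P v + ip S ?P ?P"
    unfolding ip_nsq[symmetric] by (simp add: ip_def algebra_simps sum.distrib sum_subtractf)
  also have "\<dots> = of_real (nsq S v - (\<Sum>j\<in>J. (cmod (ip S (f j) v))\<^sup>2))"
    unfolding PP Pv vP by (simp add: ip_nsq)
  finally show ?thesis using of_real_eq_iff by blast
qed

lemma bessel:
  assumes "finite S" "finite J" "pons S J f"
  shows "(\<Sum>j\<in>J. (cmod (ip S (f j) v))\<^sup>2) \<le> nsq S v"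
  using pons_pythagoras[OF assms, of v] nsq_nonneg[of S "\<lambda>s. v s - (\<Sum>j\<in>J. ip S (f j) v * f j s)"]
  by linarith

text \<open>The weight identity serves the greedy constructions of codes. The two span relations,
  the new vector in terms of \<open>v\<close> and the old ones and \<open>v\<close> in terms of the
  enlarged family, serve the triangularization.\<close>

lemma gs_step:
  fixes f :: "'j \<Rightarrow> 'a \<Rightarrow> complex" and v :: "'a \<Rightarrow> complex"
  assumes "finite S" "finite J" "pons S J f" "k \<notin> J"
  obtains g where "pons S (insert k J) (f(k := g))"
    "\<exists>c. \<forall>s. g s = c * (v s - (\<Sum>j\<in>J. ip S (f j) v * f j s))"
    "\<forall>s\<in>S. v s = (\<Sum>j\<in>J. ip S (f j) v * f j s) + ip S g v * g s"
    "(cmod (ip S g v))\<^sup>2 = nsq S v - (\<Sum>j\<in>J. (cmod (ip S (f j) v))\<^sup>2)"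
proof -
  define r where "r = (\<lambda>s. v s - (\<Sum>j\<in>J. ip S (f j) v * f j s))"
  \<comment> \<open>A zero residual is scaled by 0 and yields a null vector, so the step never
    fails.\<close>
  define c where "c = complex_of_real (if nsq S r = 0 then 0 else 1 / sqrt (nsq S r))"
  define g where "g = (\<lambda>s. c * r s)"
  have fr: "ip S (f j) r = 0" if "j \<in> J" for j
    unfolding r_def ip_diff_right using pons_coeff[OF assms(1-3) that] by simp
  have fg: "ip S (f j) g = 0" "ip S g (f j) = 0" if "j \<in> J" for j
    using fr[OF that] ip_cnj[of S "f j" g] by (simp_all add: g_def ip_scale_right)
  have gg: "ip S g g = (if nsq S r = 0 then 0 else 1)"
    by (simp add: g_def ip_scale_right ip_scale_left ip_nsq c_def flip: of_real_mult)
  have rr: "nsq S r = nsq S v - (\<Sum>j\<in>J. (cmod (ip S (f j) v))\<^sup>2)"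
    unfolding r_def by (rule pons_pythagoras[OF assms(1-3)])
  have vr: "v = (\<lambda>s. (\<Sum>j\<in>J. ip S (f j) v * f j s) + r s)" by (simp add: r_def)
  have gv: "ip S g v = of_real (sqrt (nsq S r))"
  proof -
    have "ip S g v = (\<Sum>j\<in>J. ip S (f j) v * ip S g (f j)) + ip S g r"
      by (subst vr) (simp only: ip_add_right ip_sum_right)
    also have "\<dots> = cnj c * of_real (nsq S r)"
      using fg by (simp add: g_def ip_scale_left ip_nsq)
    also have "\<dots> = of_real (sqrt (nsq S r))"
      by (simp add: c_def field_simps flip: of_real_mult)
    finally show ?thesis .
  qed
  show ?thesis
  proof (rule that[of g])
    show "pons S (insert k J) (f(k := g))"
      using assms fg gg by (auto simp: pons_def)
    show "\<exists>c. \<forall>s. g s = c * (v s - (\<Sum>j\<in>J. ip S (f j) v * f j s))"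
      by (auto simp: g_def r_def)
    have "v s = (\<Sum>j\<in>J. ip S (f j) v * f j s) + ip S g v * g s" if "s \<in> S" for s
    proof (cases "nsq S r = 0")
      case True
      then have "r s = 0" using assms that by (simp add: nsq_0_iff)
      then show ?thesis using True by (simp add: gv r_def)
    next
      case False
      then have "ip S g v * g s = r s" unfolding gv by (simp add: g_def c_def)
      then show ?thesis by (simp add: r_def)
    qed
    then show "\<forall>s\<in>S. v s = (\<Sum>j\<in>J. ip S (f j) v * f j s) + ip S g v * g s" by blast
    show "(cmod (ip S g v))\<^sup>2 = nsq S v - (\<Sum>j\<in>J. (cmod (ip S (f j) v))\<^sup>2)"
      by (simp add: gv rr[symmetric])
  qed
qed

text \<open>Adds a whole block: all conditional vectors of one codeword must land in the span of the
  enlarged family, while the vectors fixed earlier stay as they are.\<close>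

lemma gs_extend:
  fixes f :: "'j \<Rightarrow> 'a \<Rightarrow> complex" and v :: "'j \<Rightarrow> 'a \<Rightarrow> complex"
  assumes "finite S" "finite J" "pons S J f" "finite K" "J \<inter> K = {}"
  shows "\<exists>g. pons S (J \<union> K) g \<and> (\<forall>j\<in>J. g j = f j) \<and>
     (\<forall>k\<in>K. (\<Sum>j\<in>J \<union> K. (cmod (ip S (g j) (v k)))\<^sup>2) = nsq S (v k))"
  using assms(4,5)
proof (induction K rule: finite_induct)
  case empty
  then show ?case using assms by auto
next
  case (insert k K)
  then obtain g where g: "pons S (J \<union> K) g" "\<forall>j\<in>J. g j = f j"
    "\<forall>k\<in>K. (\<Sum>j\<in>J \<union> K. (cmod (ip S (g j) (v k)))\<^sup>2) = nsq S (v k)" by auto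
  have fin: "finite (J \<union> K)" and nk: "k \<notin> J \<union> K" using assms insert by auto
  obtain h where h: "pons S (insert k (J \<union> K)) (g(k := h))"
    "(cmod (ip S h (v k)))\<^sup>2 = nsq S (v k) - (\<Sum>j\<in>J \<union> K. (cmod (ip S (g j) (v k)))\<^sup>2)"
    using gs_step[OF assms(1) fin g(1) nk] by blast
  let ?g = "g(k := h)"
  have eq: "J \<union> insert k K = insert k (J \<union> K)" by auto
  have sm: "(\<Sum>j\<in>J \<union> insert k K. (cmod (ip S (?g j) w))\<^sup>2) =
      (cmod (ip S h w))\<^sup>2 + (\<Sum>j\<in>J \<union> K. (cmod (ip S (g j) w))\<^sup>2)" for w
    unfolding eq using fin nk by (subst sum.insert) (auto intro!: sum.cong)
  have "(\<Sum>j\<in>J \<union> insert k K. (cmod (ip S (?g j) (v l)))\<^sup>2) = nsq S (v l)" if "l \<in> insert k K" for l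
  proof (cases "l = k")
    case True
    show ?thesis unfolding True sm using h(2) by simp
  next
    case False
    \<comment> \<open>Weight captured earlier can only grow, and Bessel's inequality caps it at the
      norm, so equality persists.\<close>
    then have "nsq S (v l) \<le> (\<Sum>j\<in>J \<union> insert k K. (cmod (ip S (?g j) (v l)))\<^sup>2)"
      unfolding sm using g(3) that by simp
    moreover have "(\<Sum>j\<in>J \<union> insert k K. (cmod (ip S (?g j) (v l)))\<^sup>2) \<le> nsq S (v l)"
      using bessel[OF assms(1) _ h(1)] fin by (simp add: eq del: fun_upd_apply)
    ultimately show ?thesis by linarith
  qed
  moreover have "\<forall>j\<in>J. ?g j = f j" using g(2) nk by auto
  moreover have "pons S (J \<union> insert k K) ?g" using h(1) unfolding eq .
  ultimately show ?case by blast
qed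

text \<open>Both sides are the squared Hilbert-Schmidt norm of the product of \<open>g\<close> with
  its adjoint, taken in the two orders. For a bipartite pure state: the two marginals have equal
  purity.\<close>

lemma gram_swap:
  fixes g :: "'s \<Rightarrow> 'b \<Rightarrow> complex"
  shows "(\<Sum>b\<in>B. \<Sum>b'\<in>B. (cmod (\<Sum>s\<in>S. g s b * cnj (g s b')))\<^sup>2) =
    (\<Sum>s\<in>S. \<Sum>s'\<in>S. (cmod (\<Sum>b\<in>B. g s b * cnj (g s' b)))\<^sup>2)"
proof -
  have "complex_of_real (\<Sum>b\<in>B. \<Sum>b'\<in>B. (cmod (\<Sum>s\<in>S. g s b * cnj (g s b')))\<^sup>2) =
    (\<Sum>b\<in>B. \<Sum>b'\<in>B. \<Sum>s\<in>S. \<Sum>s'\<in>S. g s b * cnj (g s b') * cnj (g s' b * cnj (g s' b')))"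
    by (simp add: of_real_cmod_sum_sq del: of_real_power)
  also have "\<dots> = (\<Sum>b\<in>B. \<Sum>s\<in>S. \<Sum>s'\<in>S. \<Sum>b'\<in>B. g s b * cnj (g s b') * cnj (g s' b * cnj (g s' b')))"
    by (rule sum.cong[OF refl], subst sum.swap, rule sum.cong[OF refl], rule sum.swap)
  also have "\<dots> = (\<Sum>s\<in>S. \<Sum>s'\<in>S. \<Sum>b\<in>B. \<Sum>b'\<in>B. g s b * cnj (g s b') * cnj (g s' b * cnj (g s' b')))"
    by (subst sum.swap, rule sum.cong[OF refl], rule sum.swap)
  also have "\<dots> = complex_of_real (\<Sum>s\<in>S. \<Sum>s'\<in>S. (cmod (\<Sum>b\<in>B. g s b * cnj (g s' b)))\<^sup>2)"
    by (simp add: of_real_cmod_sum_sq mult_ac del: of_real_power)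
  finally show ?thesis using of_real_eq_iff by blast
qed

text \<open>The squared Hilbert-Schmidt norm of a projection is its rank. After
  \<open>gram_swap\<close> only the Gram matrix of the family remains, which is diagonal with
  entries 0 and 1.\<close>

lemma pons_hs:
  assumes "finite S" "finite J" "pons S J f"
  shows "(\<Sum>c\<in>S. \<Sum>c'\<in>S. (cmod (\<Sum>j\<in>J. f j c * cnj (f j c')))\<^sup>2) \<le> real (card J)"
proof -
  have "(\<Sum>c\<in>S. \<Sum>c'\<in>S. (cmod (\<Sum>j\<in>J. f j c * cnj (f j c')))\<^sup>2) =
      (\<Sum>j\<in>J. \<Sum>j'\<in>J. (cmod (ip S (f j') (f j)))\<^sup>2)"
    by (subst gram_swap) (simp add: ip_def mult.commute)
  also have "\<dots> = (\<Sum>j\<in>J. \<Sum>j'\<in>J. if j' = j then (cmod (ip S (f j) (f j)))\<^sup>2 else 0)"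
    using assms by (intro sum.cong) (auto simp: pons_def)
  also have "\<dots> = (\<Sum>j\<in>J. (cmod (ip S (f j) (f j)))\<^sup>2)"
    using assms by simp
  also have "\<dots> \<le> (\<Sum>j\<in>J. 1)"
    using assms by (intro sum_mono) (auto simp: pons_def)
  finally show ?thesis by simp
qed

text \<open>Cauchy-Schwarz for tr(M Q), where M is the sum of the rank one operators of the
  \<open>v x\<close> and Q the projection onto the family. Only the purity of M is left of the
  vectors, so an ensemble is seen through its average alone.\<close>

lemma pons_overlap_bound:
  assumes "finite S" "finite J" "pons S J f"
  shows "(\<Sum>x\<in>X. \<Sum>j\<in>J. (cmod (ip S (f j) (v x)))\<^sup>2) \<le>
    sqrt (real (card J) * (\<Sum>c\<in>S. \<Sum>c'\<in>S. (cmod (\<Sum>x\<in>X. v x c * cnj (v x c')))\<^sup>2))"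
proof -
  let ?m = "\<lambda>c c'. \<Sum>x\<in>X. v x c * cnj (v x c')"
  let ?q = "\<lambda>c c'. \<Sum>j\<in>J. f j c * cnj (f j c')"
  let ?L = "\<Sum>x\<in>X. \<Sum>j\<in>J. (cmod (ip S (f j) (v x)))\<^sup>2"
  have "complex_of_real ?L = (\<Sum>x\<in>X. \<Sum>j\<in>J. \<Sum>c\<in>S. \<Sum>c'\<in>S. v x c * cnj (v x c') * (f j c' * cnj (f j c)))"
    by (simp add: ip_def of_real_cmod_sum_sq mult.assoc mult.commute mult.left_commute del: of_real_power)
  also have "\<dots> = (\<Sum>x\<in>X. \<Sum>c\<in>S. \<Sum>c'\<in>S. \<Sum>j\<in>J. v x c * cnj (v x c') * (f j c' * cnj (f j c)))"
    by (rule sum.cong[OF refl], subst sum.swap, rule sum.cong[OF refl], rule sum.swap)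
  also have "\<dots> = (\<Sum>c\<in>S. \<Sum>c'\<in>S. \<Sum>x\<in>X. \<Sum>j\<in>J. v x c * cnj (v x c') * (f j c' * cnj (f j c)))"
    by (subst sum.swap, rule sum.cong[OF refl], rule sum.swap)
  also have "\<dots> = (\<Sum>c\<in>S. \<Sum>c'\<in>S. ?m c c' * ?q c' c)"
    by (simp add: sum_product)
  also have "\<dots> = (\<Sum>z\<in>S\<times>S. ?m (fst z) (snd z) * ?q (snd z) (fst z))"
    by (simp add: sum.cartesian_product split_def)
  finally have L: "complex_of_real ?L = (\<Sum>z\<in>S\<times>S. ?m (fst z) (snd z) * ?q (snd z) (fst z))" .
  have "?L\<^sup>2 = (cmod (complex_of_real ?L))\<^sup>2" by (simp only: norm_of_real power2_abs)
  also have "\<dots> = (cmod (\<Sum>z\<in>S\<times>S. ?m (fst z) (snd z) * ?q (snd z) (fst z)))\<^sup>2"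
    by (simp only: L)
  also have "\<dots> \<le> (\<Sum>z\<in>S\<times>S. (cmod (?m (fst z) (snd z)))\<^sup>2) * (\<Sum>z\<in>S\<times>S. (cmod (?q (snd z) (fst z)))\<^sup>2)"
    by (rule cmod_sum_mult_sq_le)
  also have "\<dots> = (\<Sum>c\<in>S. \<Sum>c'\<in>S. (cmod (?m c c'))\<^sup>2) * (\<Sum>c\<in>S. \<Sum>c'\<in>S. (cmod (?q c' c))\<^sup>2)"
    by (simp add: sum.cartesian_product split_def)
  also have "\<dots> \<le> (\<Sum>c\<in>S. \<Sum>c'\<in>S. (cmod (?m c c'))\<^sup>2) * real (card J)"
  proof (intro mult_left_mono sum_nonneg)
    have "(\<Sum>c\<in>S. \<Sum>c'\<in>S. (cmod (?q c' c))\<^sup>2) = (\<Sum>c\<in>S. \<Sum>c'\<in>S. (cmod (?q c c'))\<^sup>2)"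
      by (rule sum.swap)
    then show "(\<Sum>c\<in>S. \<Sum>c'\<in>S. (cmod (?q c' c))\<^sup>2) \<le> real (card J)"
      using pons_hs[OF assms] by simp
  qed simp
  finally show ?thesis
    by (intro real_le_rsqrt) (simp add: mult.commute)
qed

section \<open>Random phases and Bob's measurement\<close>

text \<open>Besides having modulus 1, the four values have mean 0 and mean square 0; signs alone
  would fail the second property. A finite set keeps every average a finite sum and the measurement
  finite.\<close>

definition phases :: "complex set" where "phases = {1, \<i>, -1, -\<i>}"

definition Om :: "'c set \<Rightarrow> ('c \<Rightarrow> complex) set" where "Om C = PiE C (\<lambda>_. phases)"

lemma finite_phases [simp]: "finite phases"
  by (simp add: phases_def)

lemma finite_Om [simp]: "finite C \<Longrightarrow> finite (Om C)"
  by (simp add: Om_def finite_PiE)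

lemma card_phases: "card phases = 4"
  by (simp add: phases_def complex_eq_iff)

lemma sum_phases: "(\<Sum>a\<in>phases. F a) = F 1 + F \<i> + F (-1) + F (-\<i>)"
  by (simp add: phases_def complex_eq_iff add.assoc)

lemma card_Om: "finite C \<Longrightarrow> card (Om C) = 4 ^ card C"
  by (simp add: Om_def card_PiE card_phases)

lemma card_Om_pos: "finite C \<Longrightarrow> 0 < real (card (Om C))"
  by (simp add: card_Om)

lemma Om_norm: "\<omega> \<in> Om C \<Longrightarrow> c \<in> C \<Longrightarrow> cmod (\<omega> c) = 1"
  by (auto simp: Om_def phases_def dest!: PiE_mem)

lemma sum_Om_insert:
  assumes "finite C" "z \<notin> C"
  shows "(\<Sum>\<omega>\<in>Om (insert z C). F \<omega>) = (\<Sum>g\<in>Om C. \<Sum>a\<in>phases. F (g(z := a)))"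
proof -
  have "(\<Sum>\<omega>\<in>Om (insert z C). F \<omega>) = (\<Sum>(a, g)\<in>phases \<times> Om C. F (g(z := a)))"
    unfolding Om_def PiE_insert_eq
    by (subst sum.reindex[OF inj_combinator[OF assms(2)]]) (simp add: split_def)
  also have "\<dots> = (\<Sum>g\<in>Om C. \<Sum>a\<in>phases. F (g(z := a)))"
    unfolding sum.cartesian_product[symmetric] by (rule sum.swap)
  finally show ?thesis .
qed

text \<open>All cross terms cancel: those with \<open>y\<close> carry the phase or its conjugate,
  the one between \<open>l\<close> and \<open>r\<close> carries its square, and both average to
  0.\<close>

lemma sum_phases_sq:
  "(\<Sum>a\<in>phases. (cmod (y + cnj a * l + a * r))\<^sup>2) = 4 * ((cmod y)\<^sup>2 + (cmod l)\<^sup>2 + (cmod r)\<^sup>2)"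
  unfolding sum_phases cmod_power2 by (simp add: power2_eq_square algebra_simps)

lemma Om_first_moment:
  assumes "finite C"
  shows "(\<Sum>\<omega>\<in>Om C. (cmod (a + (\<Sum>c\<in>C. \<omega> c * v c)))\<^sup>2) = real (card (Om C)) * ((cmod a)\<^sup>2 + (\<Sum>c\<in>C. (cmod (v c))\<^sup>2))"
  using assms
proof (induction C arbitrary: a rule: finite_induct)
  case empty
  then show ?case by (simp add: Om_def)
next
  case (insert z C)
  have eq: "a + (\<Sum>c\<in>insert z C. (g(z := t)) c * v c) = (a + (\<Sum>c\<in>C. g c * v c)) + cnj t * 0 + t * v z" for g :: "'a \<Rightarrow> complex" and t
    using insert by (auto simp: sum.insert intro!: sum.cong)
  have "(\<Sum>\<omega>\<in>Om (insert z C). (cmod (a + (\<Sum>c\<in>insert z C. \<omega> c * v c)))\<^sup>2) =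
      (\<Sum>g\<in>Om C. 4 * ((cmod (a + (\<Sum>c\<in>C. g c * v c)))\<^sup>2 + (cmod (v z))\<^sup>2))"
    unfolding sum_Om_insert[OF insert(1,2)] eq sum_phases_sq by simp
  also have "\<dots> = real (card (Om (insert z C))) * ((cmod a)\<^sup>2 + (\<Sum>c\<in>insert z C. (cmod (v c))\<^sup>2))"
    using insert by (simp add: card_Om sum.distrib distrib_left sum_distrib_left[symmetric])
  finally show ?case .
qed

lemma Om_first_moment0:
  assumes "finite C"
  shows "(\<Sum>\<omega>\<in>Om C. (cmod (\<Sum>c\<in>C. \<omega> c * v c))\<^sup>2) = real (card (Om C)) * (\<Sum>c\<in>C. (cmod (v c))\<^sup>2)"
  using Om_first_moment[OF assms, of 0 v] by simp

lemma Om_first_moment_cnj: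
  assumes "finite C"
  shows "(\<Sum>\<omega>\<in>Om C. (cmod (\<Sum>c\<in>C. cnj (\<omega> c) * v c))\<^sup>2) = real (card (Om C)) * (\<Sum>c\<in>C. (cmod (v c))\<^sup>2)"
proof -
  have "cmod (\<Sum>c\<in>C. cnj (\<omega> c) * v c) = cmod (\<Sum>c\<in>C. \<omega> c * cnj (v c))" for \<omega> :: "'a \<Rightarrow> complex"
  proof -
    have "(\<Sum>c\<in>C. cnj (\<omega> c) * v c) = cnj (\<Sum>c\<in>C. \<omega> c * cnj (v c))" by simp
    then show ?thesis by (simp only: complex_mod_cnj)
  qed
  then show ?thesis using Om_first_moment0[OF assms, of "\<lambda>c. cnj (v c)"] by simp
qed

text \<open>The diagonal terms do not depend on the phases, and the off-diagonal ones are
  uncorrelated because a phase and its square have mean 0. The offset \<open>a\<close> collects the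
  diagonal entries split off by the induction.\<close>

lemma Om_second_moment:
  assumes "finite C"
  shows "(\<Sum>\<omega>\<in>Om C. (cmod (a + (\<Sum>c\<in>C. \<Sum>c'\<in>C. cnj (\<omega> c) * \<omega> c' * M c c')))\<^sup>2) \<le>
     real (card (Om C)) * ((cmod (a + (\<Sum>c\<in>C. M c c)))\<^sup>2 + (\<Sum>c\<in>C. \<Sum>c'\<in>C. (cmod (M c c'))\<^sup>2))"
  using assms
proof (induction C arbitrary: a rule: finite_induct)
  case empty
  then show ?case by (simp add: Om_def)
next
  case (insert z C)
  define L where "L = (\<lambda>g. \<Sum>c'\<in>C. g c' * M z c')"
  define R where "R = (\<lambda>g. \<Sum>c\<in>C. cnj (g c) * M c z)"
  define Z where "Z = (\<lambda>g. \<Sum>c\<in>C. \<Sum>c'\<in>C. cnj (g c) * g c' * M c c')"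
  let ?n = "real (card (Om C))"
  have eq: "a + (\<Sum>c\<in>insert z C. \<Sum>c'\<in>insert z C. cnj ((g(z := t)) c) * (g(z := t)) c' * M c c') =
      ((a + M z z) + Z g) + cnj t * L g + t * R g" if "t \<in> phases" for g t
  proof -
    have t: "cnj t * t = 1" using that by (auto simp: phases_def)
    have upd: "(g(z := t)) c = g c" if "c \<in> C" for c using that insert by auto
    have "(\<Sum>c\<in>insert z C. \<Sum>c'\<in>insert z C. cnj ((g(z := t)) c) * (g(z := t)) c' * M c c') =
       (cnj t * t * M z z + (\<Sum>c'\<in>C. cnj t * g c' * M z c')) +
       (\<Sum>c\<in>C. (cnj (g c) * t * M c z + (\<Sum>c'\<in>C. cnj (g c) * g c' * M c c')))"
      using insert(1,2) by (simp add: upd del: fun_upd_apply cong: sum.cong) simp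
    also have "\<dots> = M z z + cnj t * L g + t * R g + Z g"
      unfolding t L_def R_def Z_def by (simp add: sum.distrib sum_distrib_left mult_ac)
    finally show ?thesis by simp
  qed
  have "(\<Sum>\<omega>\<in>Om (insert z C). (cmod (a + (\<Sum>c\<in>insert z C. \<Sum>c'\<in>insert z C. cnj (\<omega> c) * \<omega> c' * M c c')))\<^sup>2)
      = (\<Sum>g\<in>Om C. \<Sum>t\<in>phases. (cmod (((a + M z z) + Z g) + cnj t * L g + t * R g))\<^sup>2)"
    unfolding sum_Om_insert[OF insert(1,2)] by (intro sum.cong[OF refl] arg_cong[where f = "\<lambda>z. (cmod z)\<^sup>2"] eq)
  also have "\<dots> = 4 * ((\<Sum>g\<in>Om C. (cmod ((a + M z z) + Z g))\<^sup>2) + (\<Sum>g\<in>Om C. (cmod (L g))\<^sup>2) + (\<Sum>g\<in>Om C. (cmod (R g))\<^sup>2))"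
    unfolding sum_phases_sq by (simp add: sum_distrib_left sum.distrib)
  also have "\<dots> \<le> 4 * (?n * ((cmod ((a + M z z) + (\<Sum>c\<in>C. M c c)))\<^sup>2 + (\<Sum>c\<in>C. \<Sum>c'\<in>C. (cmod (M c c'))\<^sup>2))
      + ?n * (\<Sum>c'\<in>C. (cmod (M z c'))\<^sup>2) + ?n * (\<Sum>c\<in>C. (cmod (M c z))\<^sup>2))"
    unfolding L_def R_def Om_first_moment0[OF insert(1)] Om_first_moment_cnj[OF insert(1)] Z_def
    using insert(3)[of "a + M z z"] by simp
  also have "\<dots> = (4 * ?n) * ((cmod ((a + M z z) + (\<Sum>c\<in>C. M c c)))\<^sup>2 + ((\<Sum>c\<in>C. \<Sum>c'\<in>C. (cmod (M c c'))\<^sup>2)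
      + (\<Sum>c'\<in>C. (cmod (M z c'))\<^sup>2) + (\<Sum>c\<in>C. (cmod (M c z))\<^sup>2)))"
    by (simp add: algebra_simps)
  \<comment> \<open>The only loss: the square of the diagonal entry at \<open>z\<close> is added to
    complete the Hilbert-Schmidt norm.\<close>
  also have "\<dots> \<le> (4 * ?n) * ((cmod (a + (\<Sum>c\<in>insert z C. M c c)))\<^sup>2 + (\<Sum>c\<in>insert z C. \<Sum>c'\<in>insert z C. (cmod (M c c'))\<^sup>2))"
    using insert(1,2) by (intro mult_left_mono) (auto simp: sum.distrib add.assoc)
  also have "4 * ?n = real (card (Om (insert z C)))"
    using insert(1,2) by (simp add: card_Om)
  finally show ?case .
qed

section \<open>Averaging arguments and purities of weighted ensembles\<close>

lemma exists_le_average: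
  fixes g p :: "'x \<Rightarrow> real"
  assumes "finite X" "\<And>x. x \<in> X \<Longrightarrow> 0 \<le> p x" "sum p X = 1" "(\<Sum>x\<in>X. p x * g x) \<le> t"
  shows "\<exists>x\<in>X. g x \<le> t"
proof (rule ccontr)
  assume neg: "\<not> ?thesis"
  then have gt: "t < g x" if "x \<in> X" for x using that by force
  have "(\<Sum>x\<in>X. p x * (g x - t)) \<le> 0"
    using assms by (simp add: algebra_simps sum_subtractf sum_distrib_left[symmetric])
  moreover have nn: "0 \<le> p x * (g x - t)" if "x \<in> X" for x
    using gt[OF that] assms(2)[OF that] by simp
  ultimately have "(\<Sum>x\<in>X. p x * (g x - t)) = 0"
    by (meson sum_nonneg order_antisym)
  then have "\<forall>x\<in>X. p x * (g x - t) = 0"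
    using sum_nonneg_eq_0_iff[OF assms(1), of "\<lambda>x. p x * (g x - t)"] nn by simp
  then have "\<forall>x\<in>X. p x = 0" using gt by force
  then show False using assms(3) by simp
qed

lemma exists_le_uniform_average:
  fixes g :: "'x \<Rightarrow> real"
  assumes "finite X" "card X > 0" "(\<Sum>x\<in>X. g x) \<le> real (card X) * t"
  shows "\<exists>x\<in>X. g x \<le> t"
proof (rule exists_le_average[of X "\<lambda>_. 1 / real (card X)"])
  show "(\<Sum>x\<in>X. 1 / real (card X) * g x) \<le> t"
    using assms by (simp add: sum_distrib_left[symmetric] field_simps flip: sum_divide_distrib)
qed (use assms in auto)

text \<open>Concavity of the square root, used to average root bounds over Charlie's
  outcomes.\<close>

lemma sum_sqrt_le:
  assumes "\<And>i. i \<in> I \<Longrightarrow> 0 \<le> t i"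
  shows "(\<Sum>i\<in>I. sqrt (t i)) \<le> sqrt (real (card I) * (\<Sum>i\<in>I. t i))"
proof -
  have "(\<Sum>i\<in>I. sqrt (t i)) = (\<Sum>i\<in>I. \<bar>1::real\<bar> * \<bar>sqrt (t i)\<bar>)"
    using assms by (intro sum.cong) auto
  also have "\<dots> \<le> L2_set (\<lambda>_. 1::real) I * L2_set (\<lambda>i. sqrt (t i)) I"
    by (rule L2_set_mult_ineq)
  also have "\<dots> = sqrt (real (card I) * (\<Sum>i\<in>I. t i))"
    using assms by (simp add: L2_set_def real_sqrt_mult)
  finally show ?thesis .
qed

text \<open>The trace of the average state sigma, the sum over \<open>x\<close> of
  \<open>p x\<close> times the rank one operator of \<open>w x\<close>. It may be below 1, since the
  vectors will be cut to typical subspaces.\<close>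

definition wt :: "'x set \<Rightarrow> 'b set \<Rightarrow> 'c set \<Rightarrow> ('x \<Rightarrow> real) \<Rightarrow> ('x \<Rightarrow> 'b \<Rightarrow> 'c \<Rightarrow> complex) \<Rightarrow> real" where
  "wt X B C p w = (\<Sum>x\<in>X. p x * (\<Sum>b\<in>B. \<Sum>c\<in>C. (cmod (w x b c))\<^sup>2))"

text \<open>The trace of the square of Bob's marginal of the average state sigma;
  \<open>purC\<close> is the same for Charlie and \<open>purBC\<close> for sigma itself.\<close>

definition purB :: "'x set \<Rightarrow> 'b set \<Rightarrow> 'c set \<Rightarrow> ('x \<Rightarrow> real) \<Rightarrow> ('x \<Rightarrow> 'b \<Rightarrow> 'c \<Rightarrow> complex) \<Rightarrow> real" where
  "purB X B C p w = (\<Sum>b\<in>B. \<Sum>b'\<in>B. (cmod (\<Sum>c\<in>C. \<Sum>x\<in>X. of_real (p x) * w x b c * cnj (w x b' c)))\<^sup>2)"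

definition purC :: "'x set \<Rightarrow> 'b set \<Rightarrow> 'c set \<Rightarrow> ('x \<Rightarrow> real) \<Rightarrow> ('x \<Rightarrow> 'b \<Rightarrow> 'c \<Rightarrow> complex) \<Rightarrow> real" where
  "purC X B C p w = (\<Sum>c\<in>C. \<Sum>c'\<in>C. (cmod (\<Sum>b\<in>B. \<Sum>x\<in>X. of_real (p x) * w x b c * cnj (w x b c')))\<^sup>2)"

definition purBC :: "'x set \<Rightarrow> 'b set \<Rightarrow> 'c set \<Rightarrow> ('x \<Rightarrow> real) \<Rightarrow> ('x \<Rightarrow> 'b \<Rightarrow> 'c \<Rightarrow> complex) \<Rightarrow> real" where
  "purBC X B C p w = (\<Sum>b\<in>B. \<Sum>b'\<in>B. \<Sum>c\<in>C. \<Sum>c'\<in>C. (cmod (\<Sum>x\<in>X. of_real (p x) * w x b c * cnj (w x b' c')))\<^sup>2)"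

text \<open>Bob's unnormalised vector after Charlie's outcome \<open>\<omega>\<close> on the joint vector \<open>v\<close>.\<close>
definition meas :: "'c set \<Rightarrow> ('b \<Rightarrow> 'c \<Rightarrow> complex) \<Rightarrow> ('c \<Rightarrow> complex) \<Rightarrow> 'b \<Rightarrow> complex" where
  "meas C v \<omega> b = (\<Sum>c\<in>C. cnj (\<omega> c) * v b c)"

text \<open>The phase vectors resolve the identity on \<open>C\<close> up to the factor
  \<open>card (Om C)\<close>, which is what makes them a measurement.\<close>

lemma meas_nsq:
  assumes "finite C"
  shows "(\<Sum>\<omega>\<in>Om C. nsq B (meas C v \<omega>)) = real (card (Om C)) * (\<Sum>b\<in>B. \<Sum>c\<in>C. (cmod (v b c))\<^sup>2)"
  unfolding nsq_def meas_def
  by (subst sum.swap) (simp add: Om_first_moment_cnj[OF assms] sum_distrib_left)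

text \<open>For fixed \<open>b\<close> and \<open>b'\<close> the entry of Bob's unnormalised average
  is a quadratic form in the phases. Its diagonal sum is an entry of Bob's marginal of sigma and its
  coefficients are entries of sigma, hence the two purities.\<close>

lemma meas_purity:
  fixes w :: "'x \<Rightarrow> 'b \<Rightarrow> 'c \<Rightarrow> complex"
  assumes "finite C"
  shows "(\<Sum>\<omega>\<in>Om C. \<Sum>b\<in>B. \<Sum>b'\<in>B. (cmod (\<Sum>x\<in>X. of_real (p x) * meas C (w x) \<omega> b * cnj (meas C (w x) \<omega> b')))\<^sup>2)
    \<le> real (card (Om C)) * (purB X B C p w + purBC X B C p w)"
proof -
  define M where "M b b' c c' = (\<Sum>x\<in>X. of_real (p x) * w x b c * cnj (w x b' c'))" for b b' c c'
  have M: "(\<Sum>x\<in>X. of_real (p x) * meas C (w x) \<omega> b * cnj (meas C (w x) \<omega> b')) =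
      0 + (\<Sum>c\<in>C. \<Sum>c'\<in>C. cnj (\<omega> c) * \<omega> c' * M b b' c c')" for \<omega> b b'
  proof -
    have "(\<Sum>x\<in>X. of_real (p x) * meas C (w x) \<omega> b * cnj (meas C (w x) \<omega> b')) =
      (\<Sum>x\<in>X. \<Sum>c\<in>C. \<Sum>c'\<in>C. of_real (p x) * ((cnj (\<omega> c) * w x b c) * (\<omega> c' * cnj (w x b' c'))))"
      unfolding meas_def cnj_sum mult.assoc unfolding sum_product unfolding sum_distrib_left
      by (simp add: mult_ac)
    also have "\<dots> = (\<Sum>c\<in>C. \<Sum>c'\<in>C. \<Sum>x\<in>X. of_real (p x) * ((cnj (\<omega> c) * w x b c) * (\<omega> c' * cnj (w x b' c'))))"
      by (subst sum.swap, rule sum.cong[OF refl], rule sum.swap)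
    also have "\<dots> = (\<Sum>c\<in>C. \<Sum>c'\<in>C. cnj (\<omega> c) * \<omega> c' * M b b' c c')"
      unfolding M_def sum_distrib_left by (intro sum.cong refl) (simp add: mult_ac)
    finally show ?thesis by simp
  qed
  have "(\<Sum>\<omega>\<in>Om C. \<Sum>b\<in>B. \<Sum>b'\<in>B. (cmod (\<Sum>x\<in>X. of_real (p x) * meas C (w x) \<omega> b * cnj (meas C (w x) \<omega> b')))\<^sup>2)
     = (\<Sum>b\<in>B. \<Sum>b'\<in>B. \<Sum>\<omega>\<in>Om C. (cmod (0 + (\<Sum>c\<in>C. \<Sum>c'\<in>C. cnj (\<omega> c) * \<omega> c' * M b b' c c')))\<^sup>2)"
    unfolding M by (subst sum.swap, rule sum.cong[OF refl], rule sum.swap)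
  also have "\<dots> \<le> (\<Sum>b\<in>B. \<Sum>b'\<in>B. real (card (Om C)) * ((cmod (0 + (\<Sum>c\<in>C. M b b' c c)))\<^sup>2 + (\<Sum>c\<in>C. \<Sum>c'\<in>C. (cmod (M b b' c c'))\<^sup>2)))"
    by (intro sum_mono Om_second_moment assms)
  also have "\<dots> = real (card (Om C)) * (purB X B C p w + purBC X B C p w)"
    by (simp add: purB_def purBC_def M_def sum_distrib_left sum.distrib distrib_left)
  finally show ?thesis .
qed

lemma weight_sqrt:
  assumes "0 \<le> p"
  shows "p * (cmod (ip S f v))\<^sup>2 = (cmod (ip S f (\<lambda>s. of_real (sqrt p) * v s)))\<^sup>2"
  using assms by (simp add: ip_scale_right norm_mult power_mult_distrib)

text \<open>Bounds what the existing decoding vectors capture of a fresh random codeword: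
  \<open>pons_overlap_bound\<close> for each outcome, concavity of the root over the outcomes, then
  \<open>meas_purity\<close> for the mean under the root.\<close>

lemma decode_average:
  fixes w :: "'x \<Rightarrow> 'b \<Rightarrow> 'c \<Rightarrow> complex"
  assumes fin: "finite X" "finite B" "finite C" "finite J"
    and p: "\<And>x. x \<in> X \<Longrightarrow> 0 \<le> p x"
    and e: "\<And>\<omega>. \<omega> \<in> Om C \<Longrightarrow> pons B J (e \<omega>)"
  shows "(\<Sum>x\<in>X. p x * (\<Sum>\<omega>\<in>Om C. \<Sum>j\<in>J. (cmod (ip B (e \<omega> j) (meas C (w x) \<omega>)))\<^sup>2))
     \<le> real (card (Om C)) * sqrt (real (card J) * (purB X B C p w + purBC X B C p w))"
proof -
  let ?v = "\<lambda>\<omega> x b. of_real (sqrt (p x)) * meas C (w x) \<omega> b"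
  let ?T = "\<lambda>\<omega>. \<Sum>b\<in>B. \<Sum>b'\<in>B. (cmod (\<Sum>x\<in>X. ?v \<omega> x b * cnj (?v \<omega> x b')))\<^sup>2"
  let ?n = "real (card (Om C))"
  have vv: "?v \<omega> x b * cnj (?v \<omega> x b') = of_real (p x) * meas C (w x) \<omega> b * cnj (meas C (w x) \<omega> b')" if "x \<in> X" for \<omega> x b b'
  proof -
    have "complex_of_real (sqrt (p x)) * complex_of_real (sqrt (p x)) = of_real (p x)"
      using p[OF that] by (simp flip: of_real_mult)
    then show ?thesis by (simp add: algebra_simps)
  qed
  have T: "(\<Sum>\<omega>\<in>Om C. ?T \<omega>) \<le> ?n * (purB X B C p w + purBC X B C p w)"
    using meas_purity[OF fin(3), where B = B and X = X and p = p and w = w] by (simp only: sum.cong[OF refl vv])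
  have "(\<Sum>x\<in>X. p x * (\<Sum>\<omega>\<in>Om C. \<Sum>j\<in>J. (cmod (ip B (e \<omega> j) (meas C (w x) \<omega>)))\<^sup>2)) =
     (\<Sum>x\<in>X. \<Sum>\<omega>\<in>Om C. \<Sum>j\<in>J. (cmod (ip B (e \<omega> j) (?v \<omega> x)))\<^sup>2)"
    unfolding sum_distrib_left by (intro sum.cong refl weight_sqrt p)
  also have "\<dots> = (\<Sum>\<omega>\<in>Om C. \<Sum>x\<in>X. \<Sum>j\<in>J. (cmod (ip B (e \<omega> j) (?v \<omega> x)))\<^sup>2)"
    by (rule sum.swap)
  also have "\<dots> \<le> (\<Sum>\<omega>\<in>Om C. sqrt (real (card J) * ?T \<omega>))"
    by (intro sum_mono pons_overlap_bound fin e)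
  also have "\<dots> \<le> sqrt (?n * (\<Sum>\<omega>\<in>Om C. real (card J) * ?T \<omega>))"
    by (rule sum_sqrt_le) (simp add: sum_nonneg)
  also have "\<dots> = sqrt (?n * (real (card J) * (\<Sum>\<omega>\<in>Om C. ?T \<omega>)))"
    by (simp only: sum_distrib_left)
  also have "\<dots> \<le> sqrt (?n * (real (card J) * (?n * (purB X B C p w + purBC X B C p w))))"
    using T by (intro real_sqrt_le_mono mult_left_mono) auto
  also have "\<dots> = sqrt (?n\<^sup>2 * (real (card J) * (purB X B C p w + purBC X B C p w)))"
    by (simp add: power2_eq_square mult_ac)
  also have "\<dots> = ?n * sqrt (real (card J) * (purB X B C p w + purBC X B C p w))"
    by (simp add: real_sqrt_mult)
  finally show ?thesis .
qed

lemma pur_nonneg: "0 \<le> purB X B C p w" "0 \<le> purC X B C p w" "0 \<le> purBC X B C p w"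
  by (simp_all add: purB_def purC_def purBC_def sum_nonneg)

text \<open>Each new codeword \<open>xs j\<close> is chosen after, and independently of, the vectors \<open>e \<omega> i\<close> of the earlier ones.\<close>
lemma decode_greedy:
  fixes w :: "'x \<Rightarrow> 'b \<Rightarrow> 'c \<Rightarrow> complex"
  assumes fin: "finite X" "finite B" "finite C"
    and p: "\<And>x. x \<in> X \<Longrightarrow> 0 \<le> p x" "sum p X = 1"
    and N: "N \<le> Suc N0"
  shows "\<exists>xs e. (\<forall>j<N. xs j \<in> X) \<and> (\<forall>\<omega>\<in>Om C. pons B {..<N} (e \<omega>)) \<and>
    (\<forall>j<N. real (card (Om C)) * (wt X B C p w - sqrt (real N0 * (purB X B C p w + purBC X B C p w)))
       \<le> (\<Sum>\<omega>\<in>Om C. (cmod (ip B (e \<omega> j) (meas C (w (xs j)) \<omega>)))\<^sup>2))"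
  using N
proof (induction N)
  case 0
  then show ?case by (auto simp: pons_def)
next
  case (Suc N)
  let ?n = "real (card (Om C))"
  let ?k = "purB X B C p w + purBC X B C p w"
  let ?bd = "?n * (wt X B C p w - sqrt (real N0 * ?k))"
  from Suc obtain xs e where xs: "\<forall>j<N. xs j \<in> X" and e: "\<forall>\<omega>\<in>Om C. pons B {..<N} (e \<omega>)"
    and b: "\<forall>j<N. ?bd \<le> (\<Sum>\<omega>\<in>Om C. (cmod (ip B (e \<omega> j) (meas C (w (xs j)) \<omega>)))\<^sup>2)" by auto
  define O1 where "O1 x = (\<Sum>\<omega>\<in>Om C. \<Sum>j<N. (cmod (ip B (e \<omega> j) (meas C (w x) \<omega>)))\<^sup>2)" for x
  define G where "G x = (\<Sum>\<omega>\<in>Om C. nsq B (meas C (w x) \<omega>))" for x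
  have G: "(\<Sum>x\<in>X. p x * G x) = ?n * wt X B C p w"
    unfolding G_def meas_nsq[OF fin(3)] wt_def by (simp add: sum_distrib_left mult_ac)
  have O1: "(\<Sum>x\<in>X. p x * O1 x) \<le> ?n * sqrt (real N * ?k)"
    using decode_average[OF fin, of "{..<N}" p e w] p e unfolding O1_def by simp
  \<comment> \<open>A codeword competes only with the \<open>N\<close> earlier ones, and
    \<open>N <= N0\<close>; this is why up to \<open>N0 + 1\<close> codewords obey the bound for
    \<open>N0\<close>.\<close>
  also have "\<dots> \<le> ?n * sqrt (real N0 * ?k)"
    using Suc(2) pur_nonneg(1)[of X B C p w] pur_nonneg(3)[of X B C p w]
    by (intro mult_left_mono real_sqrt_le_mono mult_right_mono) auto
  finally have "(\<Sum>x\<in>X. p x * (O1 x - G x)) \<le> - ?bd"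
    using G by (simp add: algebra_simps sum_subtractf)
  \<comment> \<open>One \<open>x\<close> is chosen for all outcomes together, since Alice does not
    know Charlie's result.\<close>
  then obtain x where x: "x \<in> X" "O1 x - G x \<le> - ?bd"
    using exists_le_average[of X p "\<lambda>x. O1 x - G x"] fin p by auto
  have "\<exists>g. pons B (insert N {..<N}) ((e \<omega>)(N := g)) \<and>
      (cmod (ip B g (meas C (w x) \<omega>)))\<^sup>2 = nsq B (meas C (w x) \<omega>) - (\<Sum>j<N. (cmod (ip B (e \<omega> j) (meas C (w x) \<omega>)))\<^sup>2)"
    if "\<omega> \<in> Om C" for \<omega>
  proof -
    have "pons B {..<N} (e \<omega>)" using e that by blast
    then show ?thesis
      using gs_step[OF fin(2) finite_lessThan, of N "e \<omega>" N "meas C (w x) \<omega>"] by blast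
  qed
  then obtain g where g: "\<And>\<omega>. \<omega> \<in> Om C \<Longrightarrow> pons B (insert N {..<N}) ((e \<omega>)(N := g \<omega>))"
     "\<And>\<omega>. \<omega> \<in> Om C \<Longrightarrow> (cmod (ip B (g \<omega>) (meas C (w x) \<omega>)))\<^sup>2 = nsq B (meas C (w x) \<omega>) - (\<Sum>j<N. (cmod (ip B (e \<omega> j) (meas C (w x) \<omega>)))\<^sup>2)"
    by metis
  define xs' where "xs' = xs(N := x)"
  define e' where "e' \<omega> = (e \<omega>)(N := g \<omega>)" for \<omega>
  have "\<forall>j<Suc N. xs' j \<in> X" using xs x by (simp add: xs'_def less_Suc_eq)
  moreover have "\<forall>\<omega>\<in>Om C. pons B {..<Suc N} (e' \<omega>)"
    using g(1) by (simp add: e'_def lessThan_Suc)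
  moreover have "?bd \<le> (\<Sum>\<omega>\<in>Om C. (cmod (ip B (e' \<omega> j) (meas C (w (xs' j)) \<omega>)))\<^sup>2)" if "j < Suc N" for j
  proof (cases "j = N")
    case True
    have "(\<Sum>\<omega>\<in>Om C. (cmod (ip B (g \<omega>) (meas C (w x) \<omega>)))\<^sup>2) = G x - O1 x"
      unfolding G_def O1_def using g(2) by (simp add: sum_subtractf)
    then show ?thesis using x True by (simp add: xs'_def e'_def)
  next
    case False
    then show ?thesis using b that by (simp add: xs'_def e'_def)
  qed
  ultimately show ?case by blast
qed

section \<open>Charlie's measurement\<close>

text \<open>Averaged over the phases \<open>\<alpha>\<close>, the rank one operator of this vector
  is the ensemble average: a pure state that imitates the mixture.\<close>

definition supst :: "'x set \<Rightarrow> ('x \<Rightarrow> real) \<Rightarrow> ('x \<Rightarrow> 'b \<Rightarrow> 'c \<Rightarrow> complex) \<Rightarrow> ('x \<Rightarrow> complex) \<Rightarrow> 'b \<Rightarrow> 'c \<Rightarrow> complex" where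
  "supst X p v \<alpha> b c = (\<Sum>x\<in>X. \<alpha> x * of_real (sqrt (p x)) * v x b c)"

lemma sqrt_weight_mult:
  "0 \<le> p \<Longrightarrow> of_real (sqrt p) * y * cnj (of_real (sqrt p) * z) = of_real p * y * cnj z"
proof -
  assume "0 \<le> p"
  then have "complex_of_real (sqrt p) * complex_of_real (sqrt p) = of_real p"
    by (simp flip: of_real_mult)
  then show ?thesis by (simp add: algebra_simps)
qed

text \<open>Reads \<open>purC\<close> as the norm of a sum of rank one operators of vectors on
  \<open>C\<close>, one for each pair of \<open>x\<close> and \<open>b\<close>, the form that
  \<open>pons_overlap_bound\<close> and \<open>gram_swap\<close> expect.\<close>

lemma purC_alt:
  assumes "\<And>x. x \<in> X \<Longrightarrow> 0 \<le> p x"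
  shows "purC X B C p v = (\<Sum>c\<in>C. \<Sum>c'\<in>C. (cmod (\<Sum>s\<in>X\<times>B. of_real (sqrt (p (fst s))) * v (fst s) (snd s) c
      * cnj (of_real (sqrt (p (fst s))) * v (fst s) (snd s) c')))\<^sup>2)"
proof -
  have "(\<Sum>s\<in>X\<times>B. of_real (sqrt (p (fst s))) * v (fst s) (snd s) c * cnj (of_real (sqrt (p (fst s))) * v (fst s) (snd s) c'))
     = (\<Sum>b\<in>B. \<Sum>x\<in>X. of_real (p x) * v x b c * cnj (v x b c'))" for c c'
  proof -
    have "(\<Sum>s\<in>X\<times>B. of_real (sqrt (p (fst s))) * v (fst s) (snd s) c * cnj (of_real (sqrt (p (fst s))) * v (fst s) (snd s) c'))
      = (\<Sum>s\<in>X\<times>B. of_real (p (fst s)) * v (fst s) (snd s) c * cnj (v (fst s) (snd s) c'))"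
      by (intro sum.cong[OF refl] sqrt_weight_mult assms) auto
    also have "\<dots> = (\<Sum>x\<in>X. \<Sum>b\<in>B. of_real (p x) * v x b c * cnj (v x b c'))"
      by (simp add: sum.cartesian_product split_def)
    also have "\<dots> = (\<Sum>b\<in>B. \<Sum>x\<in>X. of_real (p x) * v x b c * cnj (v x b c'))"
      by (rule sum.swap)
    finally show ?thesis .
  qed
  then show ?thesis unfolding purC_def by simp
qed

lemma supst_ip:
  assumes "finite X"
  shows "(\<Sum>\<alpha>\<in>Om X. (cmod (ip C f (supst X p v \<alpha> b)))\<^sup>2)
    = real (card (Om X)) * (\<Sum>x\<in>X. (cmod (ip C f (\<lambda>c. of_real (sqrt (p x)) * v x b c)))\<^sup>2)"
proof -
  have "ip C f (supst X p v \<alpha> b) = (\<Sum>x\<in>X. \<alpha> x * ip C f (\<lambda>c. of_real (sqrt (p x)) * v x b c))" for \<alpha>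
    unfolding supst_def ip_sum_right ip_scale_right by (simp add: mult.assoc)
  then show ?thesis by (simp add: Om_first_moment0[OF assms])
qed

lemma supst_nsq:
  assumes "finite X" "\<And>x. x \<in> X \<Longrightarrow> 0 \<le> p x"
  shows "(\<Sum>\<alpha>\<in>Om X. \<Sum>b\<in>B. nsq C (supst X p v \<alpha> b)) = real (card (Om X)) * wt X B C p v"
proof -
  have 1: "(\<Sum>\<alpha>\<in>Om X. (cmod (supst X p v \<alpha> b c))\<^sup>2) = real (card (Om X)) * (\<Sum>x\<in>X. p x * (cmod (v x b c))\<^sup>2)" for b c
  proof -
    have "(\<Sum>x\<in>X. (cmod (of_real (sqrt (p x)) * v x b c))\<^sup>2) = (\<Sum>x\<in>X. p x * (cmod (v x b c))\<^sup>2)"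
      using assms(2) by (intro sum.cong) (simp_all add: norm_mult power_mult_distrib)
    then show ?thesis
      using Om_first_moment0[OF assms(1), of "\<lambda>x. of_real (sqrt (p x)) * v x b c"]
      by (simp only: supst_def mult.assoc)
  qed
  have "(\<Sum>\<alpha>\<in>Om X. \<Sum>b\<in>B. nsq C (supst X p v \<alpha> b)) = (\<Sum>b\<in>B. \<Sum>c\<in>C. \<Sum>\<alpha>\<in>Om X. (cmod (supst X p v \<alpha> b c))\<^sup>2)"
    unfolding nsq_def by (subst sum.swap, rule sum.cong[OF refl], rule sum.swap)
  also have "\<dots> = real (card (Om X)) * (\<Sum>b\<in>B. \<Sum>c\<in>C. \<Sum>x\<in>X. p x * (cmod (v x b c))\<^sup>2)"
    by (simp only: 1 sum_distrib_left)
  also have "(\<Sum>b\<in>B. \<Sum>c\<in>C. \<Sum>x\<in>X. p x * (cmod (v x b c))\<^sup>2) = (\<Sum>b\<in>B. \<Sum>x\<in>X. \<Sum>c\<in>C. p x * (cmod (v x b c))\<^sup>2)"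
    by (intro sum.cong[OF refl] sum.swap)
  also have "\<dots> = (\<Sum>x\<in>X. \<Sum>b\<in>B. \<Sum>c\<in>C. p x * (cmod (v x b c))\<^sup>2)"
    by (rule sum.swap)
  also have "\<dots> = wt X B C p v"
    by (simp only: wt_def sum_distrib_left)
  finally show ?thesis .
qed

text \<open>Phase averaging replaces the superposition by the mixture, so on average Charlie's
  conditional vectors meet the earlier blocks only as much as Charlie's marginal of the ensemble
  does.\<close>

lemma supst_overlap:
  assumes fin: "finite X" "finite C" "finite J" and p: "\<And>x. x \<in> X \<Longrightarrow> 0 \<le> p x" and f: "pons C J f"
  shows "(\<Sum>\<alpha>\<in>Om X. \<Sum>b\<in>B. \<Sum>j\<in>J. (cmod (ip C (f j) (supst X p v \<alpha> b)))\<^sup>2)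
     \<le> real (card (Om X)) * sqrt (real (card J) * purC X B C p v)"
proof -
  let ?V = "\<lambda>s c. of_real (sqrt (p (fst s))) * v (fst s) (snd s) c"
  have "(\<Sum>\<alpha>\<in>Om X. \<Sum>b\<in>B. \<Sum>j\<in>J. (cmod (ip C (f j) (supst X p v \<alpha> b)))\<^sup>2)
     = (\<Sum>b\<in>B. \<Sum>j\<in>J. \<Sum>\<alpha>\<in>Om X. (cmod (ip C (f j) (supst X p v \<alpha> b)))\<^sup>2)"
    by (subst sum.swap, rule sum.cong[OF refl], rule sum.swap)
  also have "\<dots> = real (card (Om X)) * (\<Sum>b\<in>B. \<Sum>j\<in>J. \<Sum>x\<in>X. (cmod (ip C (f j) (\<lambda>c. of_real (sqrt (p x)) * v x b c)))\<^sup>2)"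
    by (simp only: supst_ip[OF fin(1)] sum_distrib_left)
  also have "(\<Sum>b\<in>B. \<Sum>j\<in>J. \<Sum>x\<in>X. (cmod (ip C (f j) (\<lambda>c. of_real (sqrt (p x)) * v x b c)))\<^sup>2)
     = (\<Sum>b\<in>B. \<Sum>x\<in>X. \<Sum>j\<in>J. (cmod (ip C (f j) (\<lambda>c. of_real (sqrt (p x)) * v x b c)))\<^sup>2)"
    by (intro sum.cong[OF refl] sum.swap)
  also have "\<dots> = (\<Sum>x\<in>X. \<Sum>b\<in>B. \<Sum>j\<in>J. (cmod (ip C (f j) (\<lambda>c. of_real (sqrt (p x)) * v x b c)))\<^sup>2)"
    by (rule sum.swap)
  also have "\<dots> = (\<Sum>s\<in>X\<times>B. \<Sum>j\<in>J. (cmod (ip C (f j) (?V s)))\<^sup>2)"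
    by (simp only: sum.cartesian_product' fst_conv snd_conv)
  also have "\<dots> \<le> sqrt (real (card J) * (\<Sum>c\<in>C. \<Sum>c'\<in>C. (cmod (\<Sum>s\<in>X\<times>B. ?V s c * cnj (?V s c')))\<^sup>2))"
    by (rule pons_overlap_bound[OF fin(2,3) f])
  also have "(\<Sum>c\<in>C. \<Sum>c'\<in>C. (cmod (\<Sum>s\<in>X\<times>B. ?V s c * cnj (?V s c')))\<^sup>2) = purC X B C p v"
    by (rule purC_alt[OF p, symmetric])
  finally show ?thesis by (simp add: mult_left_mono)
qed

text \<open>Purity of Bob's marginal of a single joint vector. Small values mean much entanglement
  with Charlie, the resource handed to the second stage.\<close>

definition bpur :: "'b set \<Rightarrow> 'c set \<Rightarrow> ('b \<Rightarrow> 'c \<Rightarrow> complex) \<Rightarrow> real" where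
  "bpur B C s = (\<Sum>b\<in>B. \<Sum>b'\<in>B. (cmod (\<Sum>c\<in>C. s b c * cnj (s b' c)))\<^sup>2)"

lemma bpur_nonneg: "0 \<le> bpur B C s"
  by (simp add: bpur_def sum_nonneg)

text \<open>Again a quadratic form in phases, now Alice's. The diagonal gives the marginal of the
  mixture, hence \<open>purB\<close>; swapping the Gram matrix turns the Hilbert-Schmidt term into
  \<open>purC\<close>. If Charlie's purity is at most Bob's, a superposition therefore at most
  doubles Bob's purity on average.\<close>

lemma supst_purity:
  assumes fin: "finite X" and p: "\<And>x. x \<in> X \<Longrightarrow> 0 \<le> p x"
  shows "(\<Sum>\<alpha>\<in>Om X. bpur B C (supst X p v \<alpha>)) \<le> real (card (Om X)) * (purB X B C p v + purC X B C p v)"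
proof -
  let ?V = "\<lambda>s c. of_real (sqrt (p (fst s))) * v (fst s) (snd s) c"
  define M where "M b b' x' x = (\<Sum>c\<in>C. ?V (x, b) c * cnj (?V (x', b') c))" for b b' x' x
  have M: "(\<Sum>c\<in>C. supst X p v \<alpha> b c * cnj (supst X p v \<alpha> b' c)) =
      0 + (\<Sum>x'\<in>X. \<Sum>x\<in>X. cnj (\<alpha> x') * \<alpha> x * M b b' x' x)" for \<alpha> b b'
  proof -
    have "(\<Sum>c\<in>C. supst X p v \<alpha> b c * cnj (supst X p v \<alpha> b' c)) =
      (\<Sum>c\<in>C. \<Sum>x\<in>X. \<Sum>x'\<in>X. (\<alpha> x * ?V (x, b) c) * cnj (\<alpha> x' * ?V (x', b') c))"
      unfolding supst_def cnj_sum sum_product by (simp add: mult.assoc)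
    also have "\<dots> = (\<Sum>x\<in>X. \<Sum>x'\<in>X. \<Sum>c\<in>C. (\<alpha> x * ?V (x, b) c) * cnj (\<alpha> x' * ?V (x', b') c))"
      by (subst sum.swap, rule sum.cong[OF refl], rule sum.swap)
    also have "\<dots> = (\<Sum>x\<in>X. \<Sum>x'\<in>X. cnj (\<alpha> x') * \<alpha> x * M b b' x' x)"
      unfolding M_def sum_distrib_left by (intro sum.cong refl) (simp add: mult_ac)
    also have "\<dots> = (\<Sum>x'\<in>X. \<Sum>x\<in>X. cnj (\<alpha> x') * \<alpha> x * M b b' x' x)"
      by (rule sum.swap)
    finally show ?thesis by simp
  qed
  have diag: "(\<Sum>x\<in>X. M b b' x x) = (\<Sum>c\<in>C. \<Sum>x\<in>X. of_real (p x) * v x b c * cnj (v x b' c))" for b b'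
  proof -
    have "(\<Sum>x\<in>X. M b b' x x) = (\<Sum>x\<in>X. \<Sum>c\<in>C. of_real (p x) * v x b c * cnj (v x b' c))"
      unfolding M_def fst_conv snd_conv by (intro sum.cong[OF refl] sqrt_weight_mult p)
    also have "\<dots> = (\<Sum>c\<in>C. \<Sum>x\<in>X. of_real (p x) * v x b c * cnj (v x b' c))" by (rule sum.swap)
    finally show ?thesis .
  qed
  have hs: "(\<Sum>b\<in>B. \<Sum>b'\<in>B. \<Sum>x'\<in>X. \<Sum>x\<in>X. (cmod (M b b' x' x))\<^sup>2) = purC X B C p v"
  proof -
    have "(\<Sum>b\<in>B. \<Sum>b'\<in>B. \<Sum>x'\<in>X. \<Sum>x\<in>X. (cmod (M b b' x' x))\<^sup>2) = (\<Sum>b\<in>B. \<Sum>b'\<in>B. \<Sum>x\<in>X. \<Sum>x'\<in>X. (cmod (M b b' x' x))\<^sup>2)"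
      by (intro sum.cong[OF refl] sum.swap)
    also have "\<dots> = (\<Sum>b\<in>B. \<Sum>x\<in>X. \<Sum>b'\<in>B. \<Sum>x'\<in>X. (cmod (M b b' x' x))\<^sup>2)"
      by (intro sum.cong[OF refl] sum.swap)
    also have "\<dots> = (\<Sum>x\<in>X. \<Sum>b\<in>B. \<Sum>b'\<in>B. \<Sum>x'\<in>X. (cmod (M b b' x' x))\<^sup>2)"
      by (rule sum.swap)
    also have "\<dots> = (\<Sum>x\<in>X. \<Sum>b\<in>B. \<Sum>x'\<in>X. \<Sum>b'\<in>B. (cmod (M b b' x' x))\<^sup>2)"
      by (intro sum.cong[OF refl] sum.swap)
    also have "\<dots> = (\<Sum>s\<in>X\<times>B. \<Sum>s'\<in>X\<times>B. (cmod (\<Sum>c\<in>C. ?V s c * cnj (?V s' c)))\<^sup>2)"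
      unfolding M_def by (simp only: sum.cartesian_product' fst_conv snd_conv)
    also have "\<dots> = (\<Sum>c\<in>C. \<Sum>c'\<in>C. (cmod (\<Sum>s\<in>X\<times>B. ?V s c * cnj (?V s c')))\<^sup>2)"
      by (rule gram_swap[symmetric])
    also have "\<dots> = purC X B C p v" by (rule purC_alt[OF p, symmetric])
    finally show ?thesis .
  qed
  have "(\<Sum>\<alpha>\<in>Om X. bpur B C (supst X p v \<alpha>)) =
     (\<Sum>b\<in>B. \<Sum>b'\<in>B. \<Sum>\<alpha>\<in>Om X. (cmod (0 + (\<Sum>x'\<in>X. \<Sum>x\<in>X. cnj (\<alpha> x') * \<alpha> x * M b b' x' x)))\<^sup>2)"
    unfolding bpur_def M by (subst sum.swap, rule sum.cong[OF refl], rule sum.swap)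
  also have "\<dots> \<le> (\<Sum>b\<in>B. \<Sum>b'\<in>B. real (card (Om X)) * ((cmod (0 + (\<Sum>x\<in>X. M b b' x x)))\<^sup>2 + (\<Sum>x'\<in>X. \<Sum>x\<in>X. (cmod (M b b' x' x))\<^sup>2)))"
    by (intro sum_mono Om_second_moment fin)
  also have "\<dots> = real (card (Om X)) * (purB X B C p v + purC X B C p v)"
    unfolding hs[symmetric] purB_def diag[symmetric]
    by (simp add: sum_distrib_left sum.distrib distrib_left)
  finally show ?thesis .
qed

text \<open>A codeword has one conditional vector on \<open>C\<close> for each \<open>b\<close>, so
  a block of \<open>card B\<close> dimensions contains them all; this is the factor in front of
  \<open>purC\<close>. Every codeword must be both distinguishable and entangled, which a single
  averaging over the sum of two normalised defects achieves.\<close>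

lemma encode_greedy:
  fixes v :: "'x \<Rightarrow> 'b \<Rightarrow> 'c \<Rightarrow> complex"
  assumes fin: "finite X" "finite B" "finite C"
    and p: "\<And>x. x \<in> X \<Longrightarrow> 0 \<le> p x"
    and sub: "\<And>\<alpha>. \<alpha> \<in> Om X \<Longrightarrow> (\<Sum>b\<in>B. nsq C (supst X p v \<alpha> b)) \<le> 1"
    and e1: "0 < e1" "1 - wt X B C p v + sqrt (real N0 * real (card B) * purC X B C p v) \<le> e1"
    and e2: "0 < e2" "purB X B C p v + purC X B C p v \<le> e2"
    and N: "N \<le> Suc N0"
  shows "\<exists>\<alpha> f. (\<forall>i<N. \<alpha> i \<in> Om X) \<and> pons C ({..<N} \<times> B) f \<and>
    (\<forall>i<N. 1 - 2 * e1 \<le> (\<Sum>b\<in>B. \<Sum>k\<in>B. (cmod (ip C (f (i, k)) (supst X p v (\<alpha> i) b)))\<^sup>2) \<and>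
       bpur B C (supst X p v (\<alpha> i)) \<le> 2 * e2)"
  using N
proof (induction N)
  case 0
  then show ?case by (auto simp: pons_def)
next
  case (Suc N)
  let ?s = "supst X p v"
  let ?J = "{..<N} \<times> B"
  let ?n = "real (card (Om X))"
  from Suc obtain \<alpha> f where \<alpha>: "\<forall>i<N. \<alpha> i \<in> Om X" and f: "pons C ?J f"
    and ih: "\<forall>i<N. 1 - 2 * e1 \<le> (\<Sum>b\<in>B. \<Sum>k\<in>B. (cmod (ip C (f (i, k)) (?s (\<alpha> i) b)))\<^sup>2) \<and>
       bpur B C (?s (\<alpha> i)) \<le> 2 * e2" by auto
  define O1 where "O1 a = (\<Sum>b\<in>B. \<Sum>j\<in>?J. (cmod (ip C (f j) (?s a b)))\<^sup>2)" for a
  define G where "G a = (\<Sum>b\<in>B. nsq C (?s a b))" for a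
  have finJ: "finite ?J" using fin by simp
  have O1: "(\<Sum>a\<in>Om X. O1 a) \<le> ?n * sqrt (real N0 * real (card B) * purC X B C p v)"
  proof -
    have "(\<Sum>a\<in>Om X. O1 a) \<le> ?n * sqrt (real (card ?J) * purC X B C p v)"
      unfolding O1_def by (rule supst_overlap[OF fin(1,3) finJ p f])
    also have "\<dots> \<le> ?n * sqrt (real N0 * real (card B) * purC X B C p v)"
      using Suc(2) pur_nonneg(2)[of X B C p v] 
      by (intro mult_left_mono real_sqrt_le_mono mult_right_mono) (auto simp: card_cartesian_product intro!: mult_right_mono)
    finally show ?thesis .
  qed
  have G: "(\<Sum>a\<in>Om X. G a) = ?n * wt X B C p v"
    unfolding G_def by (rule supst_nsq[OF fin(1) p])
  have pur: "(\<Sum>a\<in>Om X. bpur B C (?s a)) \<le> ?n * (purB X B C p v + purC X B C p v)"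
    by (rule supst_purity[OF fin(1) p])
  \<comment> \<open>Each of the two quotients has average at most 1. Both are nonnegative, so a
    choice with sum at most 2 bounds each by 2: the origin of \<open>2 * e1\<close> and
    \<open>2 * e2\<close>.\<close>
  have "\<exists>a\<in>Om X. (1 - G a + O1 a) / e1 + bpur B C (?s a) / e2 \<le> 2"
  proof (rule exists_le_uniform_average)
    show "card (Om X) > 0" using card_Om_pos[OF fin(1)] by simp
    have "(\<Sum>a\<in>Om X. (1 - G a + O1 a) / e1 + bpur B C (?s a) / e2) =
      (?n - (\<Sum>a\<in>Om X. G a) + (\<Sum>a\<in>Om X. O1 a)) / e1 + (\<Sum>a\<in>Om X. bpur B C (?s a)) / e2"
      by (simp add: sum.distrib sum_subtractf flip: sum_divide_distrib)
    also have "\<dots> \<le> (?n * e1) / e1 + (?n * e2) / e2"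
    proof (intro add_mono divide_right_mono)
      have "?n - (\<Sum>a\<in>Om X. G a) + (\<Sum>a\<in>Om X. O1 a) \<le> ?n * (1 - wt X B C p v + sqrt (real N0 * real (card B) * purC X B C p v))"
        using O1 G by (simp add: algebra_simps)
      also have "\<dots> \<le> ?n * e1" using e1 by (intro mult_left_mono) auto
      finally show "?n - (\<Sum>a\<in>Om X. G a) + (\<Sum>a\<in>Om X. O1 a) \<le> ?n * e1" .
      have "?n * (purB X B C p v + purC X B C p v) \<le> ?n * e2" using e2 by (intro mult_left_mono) auto
      then show "(\<Sum>a\<in>Om X. bpur B C (?s a)) \<le> ?n * e2" using pur by linarith
    qed (use e1 e2 in auto)
    also have "\<dots> = ?n * 2" using e1 e2 by simp
    finally show "(\<Sum>a\<in>Om X. (1 - G a + O1 a) / e1 + bpur B C (?s a) / e2) \<le> ?n * 2" .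
  qed (use fin in simp)
  then obtain a where a: "a \<in> Om X" "(1 - G a + O1 a) / e1 + bpur B C (?s a) / e2 \<le> 2" by blast
  \<comment> \<open>The hypothesis \<open>sub\<close> enters here: the superpositions have norm at
    most 1, so the first defect is not negative.\<close>
  have nn: "0 \<le> (1 - G a + O1 a) / e1" "0 \<le> bpur B C (?s a) / e2"
    using sub[OF a(1)] e1 e2 by (auto simp: G_def O1_def bpur_nonneg intro!: divide_nonneg_pos add_nonneg_nonneg sum_nonneg)
  have a1: "1 - G a + O1 a \<le> 2 * e1" and a2: "bpur B C (?s a) \<le> 2 * e2"
    using a(2) nn e1(1) e2(1) pos_divide_le_eq[of e1 "1 - G a + O1 a" 2] pos_divide_le_eq[of e2 "bpur B C (?s a)" 2]
    by linarith+
  let ?K = "{N} \<times> B"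
  \<comment> \<open>The new block completes the capture of all conditional vectors, so its own share
    is exactly what the earlier blocks missed.\<close>
  obtain g where g: "pons C (?J \<union> ?K) g" "\<forall>j\<in>?J. g j = f j"
    "\<forall>k\<in>?K. (\<Sum>j\<in>?J \<union> ?K. (cmod (ip C (g j) (?s a (snd k))))\<^sup>2) = nsq C (?s a (snd k))"
    using gs_extend[OF fin(3) finJ f, of ?K "\<lambda>k. ?s a (snd k)"] fin by auto
  have JK: "?J \<union> ?K = {..<Suc N} \<times> B" by auto
  have new: "(\<Sum>k\<in>B. (cmod (ip C (g (N, k)) (?s a b)))\<^sup>2) = nsq C (?s a b) - (\<Sum>j\<in>?J. (cmod (ip C (f j) (?s a b)))\<^sup>2)" if "b \<in> B" for b
  proof -
    have "nsq C (?s a b) = (\<Sum>j\<in>?J \<union> ?K. (cmod (ip C (g j) (?s a b)))\<^sup>2)"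
      using g(3) that by auto
    also have "\<dots> = (\<Sum>j\<in>?J. (cmod (ip C (g j) (?s a b)))\<^sup>2) + (\<Sum>j\<in>?K. (cmod (ip C (g j) (?s a b)))\<^sup>2)"
      using fin by (intro sum.union_disjoint) auto
    also have "(\<Sum>j\<in>?J. (cmod (ip C (g j) (?s a b)))\<^sup>2) = (\<Sum>j\<in>?J. (cmod (ip C (f j) (?s a b)))\<^sup>2)"
      using g(2) by (intro sum.cong) auto
    also have "(\<Sum>j\<in>?K. (cmod (ip C (g j) (?s a b)))\<^sup>2) = (\<Sum>k\<in>B. (cmod (ip C (g (N, k)) (?s a b)))\<^sup>2)"
      by (simp add: sum.cartesian_product')
    finally show ?thesis by simp
  qed
  have newS: "(\<Sum>b\<in>B. \<Sum>k\<in>B. (cmod (ip C (g (N, k)) (?s a b)))\<^sup>2) = G a - O1 a"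
    unfolding G_def O1_def using new by (simp add: sum_subtractf)
  define \<alpha>' where "\<alpha>' = \<alpha>(N := a)"
  have "\<forall>i<Suc N. \<alpha>' i \<in> Om X" using \<alpha> a by (simp add: \<alpha>'_def less_Suc_eq)
  moreover have "pons C ({..<Suc N} \<times> B) g" using g(1) JK by simp
  moreover have "1 - 2 * e1 \<le> (\<Sum>b\<in>B. \<Sum>k\<in>B. (cmod (ip C (g (i, k)) (?s (\<alpha>' i) b)))\<^sup>2) \<and>
       bpur B C (?s (\<alpha>' i)) \<le> 2 * e2" if "i < Suc N" for i
  proof (cases "i = N")
    case True
    then show ?thesis using newS a1 a2 by (simp add: \<alpha>'_def)
  next
    case False
    then have "i < N" using that by simp
    moreover from this have "(\<Sum>b\<in>B. \<Sum>k\<in>B. (cmod (ip C (g (i, k)) (?s (\<alpha>' i) b)))\<^sup>2) =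
       (\<Sum>b\<in>B. \<Sum>k\<in>B. (cmod (ip C (f (i, k)) (?s (\<alpha> i) b)))\<^sup>2)"
      using g(2) False by (intro sum.cong refl) (simp add: \<alpha>'_def)
    ultimately show ?thesis using ih False by (simp add: \<alpha>'_def)
  qed
  ultimately show ?case by blast
qed

section \<open>Marginals of a tripartite pure state\<close>

text \<open>Squared Hilbert-Schmidt norm of the sum of the rank one operators of the
  \<open>g s\<close>: a common form for the three purities, with the traced out indices as
  \<open>s\<close>.\<close>

definition hs :: "'s set \<Rightarrow> 'b set \<Rightarrow> ('s \<Rightarrow> 'b \<Rightarrow> complex) \<Rightarrow> real" where
  "hs S B g = (\<Sum>b\<in>B. \<Sum>b'\<in>B. (cmod (\<Sum>s\<in>S. g s b * cnj (g s b')))\<^sup>2)"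

lemma hs_swap: "hs S B g = (\<Sum>s\<in>S. \<Sum>s'\<in>S. (cmod (\<Sum>b\<in>B. g s b * cnj (g s' b)))\<^sup>2)"
  unfolding hs_def by (rule gram_swap)

text \<open>Seen through the Gram matrix, removing or nullifying vectors only deletes entries, so
  the norm cannot grow. The operator itself does not shrink entry by entry.\<close>

lemma hs_mono:
  assumes "finite S'" "S \<subseteq> S'" "\<And>s. s \<in> S \<Longrightarrow> (\<forall>b\<in>B. g s b = h s b) \<or> (\<forall>b\<in>B. g s b = 0)"
  shows "hs S B g \<le> hs S' B h"
proof -
  have "(\<Sum>s\<in>S. \<Sum>s'\<in>S. (cmod (\<Sum>b\<in>B. g s b * cnj (g s' b)))\<^sup>2) \<le> (\<Sum>s\<in>S. \<Sum>s'\<in>S. (cmod (\<Sum>b\<in>B. h s b * cnj (h s' b)))\<^sup>2)"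
  proof (intro sum_mono)
    fix s s' assume s: "s \<in> S" "s' \<in> S"
    have "(\<Sum>b\<in>B. g s b * cnj (g s' b)) = (\<Sum>b\<in>B. h s b * cnj (h s' b)) \<or> (\<Sum>b\<in>B. g s b * cnj (g s' b)) = 0"
      using assms(3)[OF s(1)] assms(3)[OF s(2)] by auto
    then show "(cmod (\<Sum>b\<in>B. g s b * cnj (g s' b)))\<^sup>2 \<le> (cmod (\<Sum>b\<in>B. h s b * cnj (h s' b)))\<^sup>2"
      by auto
  qed
  also have "\<dots> \<le> (\<Sum>s\<in>S'. \<Sum>s'\<in>S'. (cmod (\<Sum>b\<in>B. h s b * cnj (h s' b)))\<^sup>2)"
    using assms(1,2) by (intro order_trans[OF sum_mono[OF sum_mono2] sum_mono2]) (auto intro: sum_nonneg)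
  finally show ?thesis by (simp only: hs_swap)
qed

lemma hs_mono2:
  assumes "finite B'" "B \<subseteq> B'"
  shows "hs S B g \<le> hs S B' g"
  unfolding hs_def
  using assms by (intro order_trans[OF sum_mono[OF sum_mono2] sum_mono2]) (auto intro: sum_nonneg)

lemma purB_hs:
  assumes "\<And>x. x \<in> X \<Longrightarrow> 0 \<le> p x"
  shows "purB X B C p w = hs (C \<times> X) B (\<lambda>s b. of_real (sqrt (p (snd s))) * w (snd s) b (fst s))"
proof -
  have "(\<Sum>s\<in>C\<times>X. of_real (sqrt (p (snd s))) * w (snd s) b (fst s) * cnj (of_real (sqrt (p (snd s))) * w (snd s) b' (fst s)))
    = (\<Sum>c\<in>C. \<Sum>x\<in>X. of_real (p x) * w x b c * cnj (w x b' c))" for b b'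
    unfolding sum.cartesian_product' fst_conv snd_conv by (intro sum.cong[OF refl] sqrt_weight_mult assms)
  then show ?thesis by (simp only: purB_def hs_def)
qed

lemma purC_hs:
  assumes "\<And>x. x \<in> X \<Longrightarrow> 0 \<le> p x"
  shows "purC X B C p w = hs (B \<times> X) C (\<lambda>s c. of_real (sqrt (p (snd s))) * w (snd s) (fst s) c)"
proof -
  have "(\<Sum>s\<in>B\<times>X. of_real (sqrt (p (snd s))) * w (snd s) (fst s) c * cnj (of_real (sqrt (p (snd s))) * w (snd s) (fst s) c'))
    = (\<Sum>b\<in>B. \<Sum>x\<in>X. of_real (p x) * w x b c * cnj (w x b c'))" for c c'
    unfolding sum.cartesian_product' fst_conv snd_conv by (intro sum.cong[OF refl] sqrt_weight_mult assms)
  then show ?thesis by (simp only: purC_def hs_def)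
qed

lemma purBC_hs:
  assumes "\<And>x. x \<in> X \<Longrightarrow> 0 \<le> p x"
  shows "purBC X B C p w = hs X (B \<times> C) (\<lambda>x z. of_real (sqrt (p x)) * w x (fst z) (snd z))"
proof -
  have 1: "(\<Sum>x\<in>X. of_real (sqrt (p x)) * w x b c * cnj (of_real (sqrt (p x)) * w x b' c'))
    = (\<Sum>x\<in>X. of_real (p x) * w x b c * cnj (w x b' c'))" for b b' c c'
    by (intro sum.cong[OF refl] sqrt_weight_mult assms)
  show ?thesis unfolding purBC_def hs_def sum.cartesian_product' fst_conv snd_conv 1
    by (intro sum.cong[OF refl] sum.swap)
qed

text \<open>Amplitudes, in the eigenbases of the three marginals, of an isometry applied to one half
  of a purification of a state with spectrum \<open>p\<close>; \<open>q\<close> and \<open>r\<close> are the output spectra.\<close>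
locale tripartite =
  fixes X :: "'x set" and B :: "'b set" and C :: "'c set"
    and p :: "'x \<Rightarrow> real" and q :: "'b \<Rightarrow> real" and r :: "'c \<Rightarrow> real"
    and u :: "'x \<Rightarrow> 'b \<Rightarrow> 'c \<Rightarrow> complex"
  assumes fin: "finite X" "finite B" "finite C"
    and p_nonneg: "\<And>x. x \<in> X \<Longrightarrow> 0 \<le> p x" and p_sum: "sum p X = 1"
    and iso: "\<And>x x'. x \<in> X \<Longrightarrow> x' \<in> X \<Longrightarrow> (\<Sum>b\<in>B. \<Sum>c\<in>C. u x b c * cnj (u x' b c)) = (if x = x' then 1 else 0)"
    and margB: "\<And>b b'. b \<in> B \<Longrightarrow> b' \<in> B \<Longrightarrow>
      (\<Sum>c\<in>C. \<Sum>x\<in>X. of_real (p x) * u x b c * cnj (u x b' c)) = (if b = b' then of_real (q b) else 0)"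
    and margC: "\<And>c c'. c \<in> C \<Longrightarrow> c' \<in> C \<Longrightarrow>
      (\<Sum>b\<in>B. \<Sum>x\<in>X. of_real (p x) * u x b c * cnj (u x b c')) = (if c = c' then of_real (r c) else 0)"
begin

lemma iso_sq: "x \<in> X \<Longrightarrow> (\<Sum>b\<in>B. \<Sum>c\<in>C. (cmod (u x b c))\<^sup>2) = 1"
proof -
  assume "x \<in> X"
  from iso[OF this this] have "complex_of_real (\<Sum>b\<in>B. \<Sum>c\<in>C. (cmod (u x b c))\<^sup>2) = of_real 1"
    by (simp add: complex_norm_square del: of_real_power)
  then show ?thesis using of_real_eq_iff by blast
qed

lemma margB_sq: "b \<in> B \<Longrightarrow> (\<Sum>c\<in>C. \<Sum>x\<in>X. p x * (cmod (u x b c))\<^sup>2) = q b"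
proof -
  assume "b \<in> B"
  from margB[OF this this] have "complex_of_real (\<Sum>c\<in>C. \<Sum>x\<in>X. p x * (cmod (u x b c))\<^sup>2) = of_real (q b)"
    by (simp add: complex_norm_square mult.assoc del: of_real_power)
  then show ?thesis using of_real_eq_iff by blast
qed

lemma margC_sq: "c \<in> C \<Longrightarrow> (\<Sum>b\<in>B. \<Sum>x\<in>X. p x * (cmod (u x b c))\<^sup>2) = r c"
proof -
  assume "c \<in> C"
  from margC[OF this this] have "complex_of_real (\<Sum>b\<in>B. \<Sum>x\<in>X. p x * (cmod (u x b c))\<^sup>2) = of_real (r c)"
    by (simp add: complex_norm_square mult.assoc del: of_real_power)
  then show ?thesis using of_real_eq_iff by blast
qed

lemma q_nonneg: "b \<in> B \<Longrightarrow> 0 \<le> q b"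
  by (subst margB_sq[symmetric]) (auto intro!: sum_nonneg mult_nonneg_nonneg p_nonneg)

lemma r_nonneg: "c \<in> C \<Longrightarrow> 0 \<le> r c"
  by (subst margC_sq[symmetric]) (auto intro!: sum_nonneg mult_nonneg_nonneg p_nonneg)

text \<open>A genuine joint distribution of the three eigenbasis labels, with marginals
  \<open>p\<close>, \<open>q\<close> and \<open>r\<close>. It makes typical truncation a classical
  union bound and carries the entropy inequalities.\<close>

definition T :: "'x \<Rightarrow> 'b \<Rightarrow> 'c \<Rightarrow> real" where "T x b c = p x * (cmod (u x b c))\<^sup>2"

lemma T_nonneg: "x \<in> X \<Longrightarrow> 0 \<le> T x b c" by (simp add: T_def p_nonneg)

lemma T_X: "x \<in> X \<Longrightarrow> (\<Sum>b\<in>B. \<Sum>c\<in>C. T x b c) = p x"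
  unfolding T_def using iso_sq by (simp flip: sum_distrib_left)

lemma T_B: "b \<in> B \<Longrightarrow> (\<Sum>c\<in>C. \<Sum>x\<in>X. T x b c) = q b"
  unfolding T_def by (rule margB_sq)

lemma T_C: "c \<in> C \<Longrightarrow> (\<Sum>b\<in>B. \<Sum>x\<in>X. T x b c) = r c"
  unfolding T_def by (rule margC_sq)

lemma T_swapB: "(\<Sum>x\<in>X'. \<Sum>b\<in>B'. \<Sum>c\<in>C'. T x b c) = (\<Sum>b\<in>B'. \<Sum>c\<in>C'. \<Sum>x\<in>X'. T x b c)"
  by (subst sum.swap, rule sum.cong[OF refl], rule sum.swap)

lemma T_swapC: "(\<Sum>x\<in>X'. \<Sum>b\<in>B'. \<Sum>c\<in>C'. T x b c) = (\<Sum>c\<in>C'. \<Sum>b\<in>B'. \<Sum>x\<in>X'. T x b c)"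
  unfolding T_swapB by (rule sum.swap)

lemma q_sum: "sum q B = 1"
proof -
  have "sum q B = (\<Sum>x\<in>X. \<Sum>b\<in>B. \<Sum>c\<in>C. T x b c)" unfolding T_swapB using T_B by simp
  also have "\<dots> = 1" using T_X p_sum by simp
  finally show ?thesis .
qed

lemma r_sum: "sum r C = 1"
proof -
  have "sum r C = (\<Sum>x\<in>X. \<Sum>b\<in>B. \<Sum>c\<in>C. T x b c)" unfolding T_swapC using T_C by simp
  also have "\<dots> = 1" using T_X p_sum by simp
  finally show ?thesis .
qed

text \<open>Atypical \<open>x\<close> get the zero vector but stay in \<open>X\<close>, so the
  weights \<open>p\<close> remain a probability distribution.\<close>

definition restr :: "'x set \<Rightarrow> 'x \<Rightarrow> 'b \<Rightarrow> 'c \<Rightarrow> complex" where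
  "restr X0 x b c = (if x \<in> X0 then u x b c else 0)"

text \<open>Union bound: a triple outside the box violates one of the three restrictions.\<close>

lemma sum3_split:
  assumes "X0 \<subseteq> X" "B0 \<subseteq> B" "C0 \<subseteq> C"
  shows "(\<Sum>x\<in>X. \<Sum>b\<in>B. \<Sum>c\<in>C. T x b c) \<le> (\<Sum>x\<in>X0. \<Sum>b\<in>B0. \<Sum>c\<in>C0. T x b c)
     + (\<Sum>x\<in>X-X0. \<Sum>b\<in>B. \<Sum>c\<in>C. T x b c) + (\<Sum>x\<in>X. \<Sum>b\<in>B-B0. \<Sum>c\<in>C. T x b c) + (\<Sum>x\<in>X. \<Sum>b\<in>B. \<Sum>c\<in>C-C0. T x b c)"
proof -
  have spB: "sum F B = sum F B0 + sum F (B - B0)" for F :: "'b \<Rightarrow> real"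
    by (subst sum.subset_diff[OF assms(2) fin(2)]) (rule add.commute)
  have spC: "sum F C = sum F C0 + sum F (C - C0)" for F :: "'c \<Rightarrow> real"
    by (subst sum.subset_diff[OF assms(3) fin(3)]) (rule add.commute)
  have "(\<Sum>x\<in>X. \<Sum>b\<in>B. \<Sum>c\<in>C. T x b c) = (\<Sum>x\<in>X0. \<Sum>b\<in>B. \<Sum>c\<in>C. T x b c) + (\<Sum>x\<in>X-X0. \<Sum>b\<in>B. \<Sum>c\<in>C. T x b c)"
    by (subst sum.subset_diff[OF assms(1) fin(1)]) (rule add.commute)
  moreover have "(\<Sum>x\<in>X0. \<Sum>b\<in>B. \<Sum>c\<in>C. T x b c) = (\<Sum>x\<in>X0. \<Sum>b\<in>B0. \<Sum>c\<in>C. T x b c) + (\<Sum>x\<in>X0. \<Sum>b\<in>B-B0. \<Sum>c\<in>C. T x b c)"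
    by (simp only: spB sum.distrib)
  moreover have "(\<Sum>x\<in>X0. \<Sum>b\<in>B0. \<Sum>c\<in>C. T x b c) = (\<Sum>x\<in>X0. \<Sum>b\<in>B0. \<Sum>c\<in>C0. T x b c) + (\<Sum>x\<in>X0. \<Sum>b\<in>B0. \<Sum>c\<in>C-C0. T x b c)"
    by (simp only: spC sum.distrib)
  moreover have "(\<Sum>x\<in>X0. \<Sum>b\<in>B-B0. \<Sum>c\<in>C. T x b c) \<le> (\<Sum>x\<in>X. \<Sum>b\<in>B-B0. \<Sum>c\<in>C. T x b c)"
    using assms fin by (intro sum_mono2) (auto intro!: sum_nonneg T_nonneg)
  moreover have "(\<Sum>x\<in>X0. \<Sum>b\<in>B0. \<Sum>c\<in>C-C0. T x b c) \<le> (\<Sum>x\<in>X. \<Sum>b\<in>B. \<Sum>c\<in>C-C0. T x b c)"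
  proof -
    have "(\<Sum>x\<in>X0. \<Sum>b\<in>B0. \<Sum>c\<in>C-C0. T x b c) \<le> (\<Sum>x\<in>X0. \<Sum>b\<in>B. \<Sum>c\<in>C-C0. T x b c)"
      using assms fin by (intro sum_mono sum_mono2) (auto intro!: sum_nonneg T_nonneg)
    also have "\<dots> \<le> (\<Sum>x\<in>X. \<Sum>b\<in>B. \<Sum>c\<in>C-C0. T x b c)"
      using assms fin by (intro sum_mono2) (auto intro!: sum_nonneg T_nonneg)
    finally show ?thesis .
  qed
  ultimately show ?thesis by linarith
qed

lemma wt_restr:
  assumes "X0 \<subseteq> X"
  shows "wt X B0 C0 p (restr X0) = (\<Sum>x\<in>X0. \<Sum>b\<in>B0. \<Sum>c\<in>C0. T x b c)"
proof -
  have "wt X B0 C0 p (restr X0) = (\<Sum>x\<in>X. if x \<in> X0 then (\<Sum>b\<in>B0. \<Sum>c\<in>C0. T x b c) else 0)"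
    unfolding wt_def by (intro sum.cong) (auto simp: restr_def T_def sum_distrib_left)
  also have "\<dots> = (\<Sum>x\<in>X0. \<Sum>b\<in>B0. \<Sum>c\<in>C0. T x b c)"
    using assms fin by (simp add: sum.If_cases Int_absorb1)
  finally show ?thesis .
qed

lemma wt_restr_ge:
  assumes "X0 \<subseteq> X" "B0 \<subseteq> B" "C0 \<subseteq> C"
  shows "1 - sum p (X - X0) - sum q (B - B0) - sum r (C - C0) \<le> wt X B0 C0 p (restr X0)"
proof -
  have "(\<Sum>x\<in>X. \<Sum>b\<in>B. \<Sum>c\<in>C. T x b c) = 1" using T_X p_sum by simp
  moreover have "(\<Sum>x\<in>X-X0. \<Sum>b\<in>B. \<Sum>c\<in>C. T x b c) = sum p (X - X0)" using T_X by simp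
  moreover have "(\<Sum>x\<in>X. \<Sum>b\<in>B-B0. \<Sum>c\<in>C. T x b c) = sum q (B - B0)" unfolding T_swapB using T_B by simp
  moreover have "(\<Sum>x\<in>X. \<Sum>b\<in>B. \<Sum>c\<in>C-C0. T x b c) = sum r (C - C0)" unfolding T_swapC using T_C by simp
  ultimately show ?thesis using sum3_split[OF assms] wt_restr[OF assms(1)] by simp
qed

lemma wt_restr_le:
  assumes "X0 \<subseteq> X" "B0 \<subseteq> B" "C0 \<subseteq> C"
  shows "wt X B0 C0 p (restr X0) \<le> 1"
proof -
  have "(\<Sum>x\<in>X0. \<Sum>b\<in>B0. \<Sum>c\<in>C0. T x b c) \<le> (\<Sum>x\<in>X0. \<Sum>b\<in>B. \<Sum>c\<in>C. T x b c)"
  proof (rule sum_mono)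
    fix x assume x: "x \<in> X0"
    have "(\<Sum>b\<in>B0. \<Sum>c\<in>C0. T x b c) \<le> (\<Sum>b\<in>B0. \<Sum>c\<in>C. T x b c)"
      using assms fin x by (intro sum_mono sum_mono2) (auto intro!: T_nonneg)
    also have "\<dots> \<le> (\<Sum>b\<in>B. \<Sum>c\<in>C. T x b c)"
      using assms fin x by (intro sum_mono2) (auto intro!: sum_nonneg T_nonneg)
    finally show "(\<Sum>b\<in>B0. \<Sum>c\<in>C0. T x b c) \<le> (\<Sum>b\<in>B. \<Sum>c\<in>C. T x b c)" .
  qed
  also have "\<dots> \<le> (\<Sum>x\<in>X. \<Sum>b\<in>B. \<Sum>c\<in>C. T x b c)"
    using assms fin by (intro sum_mono2) (auto intro!: sum_nonneg T_nonneg)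
  also have "\<dots> = 1" using T_X p_sum by simp
  finally show ?thesis using wt_restr[OF assms(1)] by simp
qed

text \<open>Discarding values of the traced out \<open>x\<close> and \<open>c\<close> can only lower
  the purity, by \<open>hs_mono\<close>; the marginal that results from keeping all of them is
  diagonal with entries \<open>q\<close>.\<close>

lemma purB_restr:
  assumes "B0 \<subseteq> B" "C0 \<subseteq> C"
  shows "purB X B0 C0 p (restr X0) \<le> (\<Sum>b\<in>B0. (q b)\<^sup>2)"
proof -
  have "purB X B0 C0 p (restr X0) \<le> purB X B0 C p u"
  proof -
    have H: "purB X B0 C' p w = hs (C' \<times> X) B0 (\<lambda>s b. of_real (sqrt (p (snd s))) * w (snd s) b (fst s))" for C' w
      by (rule purB_hs) (rule p_nonneg)
    show ?thesis unfolding H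
      using assms fin by (intro hs_mono) (auto simp: restr_def)
  qed
  also have "\<dots> = (\<Sum>b\<in>B0. \<Sum>b'\<in>B0. if b = b' then (q b)\<^sup>2 else 0)"
    unfolding purB_def using assms by (intro sum.cong refl) (auto simp: margB subset_eq)
  also have "\<dots> = (\<Sum>b\<in>B0. (q b)\<^sup>2)"
    using finite_subset[OF assms(1) fin(2)] by simp
  finally show ?thesis .
qed

lemma purC_restr:
  assumes "B0 \<subseteq> B" "C0 \<subseteq> C"
  shows "purC X B0 C0 p (restr X0) \<le> (\<Sum>c\<in>C0. (r c)\<^sup>2)"
proof -
  have "purC X B0 C0 p (restr X0) \<le> purC X B C0 p u"
  proof -
    have H: "purC X B' C0 p w = hs (B' \<times> X) C0 (\<lambda>s c. of_real (sqrt (p (snd s))) * w (snd s) (fst s) c)" for B' w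
      by (rule purC_hs) (rule p_nonneg)
    show ?thesis unfolding H
      using assms fin by (intro hs_mono) (auto simp: restr_def)
  qed
  also have "\<dots> = (\<Sum>c\<in>C0. \<Sum>c'\<in>C0. if c = c' then (r c)\<^sup>2 else 0)"
    unfolding purC_def using assms by (intro sum.cong refl) (auto simp: margC subset_eq)
  also have "\<dots> = (\<Sum>c\<in>C0. (r c)\<^sup>2)"
    using finite_subset[OF assms(2) fin(3)] by simp
  finally show ?thesis .
qed

text \<open>Enlarging to the full \<open>B\<close> and \<open>C\<close> restores the isometry, and
  then the Gram matrix of the weighted outputs is diagonal with entries \<open>p\<close>.\<close>

lemma purBC_restr:
  assumes "X0 \<subseteq> X" "B0 \<subseteq> B" "C0 \<subseteq> C"
  shows "purBC X B0 C0 p (restr X0) \<le> (\<Sum>x\<in>X0. (p x)\<^sup>2)"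
proof -
  let ?g = "\<lambda>x z. of_real (sqrt (p x)) * u x (fst z) (snd z)"
  let ?h = "\<lambda>x z. of_real (sqrt (p x)) * restr X0 x (fst z) (snd z)"
  have finX0: "finite X0" using assms(1) fin(1) by (rule finite_subset)
  have "purBC X B0 C0 p (restr X0) = hs X (B0 \<times> C0) ?h"
    by (rule purBC_hs[OF p_nonneg])
  also have "\<dots> \<le> hs X (B \<times> C) ?h"
    using assms fin by (intro hs_mono2) auto
  also have "\<dots> = hs X0 (B \<times> C) ?g"
  proof -
    have "(\<Sum>x\<in>X. ?h x z * cnj (?h x z')) = (\<Sum>x\<in>X0. ?g x z * cnj (?g x z'))" for z z'
    proof -
      have "(\<Sum>x\<in>X. ?h x z * cnj (?h x z')) = (\<Sum>x\<in>X. if x \<in> X0 then ?g x z * cnj (?g x z') else 0)"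
        by (intro sum.cong) (auto simp: restr_def)
      also have "\<dots> = (\<Sum>x\<in>X0. ?g x z * cnj (?g x z'))"
        using assms fin by (simp add: sum.If_cases Int_absorb1)
      finally show ?thesis .
    qed
    then show ?thesis by (simp only: hs_def)
  qed
  also have "\<dots> = (\<Sum>x\<in>X0. \<Sum>x'\<in>X0. if x' = x then (p x)\<^sup>2 else 0)"
    unfolding hs_swap
  proof (intro sum.cong refl)
    fix x x' assume "x \<in> X0" "x' \<in> X0"
    then have x: "x \<in> X" "x' \<in> X" using assms by auto
    have "(\<Sum>z\<in>B\<times>C. ?g x z * cnj (?g x' z)) = of_real (sqrt (p x) * sqrt (p x')) * (\<Sum>b\<in>B. \<Sum>c\<in>C. u x b c * cnj (u x' b c))"
      unfolding sum.cartesian_product' by (simp add: sum_distrib_left mult_ac)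
    also have "\<dots> = (if x' = x then of_real (p x) else 0)"
      using iso[OF x] p_nonneg[OF x(1)] by (auto simp flip: of_real_mult)
    finally show "(cmod (\<Sum>z\<in>B\<times>C. ?g x z * cnj (?g x' z)))\<^sup>2 = (if x' = x then (p x)\<^sup>2 else 0)"
      by simp
  qed
  also have "\<dots> = (\<Sum>x\<in>X0. (p x)\<^sup>2)" using finX0 by simp
  finally show ?thesis .
qed

lemma iso_norm:
  "(\<Sum>b\<in>B. \<Sum>c\<in>C. (cmod (\<Sum>x\<in>X. a x * u x b c))\<^sup>2) = (\<Sum>x\<in>X. (cmod (a x))\<^sup>2)"
proof -
  have "complex_of_real (\<Sum>b\<in>B. \<Sum>c\<in>C. (cmod (\<Sum>x\<in>X. a x * u x b c))\<^sup>2) =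
    (\<Sum>b\<in>B. \<Sum>c\<in>C. \<Sum>x\<in>X. \<Sum>x'\<in>X. (a x * u x b c) * cnj (a x' * u x' b c))"
    by (simp only: of_real_sum of_real_cmod_sum_sq)
  also have "\<dots> = (\<Sum>b\<in>B. \<Sum>x\<in>X. \<Sum>x'\<in>X. \<Sum>c\<in>C. (a x * u x b c) * cnj (a x' * u x' b c))"
    by (rule sum.cong[OF refl], subst sum.swap, rule sum.cong[OF refl], rule sum.swap)
  also have "\<dots> = (\<Sum>x\<in>X. \<Sum>x'\<in>X. \<Sum>b\<in>B. \<Sum>c\<in>C. (a x * u x b c) * cnj (a x' * u x' b c))"
    by (subst sum.swap, rule sum.cong[OF refl], rule sum.swap)
  also have "\<dots> = (\<Sum>x\<in>X. \<Sum>x'\<in>X. a x * cnj (a x') * (\<Sum>b\<in>B. \<Sum>c\<in>C. u x b c * cnj (u x' b c)))"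
    by (simp add: sum_distrib_left mult_ac)
  also have "\<dots> = (\<Sum>x\<in>X. \<Sum>x'\<in>X. if x' = x then a x * cnj (a x) else 0)"
    by (intro sum.cong refl) (auto simp: iso)
  also have "\<dots> = complex_of_real (\<Sum>x\<in>X. (cmod (a x))\<^sup>2)"
    using fin by (simp add: complex_norm_square del: of_real_power)
  finally show ?thesis using of_real_eq_iff by blast
qed

lemma supst_restr_le:
  assumes "X0 \<subseteq> X" "B0 \<subseteq> B" "C0 \<subseteq> C" "\<alpha> \<in> Om X"
  shows "(\<Sum>b\<in>B0. nsq C0 (supst X p (restr X0) \<alpha> b)) \<le> 1"
proof -
  define a where "a x = (if x \<in> X0 then \<alpha> x * of_real (sqrt (p x)) else 0)" for x
  have s: "supst X p (restr X0) \<alpha> b c = (\<Sum>x\<in>X. a x * u x b c)" for b c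
    unfolding supst_def by (intro sum.cong) (auto simp: a_def restr_def)
  have "(\<Sum>b\<in>B0. nsq C0 (supst X p (restr X0) \<alpha> b)) \<le> (\<Sum>b\<in>B0. \<Sum>c\<in>C. (cmod (\<Sum>x\<in>X. a x * u x b c))\<^sup>2)"
    unfolding nsq_def s using assms fin by (intro sum_mono sum_mono2) auto
  also have "\<dots> \<le> (\<Sum>b\<in>B. \<Sum>c\<in>C. (cmod (\<Sum>x\<in>X. a x * u x b c))\<^sup>2)"
    using assms fin by (intro sum_mono2) (auto intro: sum_nonneg)
  also have "\<dots> = (\<Sum>x\<in>X. (cmod (a x))\<^sup>2)" by (rule iso_norm)
  also have "\<dots> \<le> (\<Sum>x\<in>X. p x)"
    using assms(4) p_nonneg by (intro sum_mono) (auto simp: a_def norm_mult power_mult_distrib Om_norm)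
  also have "\<dots> = 1" by (rule p_sum)
  finally show ?thesis .
qed

end

section \<open>One-shot codes\<close>

text \<open>A projection on Charlie's side compresses his marginal from left and right, and each
  side costs one application of Bessel's inequality; \<open>gram_swap\<close> passes between the two
  marginals.\<close>

lemma pons_proj_bpur:
  assumes "finite C" "finite K" "pons C K f"
  shows "bpur B K (\<lambda>b k. ip C (f k) (s b)) \<le> bpur B C s"
proof -
  let ?t = "\<lambda>b k. ip C (f k) (s b)"
  have "bpur B K ?t = (\<Sum>k\<in>K. \<Sum>k'\<in>K. (cmod (\<Sum>b\<in>B. ?t b k * cnj (?t b k')))\<^sup>2)"
    unfolding bpur_def by (rule gram_swap)
  also have "\<dots> = (\<Sum>k'\<in>K. \<Sum>k\<in>K. (cmod (\<Sum>b\<in>B. ?t b k * cnj (?t b k')))\<^sup>2)"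
    by (rule sum.swap)
  also have "\<dots> = (\<Sum>k'\<in>K. \<Sum>k\<in>K. (cmod (ip C (f k) (\<lambda>c. \<Sum>b\<in>B. cnj (?t b k') * s b c)))\<^sup>2)"
    by (simp only: ip_sum_right) (simp only: mult.commute)
  also have "\<dots> \<le> (\<Sum>k'\<in>K. nsq C (\<lambda>c. \<Sum>b\<in>B. cnj (?t b k') * s b c))"
    by (intro sum_mono bessel assms)
  also have "\<dots> = (\<Sum>c\<in>C. \<Sum>k'\<in>K. (cmod (\<Sum>b\<in>B. cnj (?t b k') * s b c))\<^sup>2)"
    unfolding nsq_def by (rule sum.swap)
  also have "\<dots> = (\<Sum>c\<in>C. \<Sum>k'\<in>K. (cmod (ip C (f k') (\<lambda>c'. \<Sum>b\<in>B. cnj (s b c) * s b c')))\<^sup>2)"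
  proof (intro sum.cong refl)
    fix c k'
    have "(\<Sum>b\<in>B. cnj (?t b k') * s b c) = cnj (ip C (f k') (\<lambda>c'. \<Sum>b\<in>B. cnj (s b c) * s b c'))"
      unfolding ip_sum_right by (simp add: mult.commute)
    then show "(cmod (\<Sum>b\<in>B. cnj (?t b k') * s b c))\<^sup>2 = (cmod (ip C (f k') (\<lambda>c'. \<Sum>b\<in>B. cnj (s b c) * s b c')))\<^sup>2"
      by (simp only: complex_mod_cnj)
  qed
  also have "\<dots> \<le> (\<Sum>c\<in>C. nsq C (\<lambda>c'. \<Sum>b\<in>B. cnj (s b c) * s b c'))"
    by (intro sum_mono bessel assms)
  also have "\<dots> = (\<Sum>c\<in>C. \<Sum>c'\<in>C. (cmod (\<Sum>b\<in>B. s b c' * cnj (s b c)))\<^sup>2)"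
    unfolding nsq_def by (simp only: mult.commute)
  also have "\<dots> = (\<Sum>c\<in>C. \<Sum>c'\<in>C. (cmod (\<Sum>b\<in>B. s b c * cnj (s b c')))\<^sup>2)"
    by (rule sum.swap)
  also have "\<dots> = bpur B C s"
    unfolding bpur_def by (rule gram_swap)
  finally show ?thesis .
qed

lemma sum4_prod:

  \<comment> \<open>Products of a leftover entangled state with an ensemble\<close>
  fixes f g :: "_ \<Rightarrow> _ \<Rightarrow> 'z::comm_semiring_1"
  shows "(\<Sum>z\<in>B \<times> B'. \<Sum>y\<in>K \<times> C'. f (fst z) (fst y) * g (snd z) (snd y)) = (\<Sum>b\<in>B. \<Sum>k\<in>K. f b k) * (\<Sum>b'\<in>B'. \<Sum>c'\<in>C'. g b' c')"
  by (simp only: sum.cartesian_product' fst_conv snd_conv sum_product)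

lemma sum2_prod:
  fixes f g :: "_ \<Rightarrow> 'z::comm_semiring_1"
  shows "(\<Sum>y\<in>K \<times> C'. f (fst y) * g (snd y)) = (\<Sum>k\<in>K. f k) * (\<Sum>c'\<in>C'. g c')"
  by (simp only: sum.cartesian_product' fst_conv snd_conv sum_product)

text \<open>\<open>t\<close> is the state left by the first stage, with Charlie's part reduced to a
  label inside his block; \<open>v\<close> is the ensemble of the second stage.\<close>

definition wprod :: "('b \<Rightarrow> 'k \<Rightarrow> complex) \<Rightarrow> ('x \<Rightarrow> 'b' \<Rightarrow> 'c \<Rightarrow> complex) \<Rightarrow> 'x \<Rightarrow> 'b \<times> 'b' \<Rightarrow> 'k \<times> 'c \<Rightarrow> complex" where
  "wprod t v x z y = t (fst z) (fst y) * v x (snd z) (snd y)"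

lemma wt_wprod:
  "wt X (B \<times> B') (K \<times> C) p (wprod t v) = (\<Sum>b\<in>B. \<Sum>k\<in>K. (cmod (t b k))\<^sup>2) * wt X B' C p v"
proof -
  have "(\<Sum>z\<in>B \<times> B'. \<Sum>y\<in>K \<times> C. (cmod (wprod t v x z y))\<^sup>2) =
      (\<Sum>b\<in>B. \<Sum>k\<in>K. (cmod (t b k))\<^sup>2) * (\<Sum>b'\<in>B'. \<Sum>c\<in>C. (cmod (v x b' c))\<^sup>2)" for x
    unfolding wprod_def norm_mult power_mult_distrib by (rule sum4_prod)
  then show ?thesis
    unfolding wt_def by (simp add: sum_distrib_left mult.left_commute)
qed

text \<open>Here the leftover entanglement pays off: Bob's purity is multiplied by that of the
  leftover state.\<close>

lemma purB_wprod:
  "purB X (B \<times> B') (K \<times> C) p (wprod t v) = bpur B K t * purB X B' C p v"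
proof -
  have 1: "(\<Sum>y\<in>K \<times> C. \<Sum>x\<in>X. of_real (p x) * wprod t v x z y * cnj (wprod t v x z' y)) =
     (\<Sum>k\<in>K. t (fst z) k * cnj (t (fst z') k)) * (\<Sum>c\<in>C. \<Sum>x\<in>X. of_real (p x) * v x (snd z) c * cnj (v x (snd z') c))" for z z'
  proof -
    have eq: "(\<Sum>x\<in>X. of_real (p x) * wprod t v x z y * cnj (wprod t v x z' y)) =
      (t (fst z) (fst y) * cnj (t (fst z') (fst y))) * (\<Sum>x\<in>X. of_real (p x) * v x (snd z) (snd y) * cnj (v x (snd z') (snd y)))" for y
      unfolding wprod_def sum_distrib_left by (intro sum.cong refl) (simp add: mult_ac)
    show ?thesis unfolding eq by (rule sum2_prod)
  qed
  show ?thesis unfolding purB_def bpur_def 1 norm_mult power_mult_distrib by (rule sum4_prod)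
qed

text \<open>\<open>t\<close> is one fixed pure vector, so on the joint system it contributes no
  randomness and only its norm appears.\<close>

lemma purBC_wprod:
  "purBC X (B \<times> B') (K \<times> C) p (wprod t v) = (\<Sum>b\<in>B. \<Sum>k\<in>K. (cmod (t b k))\<^sup>2)\<^sup>2 * purBC X B' C p v"
proof -
  have 1: "(cmod (\<Sum>x\<in>X. of_real (p x) * wprod t v x z y * cnj (wprod t v x z' y')))\<^sup>2 =
     ((cmod (t (fst z) (fst y)))\<^sup>2 * (cmod (t (fst z') (fst y')))\<^sup>2) *
     (cmod (\<Sum>x\<in>X. of_real (p x) * v x (snd z) (snd y) * cnj (v x (snd z') (snd y'))))\<^sup>2" for z z' y y'
  proof -
    have "(\<Sum>x\<in>X. of_real (p x) * wprod t v x z y * cnj (wprod t v x z' y')) =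
      (t (fst z) (fst y) * cnj (t (fst z') (fst y'))) * (\<Sum>x\<in>X. of_real (p x) * v x (snd z) (snd y) * cnj (v x (snd z') (snd y')))"
      unfolding wprod_def sum_distrib_left by (intro sum.cong refl) (simp add: mult_ac)
    then show ?thesis by (simp only: norm_mult power_mult_distrib complex_mod_cnj)
  qed
  have "purBC X (B \<times> B') (K \<times> C) p (wprod t v) =
     (\<Sum>z\<in>B \<times> B'. \<Sum>z'\<in>B \<times> B'. (\<Sum>k\<in>K. \<Sum>k'\<in>K. (cmod (t (fst z) k))\<^sup>2 * (cmod (t (fst z') k'))\<^sup>2) *
       (\<Sum>c\<in>C. \<Sum>c'\<in>C. (cmod (\<Sum>x\<in>X. of_real (p x) * v x (snd z) c * cnj (v x (snd z') c')))\<^sup>2))"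
    unfolding purBC_def 1 by (intro sum.cong refl sum4_prod)
  also have "\<dots> = (\<Sum>b\<in>B. \<Sum>b'\<in>B. \<Sum>k\<in>K. \<Sum>k'\<in>K. (cmod (t b k))\<^sup>2 * (cmod (t b' k'))\<^sup>2) * purBC X B' C p v"
    unfolding purBC_def by (rule sum4_prod)
  also have "(\<Sum>b\<in>B. \<Sum>b'\<in>B. \<Sum>k\<in>K. \<Sum>k'\<in>K. (cmod (t b k))\<^sup>2 * (cmod (t b' k'))\<^sup>2) = (\<Sum>b\<in>B. \<Sum>k\<in>K. (cmod (t b k))\<^sup>2)\<^sup>2"
    by (simp only: power2_eq_square[of "\<Sum>b\<in>B. \<Sum>k\<in>K. (cmod (t b k))\<^sup>2"] sum_product)
  finally show ?thesis .
qed

text \<open>A code in coordinates: Charlie's outcomes are the rank one operators of \<open>F y\<close>, Bob's those of \<open>e y i\<close>;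
  the inequalities say that both sum to at most the identity.\<close>
definition abs_code :: "'x set \<Rightarrow> 'b set \<Rightarrow> 'c set \<Rightarrow> ('x \<Rightarrow> 'b \<Rightarrow> 'c \<Rightarrow> complex) \<Rightarrow> real \<Rightarrow> nat \<Rightarrow> bool" where
  "abs_code X B C u \<epsilon> N \<longleftrightarrow> (\<exists>a (m::nat) F e. (\<forall>i<N. nsq X (a i) = 1) \<and>
     (\<forall>v. (\<Sum>y<m. (cmod (ip C (F y) v))\<^sup>2) \<le> nsq C v) \<and>
     (\<forall>y<m. \<forall>v. (\<Sum>i<N. (cmod (ip B (e y i) v))\<^sup>2) \<le> nsq B v) \<and>
     (\<forall>i<N. 1 - \<epsilon> \<le> (\<Sum>y<m. (cmod (ip B (e y i) (\<lambda>b. ip C (F y) (\<lambda>c. \<Sum>x\<in>X. a i x * u x b c))))\<^sup>2)))"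

lemma abs_codeI:
  assumes "finite Y" "\<And>i. i < N \<Longrightarrow> nsq X (a i) = 1"
    "\<And>v. (\<Sum>y\<in>Y. (cmod (ip C (F y) v))\<^sup>2) \<le> nsq C v"
    "\<And>y v. y \<in> Y \<Longrightarrow> (\<Sum>i<N. (cmod (ip B (e y i) v))\<^sup>2) \<le> nsq B v"
    "\<And>i. i < N \<Longrightarrow> 1 - \<epsilon> \<le> (\<Sum>y\<in>Y. (cmod (ip B (e y i) (\<lambda>b. ip C (F y) (\<lambda>c. \<Sum>x\<in>X. a i x * u x b c))))\<^sup>2)"
  shows "abs_code X B C u \<epsilon> N"
proof -
  obtain h where h: "bij_betw h {..<card Y} Y"
    using ex_bij_betw_nat_finite[OF assms(1)] by (auto simp: atLeast0LessThan)
  have s: "(\<Sum>y<card Y. G (h y)) = (\<Sum>y\<in>Y. G y)" for G :: "_ \<Rightarrow> real"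
    by (rule sum.reindex_bij_betw[OF h])
  have hY: "h y \<in> Y" if "y < card Y" for y
    using h that by (auto simp: bij_betw_def)
  show ?thesis
    unfolding abs_code_def
    by (rule exI[of _ a], rule exI[of _ "card Y"], rule exI[of _ "\<lambda>y. F (h y)"], rule exI[of _ "\<lambda>y. e (h y)"])
      (use assms(2-5) hY in \<open>simp add: s[of "\<lambda>y. (cmod (ip C (F y) _))\<^sup>2"]
         s[of "\<lambda>y. (cmod (ip B (e y _) (\<lambda>b. ip C (F y) (\<lambda>c. \<Sum>x\<in>X. a _ x * u x b c))))\<^sup>2"]\<close>)
qed

lemma ip_restrict:
  assumes "finite S" "S0 \<subseteq> S"
  shows "ip S (\<lambda>s. if s \<in> S0 then f s else 0) v = ip S0 f v"
proof -
  have "ip S (\<lambda>s. if s \<in> S0 then f s else 0) v = (\<Sum>s\<in>S. if s \<in> S0 then cnj (f s) * v s else 0)"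
    unfolding ip_def by (intro sum.cong) auto
  also have "\<dots> = ip S0 f v"
    using assms by (simp add: ip_def sum.If_cases Int_absorb1)
  finally show ?thesis .
qed

lemma nsq_mono: "finite S \<Longrightarrow> S0 \<subseteq> S \<Longrightarrow> nsq S0 f \<le> nsq S f"
  unfolding nsq_def by (intro sum_mono2) auto

text \<open>Messages are pairs coded as \<open>i * N2 + j\<close>; once \<open>i\<close> is
  announced, distinct messages with that \<open>i\<close> have distinct \<open>j\<close>.\<close>

lemma sum_div_mod_le:
  fixes g :: "nat \<Rightarrow> real"
  assumes "0 < N2" "\<And>j. 0 \<le> g j"
  shows "(\<Sum>m<N1 * N2. if m div N2 = i then g (m mod N2) else 0) \<le> (\<Sum>j<N2. g j)"
proof -
  let ?A = "{m. m < N1 * N2 \<and> m div N2 = i}"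
  have inj: "inj_on (\<lambda>m. m mod N2) ?A"
    by (rule inj_onI) (metis (mono_tags, lifting) mem_Collect_eq div_mult_mod_eq)
  have "(\<Sum>m<N1 * N2. if m div N2 = i then g (m mod N2) else 0) = (\<Sum>m\<in>?A. g (m mod N2))"
    by (subst sum.inter_filter[symmetric]) (auto intro!: sum.cong)
  also have "\<dots> = sum g ((\<lambda>m. m mod N2) ` ?A)"
    using sum.reindex[OF inj, of g] by simp
  also have "\<dots> \<le> (\<Sum>j<N2. g j)"
    using assms by (intro sum_mono2) auto
  finally show ?thesis .
qed

text \<open>Message \<open>m\<close> stands for \<open>(m div N2, m mod N2)\<close>. The first index
  selects a superposition and is found by Charlie; the second selects an eigenvector, which Bob
  decodes with the leftover entanglement. In \<open>eps\<close>, \<open>2 * e1\<close> is the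
  failure of the first stage, the atypical masses are the truncation loss of the second, and the
  root is the overlap of Bob's vectors, with \<open>2 * e2\<close> bounding the purity of the
  leftover state.\<close>

lemma oneshot_code:
  fixes X :: "'x set" and B :: "'b set" and C :: "'c set" and X' :: "'x' set" and B' :: "'b' set" and C' :: "'c' set"
  assumes t1: "tripartite X B C p q r u" and t2: "tripartite X' B' C' p' q' r' u'"
    and sub1: "X0 \<subseteq> X" "B0 \<subseteq> B" "C0 \<subseteq> C" and sub2: "X0' \<subseteq> X'" "B0' \<subseteq> B'" "C0' \<subseteq> C'"
    and P0: "0 < sum p X0"
    and N: "N1 \<le> Suc M1" "0 < N2" "N2 \<le> Suc M2"
    and e1: "0 < e1" "sum p (X - X0) + sum q (B - B0) + sum r (C - C0) + sqrt (real M1 * real (card B0) * (\<Sum>c\<in>C0. (r c)\<^sup>2)) \<le> e1"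
    and e2: "0 < e2" "(\<Sum>b\<in>B0. (q b)\<^sup>2) + (\<Sum>c\<in>C0. (r c)\<^sup>2) \<le> e2"
    and eps: "2 * e1 + sum p' (X' - X0') + sum q' (B' - B0') + sum r' (C' - C0')
       + sqrt (real M2 * (2 * e2 * (\<Sum>b\<in>B0'. (q' b)\<^sup>2) + (\<Sum>x\<in>X0'. (p' x)\<^sup>2))) \<le> \<epsilon>"
  shows "abs_code (X \<times> X') (B \<times> B') (C \<times> C') (\<lambda>x b c. u (fst x) (fst b) (fst c) * u' (snd x) (snd b) (snd c)) \<epsilon> (N1 * N2)"
proof -
  interpret t1: tripartite X B C p q r u by (rule t1)
  interpret t2: tripartite X' B' C' p' q' r' u' by (rule t2)
  note fin = t1.fin t2.fin
  have fin0: "finite X0" "finite B0" "finite C0" "finite X0'" "finite B0'" "finite C0'"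
    using sub1 sub2 fin by (meson finite_subset)+
  let ?v = "t1.restr X0" and ?v' = "t2.restr X0'"
  let ?S = "supst X p ?v"
  have "1 - wt X B0 C0 p ?v + sqrt (real M1 * real (card B0) * purC X B0 C0 p ?v) \<le> e1"
  proof -
    have "sqrt (real M1 * real (card B0) * purC X B0 C0 p ?v) \<le> sqrt (real M1 * real (card B0) * (\<Sum>c\<in>C0. (r c)\<^sup>2))"
      by (intro real_sqrt_le_mono mult_left_mono t1.purC_restr sub1) simp
    then show ?thesis using t1.wt_restr_ge[OF sub1] e1(2) by linarith
  qed
  moreover have "purB X B0 C0 p ?v + purC X B0 C0 p ?v \<le> e2"
    using t1.purB_restr[OF sub1(2,3), of X0] t1.purC_restr[OF sub1(2,3), of X0] e2(2) by linarith
  ultimately obtain \<alpha> f where \<alpha>: "\<And>i. i < N1 \<Longrightarrow> \<alpha> i \<in> Om X" and f: "pons C0 ({..<N1} \<times> B0) f"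
    and f1: "\<And>i. i < N1 \<Longrightarrow> 1 - 2 * e1 \<le> (\<Sum>b\<in>B0. \<Sum>k\<in>B0. (cmod (ip C0 (f (i, k)) (?S (\<alpha> i) b)))\<^sup>2)"
    and f2: "\<And>i. i < N1 \<Longrightarrow> bpur B0 C0 (?S (\<alpha> i)) \<le> 2 * e2"
    using encode_greedy[OF fin(1) fin0(2,3) t1.p_nonneg t1.supst_restr_le[OF sub1] e1(1) _ e2(1) _ N(1)] by blast
  define t where "t i b k = ip C0 (f (i, k)) (?S (\<alpha> i) b)" for i b k
  let ?D = "B0 \<times> C0'"
  let ?n = "real (card (Om ?D))"
  have finD: "finite ?D" using fin0 by simp
  have npos: "0 < ?n" by (rule card_Om_pos[OF finD])
  \<comment> \<open>Each \<open>i\<close> gets its own second-stage code for its own leftover state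
    \<open>t i\<close>: Alice knows \<open>i\<close>, and Charlie tells Bob.\<close>
  have dec: "\<exists>xs e. (\<forall>j<N2. xs j \<in> X') \<and> (\<forall>\<omega>\<in>Om ?D. pons (B0 \<times> B0') {..<N2} (e \<omega>)) \<and>
    (\<forall>j<N2. ?n * (1 - \<epsilon>) \<le> (\<Sum>\<omega>\<in>Om ?D. (cmod (ip (B0 \<times> B0') (e \<omega> j) (meas ?D (wprod (t i) ?v' (xs j)) \<omega>)))\<^sup>2))"
    if i: "i < N1" for i
  proof -
    let ?w = "wprod (t i) ?v'"
    let ?A = "\<Sum>b\<in>B0. \<Sum>k\<in>B0. (cmod (t i b k))\<^sup>2"
    let ?W' = "wt X' B0' C0' p' ?v'"
    have fi: "pons C0 B0 (\<lambda>k. f (i, k))"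
      using f i unfolding pons_def by auto
    have A1: "?A \<le> 1"
    proof -
      have "?A \<le> (\<Sum>b\<in>B0. nsq C0 (?S (\<alpha> i) b))"
        unfolding t_def by (intro sum_mono bessel fin0 fi)
      also have "\<dots> \<le> 1" by (rule t1.supst_restr_le[OF sub1 \<alpha>[OF i]])
      finally show ?thesis .
    qed
    have A0: "0 \<le> ?A" by (simp add: sum_nonneg)
    have Ae: "1 - 2 * e1 \<le> ?A" using f1[OF i] by (simp add: t_def)
    have W1: "?W' \<le> 1" by (rule t2.wt_restr_le[OF sub2])
    \<comment> \<open>For two weights at most 1, the defect of the product is at most the sum of the
      defects.\<close>
    have "0 \<le> (1 - ?A) * (1 - ?W')" using A1 W1 by simp
    then have w: "?A + ?W' - 1 \<le> ?A * ?W'" by (simp add: algebra_simps)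
    have b: "bpur B0 B0 (t i) \<le> 2 * e2"
      using pons_proj_bpur[OF fin0(3,2) fi, of B0 "?S (\<alpha> i)"] f2[OF i]
      by (simp add: t_def[abs_def])
    have pu: "purB X' (B0 \<times> B0') ?D p' ?w + purBC X' (B0 \<times> B0') ?D p' ?w \<le> 2 * e2 * (\<Sum>b\<in>B0'. (q' b)\<^sup>2) + (\<Sum>x\<in>X0'. (p' x)\<^sup>2)"
    proof (rule add_mono)
      show "purB X' (B0 \<times> B0') ?D p' ?w \<le> 2 * e2 * (\<Sum>b\<in>B0'. (q' b)\<^sup>2)"
        unfolding purB_wprod
        by (intro mult_mono b t2.purB_restr sub2 pur_nonneg) (use e2 in simp)
      have "?A\<^sup>2 * purBC X' B0' C0' p' ?v' \<le> 1 * (\<Sum>x\<in>X0'. (p' x)\<^sup>2)"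
        using A0 A1 by (intro mult_mono t2.purBC_restr sub2 pur_nonneg) (auto simp: power_le_one)
      then show "purBC X' (B0 \<times> B0') ?D p' ?w \<le> (\<Sum>x\<in>X0'. (p' x)\<^sup>2)"
        unfolding purBC_wprod by simp
    qed
    have fB: "finite (B0 \<times> B0')" using fin0 by simp
    have "1 - \<epsilon> \<le> wt X' (B0 \<times> B0') ?D p' ?w - sqrt (real M2 * (purB X' (B0 \<times> B0') ?D p' ?w + purBC X' (B0 \<times> B0') ?D p' ?w))"
    proof -
      have "sqrt (real M2 * (purB X' (B0 \<times> B0') ?D p' ?w + purBC X' (B0 \<times> B0') ?D p' ?w)) \<le>
        sqrt (real M2 * (2 * e2 * (\<Sum>b\<in>B0'. (q' b)\<^sup>2) + (\<Sum>x\<in>X0'. (p' x)\<^sup>2)))"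
        by (intro real_sqrt_le_mono mult_left_mono pu) simp
      then show ?thesis unfolding wt_wprod using w Ae t2.wt_restr_ge[OF sub2] eps by linarith
    qed
    then have le: "?n * (1 - \<epsilon>) \<le> ?n * (wt X' (B0 \<times> B0') ?D p' ?w - sqrt (real M2 * (purB X' (B0 \<times> B0') ?D p' ?w + purBC X' (B0 \<times> B0') ?D p' ?w)))"
      by (intro mult_left_mono) simp_all
    obtain xs e where "\<forall>j<N2. xs j \<in> X'" "\<forall>\<omega>\<in>Om ?D. pons (B0 \<times> B0') {..<N2} (e \<omega>)"
      and h: "\<forall>j<N2. ?n * (wt X' (B0 \<times> B0') ?D p' ?w - sqrt (real M2 * (purB X' (B0 \<times> B0') ?D p' ?w + purBC X' (B0 \<times> B0') ?D p' ?w)))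
       \<le> (\<Sum>\<omega>\<in>Om ?D. (cmod (ip (B0 \<times> B0') (e \<omega> j) (meas ?D (?w (xs j)) \<omega>)))\<^sup>2)"
      using decode_greedy[OF fin(4) fB finD t2.p_nonneg t2.p_sum N(3), of ?w] by blast
    then show ?thesis using order_trans[OF le] by blast
  qed
  obtain xs e where xs: "\<And>i j. i < N1 \<Longrightarrow> j < N2 \<Longrightarrow> xs i j \<in> X'"
    and e: "\<And>i \<omega>. i < N1 \<Longrightarrow> \<omega> \<in> Om ?D \<Longrightarrow> pons (B0 \<times> B0') {..<N2} (e i \<omega>)"
    and suc: "\<And>i j. i < N1 \<Longrightarrow> j < N2 \<Longrightarrow> ?n * (1 - \<epsilon>) \<le> (\<Sum>\<omega>\<in>Om ?D. (cmod (ip (B0 \<times> B0') (e i \<omega> j) (meas ?D (wprod (t i) ?v' (xs i j)) \<omega>)))\<^sup>2)"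
  proof -
    from dec have "\<forall>i. \<exists>xs e. i < N1 \<longrightarrow> (\<forall>j<N2. xs j \<in> X') \<and> (\<forall>\<omega>\<in>Om ?D. pons (B0 \<times> B0') {..<N2} (e \<omega>)) \<and>
      (\<forall>j<N2. ?n * (1 - \<epsilon>) \<le> (\<Sum>\<omega>\<in>Om ?D. (cmod (ip (B0 \<times> B0') (e \<omega> j) (meas ?D (wprod (t i) ?v' (xs j)) \<omega>)))\<^sup>2))"
      by blast
    from choice[OF this] obtain xs where "\<forall>i. \<exists>e. i < N1 \<longrightarrow> (\<forall>j<N2. xs i j \<in> X') \<and> (\<forall>\<omega>\<in>Om ?D. pons (B0 \<times> B0') {..<N2} (e \<omega>)) \<and>
      (\<forall>j<N2. ?n * (1 - \<epsilon>) \<le> (\<Sum>\<omega>\<in>Om ?D. (cmod (ip (B0 \<times> B0') (e \<omega> j) (meas ?D (wprod (t i) ?v' (xs i j)) \<omega>)))\<^sup>2))" ..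
    from choice[OF this] obtain e where "\<forall>i. i < N1 \<longrightarrow> (\<forall>j<N2. xs i j \<in> X') \<and> (\<forall>\<omega>\<in>Om ?D. pons (B0 \<times> B0') {..<N2} (e i \<omega>)) \<and>
      (\<forall>j<N2. ?n * (1 - \<epsilon>) \<le> (\<Sum>\<omega>\<in>Om ?D. (cmod (ip (B0 \<times> B0') (e i \<omega> j) (meas ?D (wprod (t i) ?v' (xs i j)) \<omega>)))\<^sup>2))" ..
    then show ?thesis using that[of xs e] by simp
  qed
  define Y where "Y = {..<N1} \<times> Om ?D"
  \<comment> \<open>Charlie's outcome \<open>(i, \<omega>)\<close> is the phase vector
    \<open>\<omega>\<close> on \<open>?D\<close>, carried into his systems by the block
    \<open>f (i, _)\<close>. The scalar in front makes the outcomes of one block sum to the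
    projection onto it.\<close>
  define G where "G y z = of_real (1 / sqrt ?n) * (\<Sum>k\<in>B0. (snd y) (k, snd z) * f (fst y, k) (fst z))"
    for y :: "nat \<times> ('b \<times> 'c' \<Rightarrow> complex)" and z :: "'c \<times> 'c'"
  define F where "F y z = (if z \<in> C0 \<times> C0' then G y z else 0)" for y z
  \<comment> \<open>Bob never answers with a message whose first index differs from the announced
    one: his vectors are zero there.\<close>
  define E where "E y m z = (if z \<in> B0 \<times> B0' then (if m div N2 = fst y then e (fst y) (snd y) (m mod N2) z else 0) else 0)" for y m z
  \<comment> \<open>The coefficients of the truncated superposition have squared norm
    \<open>sum p X0\<close>. As this is at most 1, normalising can only raise the success
    probability.\<close>
  define a where "a m z = of_real (1 / sqrt (sum p X0)) * ((if fst z \<in> X0 then \<alpha> (m div N2) (fst z) * of_real (sqrt (p (fst z))) else 0)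
     * (if snd z = xs (m div N2) (m mod N2) then 1 else 0))" for m z
  have finY: "finite Y" by (simp add: Y_def finD)
  have Fip: "ip (C \<times> C') (F y) v = of_real (1 / sqrt ?n) * (\<Sum>d\<in>?D. cnj (snd y d) * ip C0 (f (fst y, fst d)) (\<lambda>c. v (c, snd d)))" for y v
  proof -
    have "ip (C \<times> C') (F y) v = ip (C0 \<times> C0') (G y) v"
      unfolding F_def using sub1 sub2 fin by (intro ip_restrict) auto
    also have "\<dots> = of_real (1 / sqrt ?n) * (\<Sum>c\<in>C0. \<Sum>c'\<in>C0'. \<Sum>k\<in>B0. cnj (snd y (k, c')) * (cnj (f (fst y, k) c) * v (c, c')))"
      unfolding ip_def G_def sum.cartesian_product' by (simp add: sum_distrib_left sum_distrib_right mult_ac)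
    also have "(\<Sum>c\<in>C0. \<Sum>c'\<in>C0'. \<Sum>k\<in>B0. cnj (snd y (k, c')) * (cnj (f (fst y, k) c) * v (c, c'))) =
        (\<Sum>c'\<in>C0'. \<Sum>c\<in>C0. \<Sum>k\<in>B0. cnj (snd y (k, c')) * (cnj (f (fst y, k) c) * v (c, c')))"
      by (rule sum.swap)
    also have "\<dots> = (\<Sum>c'\<in>C0'. \<Sum>k\<in>B0. \<Sum>c\<in>C0. cnj (snd y (k, c')) * (cnj (f (fst y, k) c) * v (c, c')))"
      by (intro sum.cong[OF refl] sum.swap)
    also have "\<dots> = (\<Sum>k\<in>B0. \<Sum>c'\<in>C0'. \<Sum>c\<in>C0. cnj (snd y (k, c')) * (cnj (f (fst y, k) c) * v (c, c')))"
      by (rule sum.swap)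
    also have "\<dots> = (\<Sum>d\<in>?D. cnj (snd y d) * ip C0 (f (fst y, fst d)) (\<lambda>c. v (c, snd d)))"
      unfolding sum.cartesian_product' by (simp add: ip_def sum_distrib_left)
    finally show ?thesis .
  qed
  have Eip: "ip (B \<times> B') (E y m) v = (if m div N2 = fst y then ip (B0 \<times> B0') (e (fst y) (snd y) (m mod N2)) v else 0)" for y m v
  proof -
    have "ip (B \<times> B') (E y m) v = ip (B0 \<times> B0') (\<lambda>z. if m div N2 = fst y then e (fst y) (snd y) (m mod N2) z else 0) v"
      unfolding E_def using sub1 sub2 fin by (intro ip_restrict) auto
    then show ?thesis by (simp add: ip_def)
  qed
  show ?thesis
  proof (rule abs_codeI[of Y _ _ a _ F _ E])
    show "finite Y" by (rule finY)
  next
    fix m assume m: "m < N1 * N2"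
    then have i: "m div N2 < N1" and j: "m mod N2 < N2" using N(2) by (simp_all add: less_mult_imp_div_less)
    let ?P = "sum p X0"
    have "nsq (X \<times> X') (a m) = (\<Sum>x\<in>X. if x \<in> X0 then p x / ?P else 0) * (\<Sum>x'\<in>X'. if x' = xs (m div N2) (m mod N2) then 1 else 0)"
      unfolding nsq_def sum2_prod[symmetric]
    proof (intro sum.cong refl)
      fix z assume z: "z \<in> X \<times> X'"
      then have "fst z \<in> X" by auto
      then have "(cmod (\<alpha> (m div N2) (fst z) * of_real (sqrt (p (fst z)))))\<^sup>2 = p (fst z)"
        using Om_norm[OF \<alpha>[OF i]] t1.p_nonneg by (simp add: norm_mult power_mult_distrib)
      then show "(cmod (a m z))\<^sup>2 = (if fst z \<in> X0 then p (fst z) / ?P else 0) * (if snd z = xs (m div N2) (m mod N2) then 1 else 0)"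
        using P0 by (simp add: a_def norm_mult norm_divide power_mult_distrib power_divide)
    qed
    also have "(\<Sum>x'\<in>X'. if x' = xs (m div N2) (m mod N2) then 1 else 0) = (1::real)"
      using xs[OF i j] fin by simp
    also have "(\<Sum>x\<in>X. if x \<in> X0 then p x / ?P else 0) = (\<Sum>x\<in>X0. p x / ?P)"
      using sub1 fin by (simp add: sum.If_cases Int_absorb1)
    also have "\<dots> = 1" using P0 by (simp flip: sum_divide_distrib)
    finally show "nsq (X \<times> X') (a m) = 1" by simp
  next
    fix v :: "'c \<times> 'c' \<Rightarrow> complex"
    have "(\<Sum>y\<in>Y. (cmod (ip (C \<times> C') (F y) v))\<^sup>2) =
       (\<Sum>i<N1. \<Sum>\<omega>\<in>Om ?D. (1 / ?n) * (cmod (\<Sum>d\<in>?D. cnj (\<omega> d) * ip C0 (f (i, fst d)) (\<lambda>c. v (c, snd d))))\<^sup>2)"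
      unfolding Fip Y_def sum.cartesian_product' using npos
      by (simp add: norm_mult norm_divide power_mult_distrib power_divide)
    also have "\<dots> = (\<Sum>i<N1. \<Sum>d\<in>?D. (cmod (ip C0 (f (i, fst d)) (\<lambda>c. v (c, snd d))))\<^sup>2)"
      using npos by (simp only: sum_distrib_left[symmetric] Om_first_moment_cnj[OF finD]) simp
    also have "\<dots> = (\<Sum>i<N1. \<Sum>k\<in>B0. \<Sum>c'\<in>C0'. (cmod (ip C0 (f (i, k)) (\<lambda>c. v (c, c'))))\<^sup>2)"
      by (simp only: sum.cartesian_product' fst_conv snd_conv)
    also have "\<dots> = (\<Sum>i<N1. \<Sum>c'\<in>C0'. \<Sum>k\<in>B0. (cmod (ip C0 (f (i, k)) (\<lambda>c. v (c, c'))))\<^sup>2)"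
      by (intro sum.cong[OF refl] sum.swap)
    also have "\<dots> = (\<Sum>c'\<in>C0'. \<Sum>i<N1. \<Sum>k\<in>B0. (cmod (ip C0 (f (i, k)) (\<lambda>c. v (c, c'))))\<^sup>2)"
      by (rule sum.swap)
    also have "\<dots> = (\<Sum>c'\<in>C0'. \<Sum>z\<in>{..<N1} \<times> B0. (cmod (ip C0 (f z) (\<lambda>c. v (c, c'))))\<^sup>2)"
      by (simp only: sum.cartesian_product' fst_conv snd_conv)
    also have "\<dots> \<le> (\<Sum>c'\<in>C0'. nsq C0 (\<lambda>c. v (c, c')))"
      using fin0 by (intro sum_mono bessel f) auto
    also have "\<dots> = nsq (C0 \<times> C0') v"
      unfolding nsq_def sum.cartesian_product' by (rule sum.swap)
    also have "\<dots> \<le> nsq (C \<times> C') v"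
      using fin sub1 sub2 by (intro nsq_mono) auto
    finally show "(\<Sum>y\<in>Y. (cmod (ip (C \<times> C') (F y) v))\<^sup>2) \<le> nsq (C \<times> C') v" .
  next
    fix y and v :: "'b \<times> 'b' \<Rightarrow> complex" assume "y \<in> Y"
    then have y: "fst y < N1" "snd y \<in> Om ?D" by (auto simp: Y_def)
    let ?g = "\<lambda>j. (cmod (ip (B0 \<times> B0') (e (fst y) (snd y) j) v))\<^sup>2"
    have "(\<Sum>m<N1 * N2. (cmod (ip (B \<times> B') (E y m) v))\<^sup>2) = (\<Sum>m<N1 * N2. if m div N2 = fst y then ?g (m mod N2) else 0)"
      unfolding Eip by (intro sum.cong) auto
    also have "\<dots> \<le> (\<Sum>j<N2. ?g j)"
      by (rule sum_div_mod_le[OF N(2)]) simp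
    also have "\<dots> \<le> nsq (B0 \<times> B0') v"
      using fin0 by (intro bessel e y) auto
    also have "\<dots> \<le> nsq (B \<times> B') v"
      using fin sub1 sub2 by (intro nsq_mono) auto
    finally show "(\<Sum>m<N1 * N2. (cmod (ip (B \<times> B') (E y m) v))\<^sup>2) \<le> nsq (B \<times> B') v" .
  next
    fix m assume m: "m < N1 * N2"
    define i where "i = m div N2"
    define j where "j = m mod N2"
    have i: "i < N1" and j: "j < N2" using m N(2) by (simp_all add: i_def j_def less_mult_imp_div_less)
    let ?P = "sum p X0"
    have P1: "?P \<le> 1" using sum_mono2[OF fin(1) sub1(1), of p] t1.p_nonneg t1.p_sum by auto
    define Psi where "Psi b c = (\<Sum>x\<in>X \<times> X'. a m x * (u (fst x) (fst b) (fst c) * u' (snd x) (snd b) (snd c)))" for b c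
    have Psi: "Psi b c = of_real (1 / sqrt ?P) * (?S (\<alpha> i) (fst b) (fst c) * u' (xs i j) (snd b) (snd c))" for b c
    proof -
      have "Psi b c = (\<Sum>x\<in>X \<times> X'. (of_real (1 / sqrt ?P) * (if fst x \<in> X0 then \<alpha> i (fst x) * of_real (sqrt (p (fst x))) else 0) * u (fst x) (fst b) (fst c))
          * ((if snd x = xs i j then 1 else 0) * u' (snd x) (snd b) (snd c)))"
        unfolding Psi_def a_def i_def[symmetric] j_def[symmetric] by (intro sum.cong refl) (simp add: mult_ac)
      also have "\<dots> = (\<Sum>x\<in>X. of_real (1 / sqrt ?P) * (if x \<in> X0 then \<alpha> i x * of_real (sqrt (p x)) else 0) * u x (fst b) (fst c))
          * (\<Sum>x'\<in>X'. (if x' = xs i j then 1 else 0) * u' x' (snd b) (snd c))"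
        by (rule sum2_prod)
      also have "(\<Sum>x'\<in>X'. (if x' = xs i j then 1 else 0) * u' x' (snd b) (snd c)) = (\<Sum>x'\<in>X'. if x' = xs i j then u' x' (snd b) (snd c) else 0)"
        by (intro sum.cong) auto
      also have "\<dots> = u' (xs i j) (snd b) (snd c)"
        using xs[OF i j] fin by simp
      also have "(\<Sum>x\<in>X. of_real (1 / sqrt ?P) * (if x \<in> X0 then \<alpha> i x * of_real (sqrt (p x)) else 0) * u x (fst b) (fst c)) =
          of_real (1 / sqrt ?P) * ?S (\<alpha> i) (fst b) (fst c)"
        unfolding supst_def sum_distrib_left by (intro sum.cong) (auto simp: t1.restr_def mult_ac)
      finally show ?thesis by simp
    qed
    define amp where "amp y = ip (B \<times> B') (E y m) (\<lambda>b. ip (C \<times> C') (F y) (Psi b))" for y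
    have amp: "(cmod (amp (i, \<omega>)))\<^sup>2 = (1 / ?P) * (1 / ?n) * (cmod (ip (B0 \<times> B0') (e i \<omega> j) (meas ?D (wprod (t i) ?v' (xs i j)) \<omega>)))\<^sup>2"
      if "\<omega> \<in> Om ?D" "xs i j \<in> X0'" for \<omega>
    proof -
      have "ip (C \<times> C') (F (i, \<omega>)) (Psi b) = of_real (1 / sqrt ?n) * of_real (1 / sqrt ?P) * meas ?D (wprod (t i) ?v' (xs i j)) \<omega> b" for b
      proof -
        have "ip C0 (f (i, fst d)) (\<lambda>c. Psi b (c, snd d)) = of_real (1 / sqrt ?P) * wprod (t i) ?v' (xs i j) b d" for d
        proof -
          have "(\<lambda>c. Psi b (c, snd d)) = (\<lambda>c. (of_real (1 / sqrt ?P) * u' (xs i j) (snd b) (snd d)) * ?S (\<alpha> i) (fst b) c)"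
            unfolding Psi by (simp add: mult_ac)
          then have "ip C0 (f (i, fst d)) (\<lambda>c. Psi b (c, snd d)) = (of_real (1 / sqrt ?P) * u' (xs i j) (snd b) (snd d)) * ip C0 (f (i, fst d)) (?S (\<alpha> i) (fst b))"
            by (simp only: ip_scale_right)
          then show ?thesis using that(2) by (simp add: wprod_def t_def t2.restr_def)
        qed
        then show ?thesis unfolding Fip meas_def by (simp add: sum_distrib_left mult_ac)
      qed
      then have "amp (i, \<omega>) = of_real (1 / sqrt ?n) * of_real (1 / sqrt ?P) * ip (B0 \<times> B0') (e i \<omega> j) (meas ?D (wprod (t i) ?v' (xs i j)) \<omega>)"
        unfolding amp_def Eip by (simp only: ip_scale_right) (simp add: i_def j_def)
      then show ?thesis using npos P0 by (simp add: norm_mult norm_divide power_mult_distrib power_divide)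
    qed
    have "1 - \<epsilon> \<le> (\<Sum>\<omega>\<in>Om ?D. (cmod (amp (i, \<omega>)))\<^sup>2)"
    proof (cases "xs i j \<in> X0'")
      case True
      let ?s = "\<Sum>\<omega>\<in>Om ?D. (cmod (ip (B0 \<times> B0') (e i \<omega> j) (meas ?D (wprod (t i) ?v' (xs i j)) \<omega>)))\<^sup>2"
      have s: "(\<Sum>\<omega>\<in>Om ?D. (cmod (amp (i, \<omega>)))\<^sup>2) = (1 / ?P) * ((1 / ?n) * ?s)"
        using amp True by (simp add: sum_distrib_left)
      have "1 - \<epsilon> \<le> (1 / ?n) * ?s"
        using suc[OF i j] npos by (simp add: field_simps)
      also have "\<dots> \<le> (1 / ?P) * ((1 / ?n) * ?s)"
      proof -
        have "1 \<le> 1 / ?P" using P0 P1 by simp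
        moreover have "0 \<le> (1 / ?n) * ?s" by (simp add: sum_nonneg)
        ultimately have "1 * ((1 / ?n) * ?s) \<le> (1 / ?P) * ((1 / ?n) * ?s)" by (rule mult_right_mono)
        then show ?thesis by (simp only: mult_1)
      qed
      finally show ?thesis using s by simp
    next
      \<comment> \<open>An atypical \<open>xs i j\<close> has the zero vector after truncation, so
        the guaranteed success is not positive and there is nothing to show.\<close>
      case False
      then have "meas ?D (wprod (t i) ?v' (xs i j)) \<omega> b = 0" for \<omega> b
        by (simp add: meas_def wprod_def t2.restr_def)
      then have "?n * (1 - \<epsilon>) \<le> 0" using suc[OF i j] by (simp add: ip_def)
      then have "1 - \<epsilon> \<le> 0" using npos by (simp add: mult_le_0_iff)
      also have "0 \<le> (\<Sum>\<omega>\<in>Om ?D. (cmod (amp (i, \<omega>)))\<^sup>2)" by (simp add: sum_nonneg)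
      finally show ?thesis .
    qed
    also have "\<dots> = (\<Sum>y\<in>{i} \<times> Om ?D. (cmod (amp y))\<^sup>2)"
      by (simp add: sum.cartesian_product')
    also have "\<dots> \<le> (\<Sum>y\<in>Y. (cmod (amp y))\<^sup>2)"
      using finY i by (intro sum_mono2) (auto simp: Y_def)
    finally show "1 - \<epsilon> \<le> (\<Sum>y\<in>Y. (cmod (ip (B \<times> B') (E y m) (\<lambda>b. ip (C \<times> C') (F y) (\<lambda>c. \<Sum>x\<in>X \<times> X'. a m x * (u (fst x) (fst b) (fst c) * u' (snd x) (snd b) (snd c))))))\<^sup>2)"
      by (simp only: amp_def Psi_def[abs_def])
  qed
qed

section \<open>Tensor powers and typical sequences\<close>

lemma sum_lessThan_mult:
  fixes f :: "nat \<Rightarrow> 'a::comm_monoid_add"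
  shows "(\<Sum>x<d * m. f x) = (\<Sum>a<d. \<Sum>y<m. f (a * m + y))"
proof -
  have "(\<Sum>x<d * m. f x) = (\<Sum>a<d. sum f {a * m..<a * m + m})"
    by (rule sum.nat_group[symmetric])
  also have "\<dots> = (\<Sum>a<d. \<Sum>y<m. f (a * m + y))"
  proof (rule sum.cong[OF refl])
    fix a
    show "sum f {a * m..<a * m + m} = (\<Sum>y<m. f (a * m + y))"
      using sum.shift_bounds_nat_ivl[of f 0 "a * m" m] by (simp add: atLeast0LessThan add.commute)
  qed
  finally show ?thesis .
qed

lemma digit_less: "x < d ^ n \<Longrightarrow> k < n \<Longrightarrow> digit d k x < d"
  by (cases d) (auto simp: digit_def zero_power)

lemma digit_top: "a < d \<Longrightarrow> y < d ^ n \<Longrightarrow> digit d n (a * d ^ n + y) = a"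
  by (simp add: digit_def)

lemma digit_low:
  assumes "k < n"
  shows "digit d k (a * d ^ n + y) = digit d k y"
proof (cases "d = 0")
  case True
  then show ?thesis using assms by (simp add: digit_def zero_power)
next
  case False
  have "d ^ n = d ^ (k + Suc (n - k - 1))" using assms by simp
  then have "d ^ n = d ^ k * (d * d ^ (n - k - 1))"
    by (simp only: power_add power_Suc)
  then have "(a * d ^ n + y) div d ^ k = (y + d ^ k * (a * (d * d ^ (n - k - 1)))) div d ^ k"
    by (simp add: mult_ac add.commute)
  also have "\<dots> = a * (d * d ^ (n - k - 1)) + y div d ^ k"
    using False by (subst div_mult_self2) auto
  also have "\<dots> = y div d ^ k + d * (a * d ^ (n - k - 1))"
    by (simp only: mult.left_commute add.commute)
  also have "\<dots> mod d = y div d ^ k mod d"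
    by (rule mod_mult_self2)
  finally show ?thesis by (simp add: digit_def)
qed

text \<open>The distributive law; with indices written in digits it takes the place of tensor
  product algebra.\<close>

lemma sum_digits_prod:
  fixes g :: "nat \<Rightarrow> nat \<Rightarrow> 'a::comm_semiring_1"
  shows "(\<Sum>x<d ^ n. \<Prod>k<n. g k (digit d k x)) = (\<Prod>k<n. \<Sum>a<d. g k a)"
proof (induction n)
  case (Suc n)
  have "(\<Sum>x<d ^ Suc n. \<Prod>k<Suc n. g k (digit d k x)) =
     (\<Sum>a<d. \<Sum>y<d ^ n. \<Prod>k<Suc n. g k (digit d k (a * d ^ n + y)))"
    by (simp only: power_Suc sum_lessThan_mult)
  also have "\<dots> = (\<Sum>a<d. \<Sum>y<d ^ n. (\<Prod>k<n. g k (digit d k y)) * g n a)"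
    by (intro sum.cong refl) (simp add: digit_top digit_low)
  also have "\<dots> = (\<Sum>a<d. (\<Prod>k<n. \<Sum>a<d. g k a) * g n a)"
    by (simp only: sum_distrib_right[symmetric] Suc.IH)
  also have "\<dots> = (\<Prod>k<Suc n. \<Sum>a<d. g k a)"
    by (simp add: sum_distrib_left)
  finally show ?case .
qed simp

lemma sum_digits_prod2:
  fixes g :: "nat \<Rightarrow> nat \<Rightarrow> nat \<Rightarrow> 'a::comm_semiring_1"
  shows "(\<Sum>x<d ^ n. \<Sum>y<d' ^ n. \<Prod>k<n. g k (digit d k x) (digit d' k y)) = (\<Prod>k<n. \<Sum>a<d. \<Sum>b<d'. g k a b)"
proof -
  have "(\<Sum>x<d ^ n. \<Sum>y<d' ^ n. \<Prod>k<n. g k (digit d k x) (digit d' k y)) = (\<Sum>x<d ^ n. \<Prod>k<n. \<Sum>b<d'. g k (digit d k x) b)"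
    by (intro sum.cong[OF refl] sum_digits_prod)
  also have "\<dots> = (\<Prod>k<n. \<Sum>a<d. \<Sum>b<d'. g k a b)"
    by (rule sum_digits_prod)
  finally show ?thesis .
qed

lemma digits_inject:
  assumes "x < d ^ n" "x' < d ^ n" "\<And>k. k < n \<Longrightarrow> digit d k x = digit d k x'"
  shows "x = x'"
  using assms
proof (induction n arbitrary: x x')
  case (Suc n)
  have d: "0 < d" using Suc.prems(1) by (cases d) auto
  have split: "z = (z div d ^ n) * d ^ n + z mod d ^ n" for z by (rule div_mult_mod_eq[symmetric])
  have top: "z div d ^ n < d" if "z < d ^ Suc n" for z
    using that by (simp add: less_mult_imp_div_less)
  have "digit d n x = x div d ^ n" "digit d n x' = x' div d ^ n"
    using top[OF Suc.prems(1)] top[OF Suc.prems(2)] by (simp_all add: digit_def)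
  then have "x div d ^ n = x' div d ^ n" using Suc.prems(3)[of n] by simp
  moreover have "x mod d ^ n = x' mod d ^ n"
  proof (rule Suc.IH)
    show "x mod d ^ n < d ^ n" "x' mod d ^ n < d ^ n" using d by simp_all
    fix k assume k: "k < n"
    have "digit d k z = digit d k (z mod d ^ n)" for z
      using digit_low[OF k, of d "z div d ^ n" "z mod d ^ n"] unfolding div_mult_mod_eq .
    then show "digit d k (x mod d ^ n) = digit d k (x' mod d ^ n)"
      using Suc.prems(3)[of k] k by simp
  qed
  ultimately show ?case by (metis split)
qed simp

lemma prod_digit_delta:
  fixes g :: "nat \<Rightarrow> nat \<Rightarrow> 'a::comm_semiring_1"
  assumes "x < d ^ n" "x' < d ^ n"
  shows "(\<Prod>k<n. if digit d k x = digit d k x' then g k (digit d k x) else 0) =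
    (if x = x' then \<Prod>k<n. g k (digit d k x) else 0)"
proof (cases "x = x'")
  case False
  then obtain k where "k < n" "digit d k x \<noteq> digit d k x'"
    using digits_inject[OF assms] by blast
  then show ?thesis using False by (auto intro!: prod_zero)
qed simp

text \<open>Basis indices of tensor powers are encoded by digits, as in \<^const>\<open>Utens\<close>.\<close>
definition tpow :: "nat \<Rightarrow> nat \<Rightarrow> (nat \<Rightarrow> 'a::comm_monoid_mult) \<Rightarrow> nat \<Rightarrow> 'a" where
  "tpow d n p x = (\<Prod>k<n. p (digit d k x))"

definition tpow3 :: "nat \<Rightarrow> nat \<Rightarrow> nat \<Rightarrow> nat \<Rightarrow> (nat \<Rightarrow> nat \<Rightarrow> nat \<Rightarrow> complex) \<Rightarrow> nat \<Rightarrow> nat \<Rightarrow> nat \<Rightarrow> complex" where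
  "tpow3 dA dB dC n u x b c = (\<Prod>k<n. u (digit dA k x) (digit dB k b) (digit dC k c))"

lemma sum_tpow: "(\<Sum>x<d ^ n. tpow d n p x) = (\<Sum>a<d. p a :: 'a::comm_semiring_1) ^ n"
  unfolding tpow_def by (subst sum_digits_prod) simp

text \<open>All defining identities are products over the digits and sums over digits factor, so
  \<open>n\<close> copies form another instance of the locale.\<close>

lemma tripartite_tpow:
  assumes "tripartite {..<dA} {..<dB} {..<dC} p q r u"
  shows "tripartite {..<dA ^ n} {..<dB ^ n} {..<dC ^ n} (tpow dA n p) (tpow dB n q) (tpow dC n r) (tpow3 dA dB dC n u)"
proof -
  interpret tripartite "{..<dA}" "{..<dB}" "{..<dC}" p q r u by (rule assms)
  show ?thesis
  proof
    fix x assume "x \<in> {..<dA ^ n}"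
    then show "0 \<le> tpow dA n p x"
      unfolding tpow_def by (intro prod_nonneg p_nonneg ballI) (auto intro: digit_less)
  next
    show "sum (tpow dA n p) {..<dA ^ n} = 1"
      by (simp add: sum_tpow p_sum)
  next
    fix x x' assume x: "x \<in> {..<dA ^ n}" "x' \<in> {..<dA ^ n}"
    have "(\<Sum>b<dB ^ n. \<Sum>c<dC ^ n. tpow3 dA dB dC n u x b c * cnj (tpow3 dA dB dC n u x' b c)) =
      (\<Sum>b<dB ^ n. \<Sum>c<dC ^ n. \<Prod>k<n. u (digit dA k x) (digit dB k b) (digit dC k c) * cnj (u (digit dA k x') (digit dB k b) (digit dC k c)))"
      by (simp add: tpow3_def prod.distrib)
    also have "\<dots> = (\<Prod>k<n. \<Sum>b<dB. \<Sum>c<dC. u (digit dA k x) b c * cnj (u (digit dA k x') b c))"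
      by (rule sum_digits_prod2[where g = "\<lambda>k b c. u (digit dA k x) b c * cnj (u (digit dA k x') b c)"])
    also have "\<dots> = (\<Prod>k<n. if digit dA k x = digit dA k x' then 1 else 0)"
      using x by (intro prod.cong refl iso) (auto intro: digit_less)
    also have "\<dots> = (if x = x' then 1 else 0)"
      using prod_digit_delta[of x dA n x' "\<lambda>_ _. 1::complex"] x by simp
    finally show "(\<Sum>b<dB ^ n. \<Sum>c<dC ^ n. tpow3 dA dB dC n u x b c * cnj (tpow3 dA dB dC n u x' b c)) = (if x = x' then 1 else 0)" .
  next
    fix b b' assume b: "b \<in> {..<dB ^ n}" "b' \<in> {..<dB ^ n}"
    have "(\<Sum>c<dC ^ n. \<Sum>x<dA ^ n. of_real (tpow dA n p x) * tpow3 dA dB dC n u x b c * cnj (tpow3 dA dB dC n u x b' c)) =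
      (\<Sum>c<dC ^ n. \<Sum>x<dA ^ n. \<Prod>k<n. of_real (p (digit dA k x)) * u (digit dA k x) (digit dB k b) (digit dC k c) * cnj (u (digit dA k x) (digit dB k b') (digit dC k c)))"
      by (simp add: tpow_def tpow3_def prod.distrib)
    also have "\<dots> = (\<Prod>k<n. \<Sum>c<dC. \<Sum>x<dA. of_real (p x) * u x (digit dB k b) c * cnj (u x (digit dB k b') c))"
      by (rule sum_digits_prod2[where g = "\<lambda>k c x. of_real (p x) * u x (digit dB k b) c * cnj (u x (digit dB k b') c)"])
    also have "\<dots> = (\<Prod>k<n. if digit dB k b = digit dB k b' then of_real (q (digit dB k b)) else 0)"
      using b by (intro prod.cong refl margB) (auto intro: digit_less)
    also have "\<dots> = (if b = b' then of_real (tpow dB n q b) else 0)"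
      using prod_digit_delta[of b dB n b' "\<lambda>_ a. complex_of_real (q a)"] b by (simp add: tpow_def)
    finally show "(\<Sum>c<dC ^ n. \<Sum>x<dA ^ n. of_real (tpow dA n p x) * tpow3 dA dB dC n u x b c * cnj (tpow3 dA dB dC n u x b' c)) =
       (if b = b' then of_real (tpow dB n q b) else 0)" .
  next
    fix c c' assume c: "c \<in> {..<dC ^ n}" "c' \<in> {..<dC ^ n}"
    have "(\<Sum>b<dB ^ n. \<Sum>x<dA ^ n. of_real (tpow dA n p x) * tpow3 dA dB dC n u x b c * cnj (tpow3 dA dB dC n u x b c')) =
      (\<Sum>b<dB ^ n. \<Sum>x<dA ^ n. \<Prod>k<n. of_real (p (digit dA k x)) * u (digit dA k x) (digit dB k b) (digit dC k c) * cnj (u (digit dA k x) (digit dB k b) (digit dC k c')))"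
      by (simp add: tpow_def tpow3_def prod.distrib)
    also have "\<dots> = (\<Prod>k<n. \<Sum>b<dB. \<Sum>x<dA. of_real (p x) * u x b (digit dC k c) * cnj (u x b (digit dC k c')))"
      by (rule sum_digits_prod2[where g = "\<lambda>k b x. of_real (p x) * u x b (digit dC k c) * cnj (u x b (digit dC k c'))"])
    also have "\<dots> = (\<Prod>k<n. if digit dC k c = digit dC k c' then of_real (r (digit dC k c)) else 0)"
      using c by (intro prod.cong refl margC) (auto intro: digit_less)
    also have "\<dots> = (if c = c' then of_real (tpow dC n r c) else 0)"
      using prod_digit_delta[of c dC n c' "\<lambda>_ a. complex_of_real (r a)"] c by (simp add: tpow_def)
    finally show "(\<Sum>b<dB ^ n. \<Sum>x<dA ^ n. of_real (tpow dA n p x) * tpow3 dA dB dC n u x b c * cnj (tpow3 dA dB dC n u x b c')) =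
       (if c = c' then of_real (tpow dC n r c) else 0)" .
  qed auto
qed

section \<open>Surprisal, Chebyshev's inequality and typical sets\<close>

definition shan :: "nat \<Rightarrow> (nat \<Rightarrow> real) \<Rightarrow> real" where
  "shan d p = (\<Sum>a<d. p a * (- log 2 (p a)))"

definition svar :: "nat \<Rightarrow> (nat \<Rightarrow> real) \<Rightarrow> real" where
  "svar d p = (\<Sum>a<d. p a * (- log 2 (p a) - shan d p)\<^sup>2)"

definition surp :: "nat \<Rightarrow> nat \<Rightarrow> (nat \<Rightarrow> real) \<Rightarrow> nat \<Rightarrow> real" where
  "surp d n p x = (\<Sum>k<n. - log 2 (p (digit d k x)))"

text \<open>Positivity is demanded separately because \<open>log\<close> is total: a letter of
  probability zero has a finite value in \<open>surp\<close>.\<close>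

definition typical :: "nat \<Rightarrow> nat \<Rightarrow> (nat \<Rightarrow> real) \<Rightarrow> real \<Rightarrow> nat set" where
  "typical d n p D = {x. x < d ^ n \<and> 0 < tpow d n p x \<and> \<bar>surp d n p x - real n * shan d p\<bar> \<le> D}"

text \<open>Mean and variance of a sum of independent copies, by splitting off the top digit. The
  vanishing first moment removes the cross term in the second.\<close>

lemma surp_moments:
  assumes "(\<Sum>a<d. p a) = 1"
  shows "(\<Sum>x<d ^ n. tpow d n p x * (surp d n p x - real n * shan d p)) = 0"
    and "(\<Sum>x<d ^ n. tpow d n p x * (surp d n p x - real n * shan d p)\<^sup>2) = real n * svar d p"
proof (induction n)
  case 0
  show "(\<Sum>x<d ^ 0. tpow d 0 p x * (surp d 0 p x - real 0 * shan d p)) = 0"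
    "(\<Sum>x<d ^ 0. tpow d 0 p x * (surp d 0 p x - real 0 * shan d p)\<^sup>2) = real 0 * svar d p"
    by (simp_all add: surp_def)
next
  case (Suc n)
  define A where "A a = - log 2 (p a) - shan d p" for a
  define Z where "Z y = surp d n p y - real n * shan d p" for y
  have t: "tpow d (Suc n) p (a * d ^ n + y) = p a * tpow d n p y" if "a < d" "y < d ^ n" for a y
    using that by (simp add: tpow_def digit_top digit_low mult.commute)
  have s: "surp d (Suc n) p (a * d ^ n + y) - real (Suc n) * shan d p = A a + Z y" if "a < d" "y < d ^ n" for a y
  proof -
    have "surp d (Suc n) p (a * d ^ n + y) = surp d n p y - log 2 (p a)"
      using that by (simp add: surp_def digit_top digit_low)
    then show ?thesis by (simp add: A_def Z_def algebra_simps)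
  qed
  have A0: "(\<Sum>a<d. p a * A a) = 0"
    using assms by (simp add: A_def right_diff_distrib sum_subtractf shan_def flip: sum_distrib_right)
  have A2: "(\<Sum>a<d. p a * (A a)\<^sup>2) = svar d p" by (simp add: A_def svar_def)
  have P1: "(\<Sum>y<d ^ n. tpow d n p y) = 1" by (simp add: sum_tpow assms)
  have Z0: "(\<Sum>y<d ^ n. tpow d n p y * Z y) = 0" and Z2: "(\<Sum>y<d ^ n. tpow d n p y * (Z y)\<^sup>2) = real n * svar d p"
    using Suc by (simp_all add: Z_def)
  have "(\<Sum>x<d ^ Suc n. tpow d (Suc n) p x * (surp d (Suc n) p x - real (Suc n) * shan d p)) =
     (\<Sum>a<d. \<Sum>y<d ^ n. p a * tpow d n p y * (A a + Z y))"
    unfolding power_Suc sum_lessThan_mult by (intro sum.cong refl) (simp only: t s lessThan_iff)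
  also have "\<dots> = (\<Sum>a<d. p a * A a * (\<Sum>y<d ^ n. tpow d n p y) + p a * (\<Sum>y<d ^ n. tpow d n p y * Z y))"
    by (simp add: sum_distrib_left sum.distrib algebra_simps)
  also have "\<dots> = 0" by (simp add: P1 Z0 A0)
  finally show "(\<Sum>x<d ^ Suc n. tpow d (Suc n) p x * (surp d (Suc n) p x - real (Suc n) * shan d p)) = 0" .
  have "(\<Sum>x<d ^ Suc n. tpow d (Suc n) p x * (surp d (Suc n) p x - real (Suc n) * shan d p)\<^sup>2) =
     (\<Sum>a<d. \<Sum>y<d ^ n. p a * tpow d n p y * (A a + Z y)\<^sup>2)"
    unfolding power_Suc sum_lessThan_mult by (intro sum.cong refl) (simp only: t s lessThan_iff)
  also have "\<dots> = (\<Sum>a<d. p a * (A a)\<^sup>2 * (\<Sum>y<d ^ n. tpow d n p y) + 2 * (p a * A a) * (\<Sum>y<d ^ n. tpow d n p y * Z y)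
      + p a * (\<Sum>y<d ^ n. tpow d n p y * (Z y)\<^sup>2))"
    by (simp add: sum_distrib_left sum.distrib algebra_simps power2_sum)
  also have "\<dots> = svar d p + real n * svar d p" 
    using assms by (simp add: P1 Z0 Z2 A2 sum.distrib flip: sum_distrib_right)
  finally show "(\<Sum>x<d ^ Suc n. tpow d (Suc n) p x * (surp d (Suc n) p x - real (Suc n) * shan d p)\<^sup>2) = real (Suc n) * svar d p"
    by (simp add: algebra_simps)
qed

locale distribution =
  fixes d :: nat and p :: "nat \<Rightarrow> real"
  assumes nonneg: "\<And>a. a < d \<Longrightarrow> 0 \<le> p a" and total: "(\<Sum>a<d. p a) = 1"
begin

lemma le_one: "a < d \<Longrightarrow> p a \<le> 1"
  using member_le_sum[of a "{..<d}" p] nonneg total by auto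

lemma shan_nonneg: "0 \<le> shan d p"
  unfolding shan_def
proof (rule sum_nonneg)
  fix a assume "a \<in> {..<d}"
  then have a: "0 \<le> p a" "p a \<le> 1" using nonneg le_one by auto
  show "0 \<le> p a * - log 2 (p a)"
  proof (cases "p a = 0")
    case False
    then have "log 2 (p a) \<le> 0" using a by simp
    then show ?thesis using a by (simp add: mult_nonneg_nonpos)
  qed simp
qed

lemma svar_nonneg: "0 \<le> svar d p"
  unfolding svar_def by (intro sum_nonneg mult_nonneg_nonneg) (auto intro: nonneg)

lemma tpow_nonneg: "x < d ^ n \<Longrightarrow> 0 \<le> tpow d n p x"
  unfolding tpow_def by (intro prod_nonneg ballI nonneg) (auto intro: digit_less)

lemma typical_subset: "typical d n p D \<subseteq> {..<d ^ n}"
  by (auto simp: typical_def)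

text \<open>Chebyshev's inequality. Sequences excluded for zero probability carry no mass, so only
  the large deviations count.\<close>

lemma atypical_mass:
  assumes "0 < D"
  shows "sum (tpow d n p) ({..<d ^ n} - typical d n p D) \<le> real n * svar d p / D\<^sup>2"
proof -
  let ?Z = "\<lambda>x. surp d n p x - real n * shan d p"
  have "sum (tpow d n p) ({..<d ^ n} - typical d n p D) \<le> (\<Sum>x\<in>{..<d ^ n} - typical d n p D. tpow d n p x * (?Z x)\<^sup>2 / D\<^sup>2)"
  proof (rule sum_mono)
    fix x assume x: "x \<in> {..<d ^ n} - typical d n p D"
    then have nn: "0 \<le> tpow d n p x" using tpow_nonneg by auto
    show "tpow d n p x \<le> tpow d n p x * (?Z x)\<^sup>2 / D\<^sup>2"
    proof (cases "tpow d n p x = 0")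
      case False
      then have "D < \<bar>?Z x\<bar>" using x nn by (auto simp: typical_def)
      then have "D\<^sup>2 \<le> (?Z x)\<^sup>2" using assms by (metis abs_le_square_iff abs_of_pos less_imp_le)
      then have "1 \<le> (?Z x)\<^sup>2 / D\<^sup>2" using assms by simp
      then have "tpow d n p x * 1 \<le> tpow d n p x * ((?Z x)\<^sup>2 / D\<^sup>2)" using nn by (rule mult_left_mono)
      then show ?thesis by simp
    qed simp
  qed
  also have "\<dots> \<le> (\<Sum>x<d ^ n. tpow d n p x * (?Z x)\<^sup>2 / D\<^sup>2)"
    by (rule sum_mono2) (auto intro!: divide_nonneg_nonneg mult_nonneg_nonneg tpow_nonneg)
  also have "\<dots> = real n * svar d p / D\<^sup>2"
    using surp_moments(2)[OF total, of n] by (simp flip: sum_divide_distrib)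
  finally show ?thesis .
qed

lemma tpow_powr:
  assumes "x \<in> typical d n p D"
  shows "tpow d n p x = 2 powr (- surp d n p x)"
proof -
  have pos: "0 < tpow d n p x" and x: "x < d ^ n" using assms by (auto simp: typical_def)
  have dig: "0 < p (digit d k x)" if "k < n" for k
  proof -
    have "p (digit d k x) \<noteq> 0"
    proof
      assume "p (digit d k x) = 0"
      then have "tpow d n p x = 0" unfolding tpow_def using that by (intro prod_zero) auto
      then show False using pos by simp
    qed
    then show ?thesis using nonneg[OF digit_less[OF x that]] by simp
  qed
  have "log 2 (tpow d n p x) = - surp d n p x"
    unfolding tpow_def surp_def using dig
  proof (induction n)
    case (Suc n)
    then have "0 < (\<Prod>k<n. p (digit d k x))" by (auto intro: prod_pos)
    then show ?case using Suc by (simp add: log_mult_pos)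
  qed simp
  moreover have "2 powr (log 2 (tpow d n p x)) = tpow d n p x" using pos by simp
  ultimately show ?thesis by simp
qed

lemma typical_upper: "x \<in> typical d n p D \<Longrightarrow> tpow d n p x \<le> 2 powr (D - real n * shan d p)"
  unfolding tpow_powr by (rule powr_mono) (auto simp: typical_def)

lemma typical_lower: "x \<in> typical d n p D \<Longrightarrow> 2 powr (- D - real n * shan d p) \<le> tpow d n p x"
  unfolding tpow_powr by (rule powr_mono) (auto simp: typical_def)

lemma sum_typical_le: "sum (tpow d n p) (typical d n p D) \<le> 1"
proof -
  have "sum (tpow d n p) (typical d n p D) \<le> sum (tpow d n p) {..<d ^ n}"
    using typical_subset by (intro sum_mono2) (auto intro: tpow_nonneg)
  then show ?thesis by (simp add: sum_tpow total)
qed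

text \<open>Greatest probability times total mass. With \<open>card_typical\<close>, this is how
  entropies enter the coding bounds.\<close>

lemma typical_purity: "(\<Sum>x\<in>typical d n p D. (tpow d n p x)\<^sup>2) \<le> 2 powr (D - real n * shan d p)"
proof -
  have "(\<Sum>x\<in>typical d n p D. (tpow d n p x)\<^sup>2) \<le> (\<Sum>x\<in>typical d n p D. 2 powr (D - real n * shan d p) * tpow d n p x)"
    unfolding power2_eq_square
    by (intro sum_mono mult_right_mono typical_upper) (auto simp: typical_def intro: tpow_nonneg)
  also have "\<dots> = 2 powr (D - real n * shan d p) * sum (tpow d n p) (typical d n p D)"
    by (simp add: sum_distrib_left)
  also have "\<dots> \<le> 2 powr (D - real n * shan d p) * 1"
    by (intro mult_left_mono sum_typical_le) simp
  finally show ?thesis by simp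
qed

lemma card_typical: "real (card (typical d n p D)) \<le> 2 powr (real n * shan d p + D)"
proof -
  have "real (card (typical d n p D)) * 2 powr (- D - real n * shan d p) = (\<Sum>x\<in>typical d n p D. 2 powr (- D - real n * shan d p))"
    by simp
  also have "\<dots> \<le> sum (tpow d n p) (typical d n p D)"
    by (intro sum_mono typical_lower)
  also have "\<dots> \<le> 1" by (rule sum_typical_le)
  finally have "real (card (typical d n p D)) * 2 powr (- D - real n * shan d p) * 2 powr (real n * shan d p + D) \<le> 1 * 2 powr (real n * shan d p + D)"
    by (rule mult_right_mono) simp
  then show ?thesis by (simp add: mult.assoc flip: powr_add)
qed

end

section \<open>Spectral decomposition\<close>

text \<open>  fixes
The last conjunct says that \<open>P j\<close> lies in the span of \<open>e 0, \<dots>, e j\<close>, tested by orthogonality.\<close>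
lemma gram_schmidt_triangular:
  fixes P Q :: "nat \<Rightarrow> nat \<Rightarrow> complex"
  assumes inv: "\<And>m l. m < d \<Longrightarrow> l < d \<Longrightarrow> (\<Sum>i<d. Q m i * P l i) = (if m = l then 1 else 0)"
  shows "m \<le> d \<Longrightarrow> \<exists>e R. pons {..<d} {..<m} e \<and> (\<forall>j<m. ip {..<d} (e j) (e j) = 1) \<and>
    (\<forall>j<m. \<forall>i<d. e j i = (\<Sum>l<d. R j l * P l i)) \<and> (\<forall>j<m. \<forall>l. j < l \<longrightarrow> R j l = 0) \<and>
    (\<forall>j<m. \<forall>w. (\<forall>l\<le>j. ip {..<d} w (e l) = 0) \<longrightarrow> ip {..<d} w (P j) = 0)"
proof (induction m)
  case 0
  then show ?case by (auto simp: pons_def)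
next
  case (Suc m)
  let ?S = "{..<d}"
  from Suc obtain e R where e: "pons ?S {..<m} e" "\<And>j. j < m \<Longrightarrow> ip ?S (e j) (e j) = 1"
    and R: "\<And>j i. j < m \<Longrightarrow> i < d \<Longrightarrow> e j i = (\<Sum>l<d. R j l * P l i)"
    and R0: "\<And>j l. j < m \<Longrightarrow> j < l \<Longrightarrow> R j l = 0"
    and w: "\<And>j w. j < m \<Longrightarrow> (\<forall>l\<le>j. ip ?S w (e l) = 0) \<Longrightarrow> ip ?S w (P j) = 0" by auto
  have md: "m < d" using Suc by simp
  have nm: "m \<notin> {..<m}" by simp
  let ?t = "\<lambda>j. ip ?S (e j) (P m)"
  obtain g where g: "pons ?S (insert m {..<m}) (e(m := g))"
    "\<exists>c. \<forall>s. g s = c * (P m s - (\<Sum>j<m. ?t j * e j s))"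
    "\<forall>s\<in>?S. P m s = (\<Sum>j<m. ?t j * e j s) + ip ?S g (P m) * g s"
    "(cmod (ip ?S g (P m)))\<^sup>2 = nsq ?S (P m) - (\<Sum>j<m. (cmod (?t j))\<^sup>2)"
    by (rule gs_step[OF finite_lessThan finite_lessThan e(1) nm, where v = "P m"])
  from g(2) obtain c where c: "\<And>s. g s = c * (P m s - (\<Sum>j<m. ?t j * e j s))" by auto
  \<comment> \<open>Coefficients of the residual in terms of the \<open>P l\<close>. The one at
    \<open>m\<close> is 1, because the earlier vectors involve only smaller indices.\<close>
  define K where "K l = (if l = m then 1 else 0) - (\<Sum>j<m. ?t j * R j l)" for l
  have K: "P m i - (\<Sum>j<m. ?t j * e j i) = (\<Sum>l<d. K l * P l i)" if "i < d" for i
  proof -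
    have "(\<Sum>j<m. ?t j * e j i) = (\<Sum>j<m. \<Sum>l<d. ?t j * R j l * P l i)"
      using R that by (simp add: sum_distrib_left mult.assoc)
    also have "\<dots> = (\<Sum>l<d. (\<Sum>j<m. ?t j * R j l) * P l i)"
      by (subst sum.swap) (simp add: sum_distrib_right)
    finally have 1: "(\<Sum>j<m. ?t j * e j i) = (\<Sum>l<d. (\<Sum>j<m. ?t j * R j l) * P l i)" .
    have 2: "P m i = (\<Sum>l<d. (if l = m then 1 else 0) * P l i)"
      using md by (simp add: if_distrib[of "\<lambda>z. z * _"] cong: if_cong)
    show ?thesis
      unfolding 1 by (subst 2) (simp only: K_def left_diff_distrib sum_subtractf)
  qed
  have Km: "K m = 1" using R0 by (simp add: K_def)
  \<comment> \<open>A null \<open>g\<close> would make the combination of the \<open>P l\<close>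
    with coefficients \<open>K\<close> vanish, but the left inverse \<open>Q\<close> reads off
    \<open>K m = 1\<close> from it.\<close>
  have gg: "ip ?S g g = 1"
  proof (rule ccontr)
    assume "ip ?S g g \<noteq> 1"
    then have g0: "g s = 0" if "s \<in> ?S" for s
      using pons_null[OF _ g(1), of m s] that by simp
    have z: "(\<Sum>l<d. K l * P l i) = 0" if "i < d" for i
      using bspec[OF g(3), of i] g0[of i] K[OF that] that by simp
    have "0 = (\<Sum>i<d. Q m i * (\<Sum>l<d. K l * P l i))" using z by simp
    also have "\<dots> = (\<Sum>i<d. \<Sum>l<d. K l * (Q m i * P l i))"
      by (simp add: sum_distrib_left mult.left_commute)
    also have "\<dots> = (\<Sum>l<d. K l * (\<Sum>i<d. Q m i * P l i))"
      by (subst sum.swap) (simp add: sum_distrib_left)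
    also have "\<dots> = (\<Sum>l<d. if l = m then K l else 0)"
      using inv[OF md] by (intro sum.cong) auto
    also have "\<dots> = 1" using md Km by simp
    finally show False by simp
  qed
  define e' where "e' = e(m := g)"
  define R' where "R' = R(m := (\<lambda>l. c * K l))"
  have "pons ?S {..<Suc m} e'" using g(1) by (simp add: e'_def lessThan_Suc)
  moreover have "\<forall>j<Suc m. ip ?S (e' j) (e' j) = 1"
    using e(2) gg by (auto simp: e'_def less_Suc_eq)
  moreover have "\<forall>j<Suc m. \<forall>i<d. e' j i = (\<Sum>l<d. R' j l * P l i)"
    using R c K by (auto simp: e'_def R'_def less_Suc_eq sum_distrib_left mult.assoc)
  moreover have "\<forall>j<Suc m. \<forall>l. j < l \<longrightarrow> R' j l = 0"
    using R0 by (auto simp: R'_def less_Suc_eq K_def)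
  moreover have "ip ?S w (P j) = 0" if j: "j < Suc m" and h: "\<forall>l\<le>j. ip ?S w (e' l) = 0" for j w
  proof (cases "j = m")
    case False
    have "\<forall>l\<le>j. ip ?S w (e l) = 0"
    proof (intro allI impI)
      fix l assume "l \<le> j"
      then show "ip ?S w (e l) = 0" using h[rule_format, of l] False j by (simp add: e'_def)
    qed
    then show ?thesis using w[of j w] False j by simp
  next
    case True
    have "ip ?S w (P m) = ip ?S w (\<lambda>s. (\<Sum>j<m. ?t j * e j s) + ip ?S g (P m) * g s)"
      using g(3) by (intro ip_cong) auto
    also have "\<dots> = (\<Sum>j<m. ?t j * ip ?S w (e j)) + ip ?S g (P m) * ip ?S w g"
      by (simp only: ip_add_right ip_sum_right ip_scale_right)
    also have "\<dots> = 0"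
    proof -
      have "ip ?S w (e j) = 0" if "j < m" for j
        using h[rule_format, of j] True that by (simp add: e'_def)
      moreover have "ip ?S w g = 0" using h[rule_format, of m] True by (simp add: e'_def)
      ultimately show ?thesis by simp
    qed
    finally show ?thesis using True by simp
  qed
  ultimately show ?case by blast
qed

section \<open>Matrices in coordinates and diagonalisation of positive operators\<close>

lemma adj_carrier: "A \<in> carrier_mat m n \<Longrightarrow> adj A \<in> carrier_mat n m"
  unfolding mat_adjoint_def by auto

lemma adj_index: "A \<in> carrier_mat m n \<Longrightarrow> i < n \<Longrightarrow> j < m \<Longrightarrow> adj A $$ (i, j) = cnj (A $$ (j, i))"
  unfolding mat_adjoint_def by (auto simp: mat_of_rows_index)

lemma mult_mat_index:
  assumes "A \<in> carrier_mat m n" "B \<in> carrier_mat n k" "i < m" "j < k"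
  shows "(A * B) $$ (i, j) = (\<Sum>l<n. A $$ (i, l) * B $$ (l, j))"
  using assms by (auto simp: scalar_prod_def atLeast0LessThan intro!: sum.cong)

lemma qform_sum:
  assumes "A \<in> carrier_mat d d" "v \<in> carrier_vec d"
  shows "qform A v = (\<Sum>i<d. \<Sum>j<d. cnj (v $ i) * A $$ (i, j) * v $ j)"
proof -
  have "qform A v = (\<Sum>i<d. cnj (v $ i) * (\<Sum>j<d. A $$ (i, j) * v $ j))"
    using assms by (auto simp: qform_def scalar_prod_def atLeast0LessThan intro!: sum.cong)
  then show ?thesis by (simp add: sum_distrib_left mult.assoc)
qed

text \<open>Positivity is defined through the quadratic form alone, and Hermitian symmetry follows
  by polarisation: basis vectors give a real diagonal, and e_i + z e_j with z = 1 and z = \<i>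
  compares the imaginary and the real parts off the diagonal.\<close>

lemma psd_hermitian:
  assumes A: "psd d A" and i: "i < d" and j: "j < d"
  shows "A $$ (i, j) = cnj (A $$ (j, i))"
proof -
  have C: "A \<in> carrier_mat d d" using A by (simp add: psd_def)
  have im: "Im (\<Sum>k<d. \<Sum>l<d. cnj (f k) * A $$ (k, l) * f l) = 0" for f
  proof -
    have "Im (qform A (vec d f)) = 0" using A by (simp add: psd_def)
    moreover have "qform A (vec d f) = (\<Sum>k<d. \<Sum>l<d. cnj (f k) * A $$ (k, l) * f l)"
      using qform_sum[OF C, of "vec d f"] by simp
    ultimately show ?thesis by simp
  qed
  have dd: "Im (A $$ (k, k)) = 0" if "k < d" for k
  proof -
    have "(\<Sum>k'<d. \<Sum>l<d. cnj (if k' = k then 1 else 0) * A $$ (k', l) * (if l = k then 1 else 0)) =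
      (\<Sum>k'<d. \<Sum>l<d. if l = k then (if k' = k then A $$ (k', l) else 0) else 0)"
      by (intro sum.cong refl) auto
    also have "\<dots> = A $$ (k, k)" using that by simp
    finally show ?thesis using im[of "\<lambda>l. if l = k then 1 else 0"] by simp
  qed
  show ?thesis
  proof (cases "i = j")
    case True
    then show ?thesis using dd[OF i] by (simp add: complex_eq_iff)
  next
    case False
    have two: "(\<Sum>k<d. \<Sum>l<d. cnj (if k = i then 1 else if k = j then z else 0) * A $$ (k, l) * (if l = i then 1 else if l = j then z else 0)) =
      A $$ (i, i) + z * A $$ (i, j) + cnj z * A $$ (j, i) + cnj z * z * A $$ (j, j)" for z
    proof -
      have s: "(\<Sum>l<d. h l * (if l = i then 1 else if l = j then z else 0)) = h i + h j * z" for h :: "nat \<Rightarrow> complex" and z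
      proof -
        have "(\<Sum>l<d. h l * (if l = i then 1 else if l = j then z else 0)) = (\<Sum>l<d. (if l = i then h l else 0) + (if l = j then h l * z else 0))"
          using False by (intro sum.cong) auto
        also have "\<dots> = h i + h j * z" using i j by (simp add: sum.distrib)
        finally show ?thesis .
      qed
      have c: "cnj (if k = i then 1 else if k = j then z else 0) = (if k = i then 1 else if k = j then cnj z else 0)" for k
        by simp
      have "(\<Sum>k<d. \<Sum>l<d. cnj (if k = i then 1 else if k = j then z else 0) * A $$ (k, l) * (if l = i then 1 else if l = j then z else 0)) =
        (\<Sum>k<d. (A $$ (k, i) + A $$ (k, j) * z) * (if k = i then 1 else if k = j then cnj z else 0))"
        unfolding s[of "\<lambda>l. _ * A $$ (_, l)"] c by (intro sum.cong refl) (simp add: algebra_simps)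
      also have "\<dots> = A $$ (i, i) + z * A $$ (i, j) + cnj z * A $$ (j, i) + cnj z * z * A $$ (j, j)"
        unfolding s by (simp add: algebra_simps)
      finally show ?thesis .
    qed
    have "Im (A $$ (i, j)) + Im (A $$ (j, i)) = 0"
      using im[of "\<lambda>l. if l = i then 1 else if l = j then 1 else 0"] two[of 1] dd[OF i] dd[OF j] by simp
    moreover have "Re (A $$ (i, j)) - Re (A $$ (j, i)) = 0"
      using im[of "\<lambda>l. if l = i then 1 else if l = j then \<i> else 0"] two[of "\<i>"] dd[OF i] dd[OF j] by simp
    ultimately show ?thesis by (simp add: complex_eq_iff)
  qed
qed

text \<open>Both orthogonality relations and both readings of diagonality are stored: orthonormality
  for embeddings, completeness for changes of basis, the matrix elements for marginals, the
  expansion for rebuilding \<open>A\<close>.\<close>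

definition eigbasis :: "nat \<Rightarrow> complex mat \<Rightarrow> (nat \<Rightarrow> nat \<Rightarrow> complex) \<Rightarrow> (nat \<Rightarrow> real) \<Rightarrow> bool" where
  "eigbasis d A e p \<longleftrightarrow>
     (\<forall>x<d. \<forall>x'<d. (\<Sum>i<d. cnj (e x i) * e x' i) = (if x = x' then 1 else 0)) \<and>
     (\<forall>i<d. \<forall>j<d. (\<Sum>x<d. e x i * cnj (e x j)) = (if i = j then 1 else 0)) \<and>
     (\<forall>x<d. 0 \<le> p x) \<and>
     (\<forall>x<d. \<forall>x'<d. (\<Sum>i<d. \<Sum>j<d. cnj (e x i) * A $$ (i, j) * e x' j) = (if x = x' then of_real (p x) else 0)) \<and>
     (\<forall>i<d. \<forall>j<d. A $$ (i, j) = (\<Sum>x<d. of_real (p x) * e x i * cnj (e x j)))"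

text \<open>A Schur decomposition supplies an upper triangular matrix under a merely invertible
  change of basis. Gram-Schmidt on the columns keeps their flag of spans, so triangularity survives
  while the basis becomes orthonormal.\<close>

lemma unitary_triangularization:
  assumes A: "A \<in> carrier_mat d d"
  shows "\<exists>e. (\<forall>x<d. \<forall>x'<d. ip {..<d} (e x) (e x') = (if x = x' then 1 else (0::complex))) \<and>
    (\<forall>x<d. \<forall>x'<x. (\<Sum>i<d. \<Sum>j<d. cnj (e x i) * A $$ (i, j) * e x' j) = 0)"
proof -
  obtain es where es: "char_poly A = (\<Prod>a\<leftarrow>es. [:- a, 1:])" using char_poly_factorized[OF A] by auto
  obtain B P Q where "schur_decomposition A es = (B, P, Q)" by (metis prod_cases3)
  from schur_decomposition[OF A es this] have sim: "similar_mat_wit A B P Q" and ut: "upper_triangular B" by auto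
  note W = similar_mat_witD2[OF A sim]
  have inv: "(\<Sum>i<d. Q $$ (m, i) * P $$ (i, l)) = (if m = l then 1 else 0)" if "m < d" "l < d" for m l
    using arg_cong[OF W(2), of "\<lambda>M. M $$ (m, l)"] mult_mat_index[OF W(7,6) that] that by simp
  have "\<exists>e R. pons {..<d} {..<d} e \<and> (\<forall>j<d. ip {..<d} (e j) (e j) = 1) \<and>
    (\<forall>j<d. \<forall>i<d. e j i = (\<Sum>l<d. R j l * P $$ (i, l))) \<and> (\<forall>j<d. \<forall>l. j < l \<longrightarrow> R j l = 0) \<and>
    (\<forall>j<d. \<forall>w. (\<forall>l\<le>j. ip {..<d} w (e l) = 0) \<longrightarrow> ip {..<d} w (\<lambda>i. P $$ (i, j)) = 0)"
    by (rule gram_schmidt_triangular[where P = "\<lambda>l i. P $$ (i, l)" and Q = "\<lambda>m i. Q $$ (m, i)", OF inv order_refl])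
  then obtain e R where H: "pons {..<d} {..<d} e \<and> (\<forall>j<d. ip {..<d} (e j) (e j) = 1) \<and>
    (\<forall>j<d. \<forall>i<d. e j i = (\<Sum>l<d. R j l * P $$ (i, l))) \<and> (\<forall>j<d. \<forall>l. j < l \<longrightarrow> R j l = 0) \<and>
    (\<forall>j<d. \<forall>w. (\<forall>l\<le>j. ip {..<d} w (e l) = 0) \<longrightarrow> ip {..<d} w (\<lambda>i. P $$ (i, j)) = 0)"
    by (elim exE)
  have pe: "pons {..<d} {..<d} e" and e1: "\<And>j. j < d \<Longrightarrow> ip {..<d} (e j) (e j) = 1"
    and R0: "\<And>j l. j < d \<Longrightarrow> j < l \<Longrightarrow> R j l = 0"
    and w: "\<And>j w. j < d \<Longrightarrow> (\<forall>l\<le>j. ip {..<d} w (e l) = 0) \<Longrightarrow> ip {..<d} w (\<lambda>i. P $$ (i, j)) = 0"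
    using H by simp_all
  have R: "e j i = (\<Sum>l<d. R j l * P $$ (i, l))" if "j < d" "i < d" for i j
    using conjunct1[OF conjunct2[OF conjunct2[OF H]]] that by blast
  have AP: "(\<Sum>j<d. A $$ (i, j) * P $$ (j, l)) = (\<Sum>k<d. B $$ (k, l) * P $$ (i, k))" if "i < d" "l < d" for i l
  proof -
    have "A * P = P * B * (Q * P)"
      unfolding W(3) using W(4-7) by (simp add: assoc_mult_mat[of _ d d _ d _ d])
    also have "\<dots> = P * B" unfolding W(2) using W(4-7) by simp
    finally have "(A * P) $$ (i, l) = (P * B) $$ (i, l)" by simp
    then show ?thesis
      using mult_mat_index[OF A W(6) that] mult_mat_index[OF W(6,5) that] by (simp add: mult.commute)
  qed
  have "(\<Sum>i<d. \<Sum>j<d. cnj (e x i) * A $$ (i, j) * e x' j) = 0" if x: "x < d" "x' < x" for x x'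
  proof -
    have orth: "ip {..<d} (e x) (\<lambda>i. P $$ (i, l)) = 0" if "l \<le> x'" for l
    proof (rule w)
      show "l < d" using that x by simp
      show "\<forall>k\<le>l. ip {..<d} (e x) (e k) = 0"
        using pe x that by (auto simp: pons_def)
    qed
    \<comment> \<open>\<open>e x'\<close> involves only columns of \<open>P\<close> up to
      \<open>x'\<close>, \<open>A\<close> maps these to columns up to \<open>x'\<close>, and
      \<open>e x\<close> is orthogonal to all of them.\<close>
    have "(\<Sum>i<d. \<Sum>j<d. cnj (e x i) * A $$ (i, j) * e x' j) =
       (\<Sum>i<d. cnj (e x i) * (\<Sum>j<d. A $$ (i, j) * (\<Sum>l<d. R x' l * P $$ (j, l))))"
      using R x by (simp add: sum_distrib_left mult.assoc)
    also have "\<dots> = (\<Sum>i<d. cnj (e x i) * (\<Sum>l<d. R x' l * (\<Sum>j<d. A $$ (i, j) * P $$ (j, l))))"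
    proof -
      have "(\<Sum>j<d. A $$ (i, j) * (\<Sum>l<d. R x' l * P $$ (j, l))) = (\<Sum>l<d. R x' l * (\<Sum>j<d. A $$ (i, j) * P $$ (j, l)))" for i
        unfolding sum_distrib_left by (subst sum.swap) (simp add: mult_ac)
      then show ?thesis by simp
    qed
    also have "\<dots> = ip {..<d} (e x) (\<lambda>i. \<Sum>l<d. R x' l * (\<Sum>k<d. B $$ (k, l) * P $$ (i, k)))"
      unfolding ip_def using AP by simp
    also have "\<dots> = (\<Sum>l<d. R x' l * (\<Sum>k<d. B $$ (k, l) * ip {..<d} (e x) (\<lambda>i. P $$ (i, k))))"
      by (simp only: ip_sum_right)
    also have "\<dots> = 0"
    proof (intro sum.neutral ballI)
      fix l assume l: "l \<in> {..<d}"
      show "R x' l * (\<Sum>k<d. B $$ (k, l) * ip {..<d} (e x) (\<lambda>i. P $$ (i, k))) = 0"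
      proof (cases "l \<le> x'")
        case False
        then show ?thesis using R0[of x' l] x by simp
      next
        case True
        have "B $$ (k, l) * ip {..<d} (e x) (\<lambda>i. P $$ (i, k)) = 0" if "k < d" for k
        proof (cases "k \<le> l")
          case le: True
          then show ?thesis using orth[of k] True by simp
        next
          case False
          then show ?thesis using ut that W(5) by (auto simp: upper_triangular_def)
        qed
        then have "(\<Sum>k<d. B $$ (k, l) * ip {..<d} (e x) (\<lambda>i. P $$ (i, k))) = 0"
          by (intro sum.neutral) auto
        then show ?thesis by simp
      qed
    qed
    finally show ?thesis .
  qed
  moreover have "ip {..<d} (e x) (e x') = (if x = x' then 1 else 0)" if "x < d" "x' < d" for x x'
    using pe e1 that by (auto simp: pons_def)
  ultimately show ?thesis by blast
qed

text \<open>A left inverse of a square matrix is also a right inverse.\<close>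

lemma orthonormal_complete:
  fixes e :: "nat \<Rightarrow> nat \<Rightarrow> complex"
  assumes "\<And>x x'. x < d \<Longrightarrow> x' < d \<Longrightarrow> (\<Sum>i<d. cnj (e x i) * e x' i) = (if x = x' then 1 else 0)" "i < d" "j < d"
  shows "(\<Sum>x<d. e x i * cnj (e x j)) = (if i = j then 1 else 0)"
proof -
  define E where "E = mat d d (\<lambda>(i, x). e x i)"
  have E: "E \<in> carrier_mat d d" by (simp add: E_def)
  have Ei: "E $$ (i, x) = e x i" "adj E $$ (x, i) = cnj (e x i)" if "i < d" "x < d" for i x
    using that adj_index[OF E that(2,1)] by (simp_all add: E_def)
  have "adj E * E = 1\<^sub>m d"
  proof (rule eq_matI)
    fix x x' assume "x < dim_row (1\<^sub>m d :: complex mat)" "x' < dim_col (1\<^sub>m d :: complex mat)"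
    then have x: "x < d" "x' < d" by auto
    have "(adj E * E) $$ (x, x') = (\<Sum>i<d. adj E $$ (x, i) * E $$ (i, x'))"
      by (rule mult_mat_index[OF adj_carrier[OF E] E x])
    also have "\<dots> = (\<Sum>i<d. cnj (e x i) * e x' i)"
      using x by (intro sum.cong) (auto simp: Ei)
    finally show "(adj E * E) $$ (x, x') = 1\<^sub>m d $$ (x, x')" using x assms(1) by simp
  qed (use adj_carrier[OF E] E in auto)
  then have "E * adj E = 1\<^sub>m d"
    by (rule mat_mult_left_right_inverse[OF adj_carrier[OF E] E])
  then have "(\<Sum>x<d. E $$ (i, x) * adj E $$ (x, j)) = 1\<^sub>m d $$ (i, j)"
    using mult_mat_index[OF E adj_carrier[OF E] assms(2,3)] by simp
  moreover have "(\<Sum>x<d. E $$ (i, x) * adj E $$ (x, j)) = (\<Sum>x<d. e x i * cnj (e x j))"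
    using assms by (intro sum.cong) (auto simp: Ei)
  ultimately show ?thesis using assms by simp
qed

text \<open>Triangular and Hermitian means diagonal; the diagonal entries are values of the
  quadratic form, hence real and nonnegative.\<close>

lemma psd_eigbasis:
  assumes A: "psd d A"
  shows "\<exists>e p. eigbasis d A e p"
proof -
  have C: "A \<in> carrier_mat d d" using A by (simp add: psd_def)
  obtain e where on: "\<And>x x'. x < d \<Longrightarrow> x' < d \<Longrightarrow> (\<Sum>i<d. cnj (e x i) * e x' i) = (if x = x' then 1 else (0::complex))"
    and ut: "\<And>x x'. x < d \<Longrightarrow> x' < x \<Longrightarrow> (\<Sum>i<d. \<Sum>j<d. cnj (e x i) * A $$ (i, j) * e x' j) = 0"
    using unitary_triangularization[OF C] unfolding ip_def by blast
  define L where "L x x' = (\<Sum>i<d. \<Sum>j<d. cnj (e x i) * A $$ (i, j) * e x' j)" for x x'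
  note comp = orthonormal_complete[OF on]
  have Lh: "L x' x = cnj (L x x')" for x x'
  proof -
    have "cnj (L x x') = (\<Sum>i<d. \<Sum>j<d. cnj (e x' j) * A $$ (j, i) * e x i)"
      unfolding L_def cnj_sum
    proof (intro sum.cong refl)
      fix i j assume "i \<in> {..<d}" "j \<in> {..<d}"
      then have "A $$ (j, i) = cnj (A $$ (i, j))" using psd_hermitian[OF A, of j i] by simp
      then show "cnj (cnj (e x i) * A $$ (i, j) * e x' j) = cnj (e x' j) * A $$ (j, i) * e x i"
        by (simp add: mult_ac)
    qed
    also have "\<dots> = L x' x" unfolding L_def by (rule sum.swap)
    finally show ?thesis by simp
  qed
  define p where "p x = Re (L x x)" for x
  have qf: "L x x = qform A (vec d (e x))" for x
    using qform_sum[OF C, of "vec d (e x)"] by (simp add: L_def)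
  have Lxx: "L x x = of_real (p x)" and p0: "0 \<le> p x" for x
    using A qf[of x] by (auto simp: psd_def p_def complex_eq_iff)
  have L: "L x x' = (if x = x' then of_real (p x) else 0)" if "x < d" "x' < d" for x x'
    using ut[OF that(1), of x'] ut[OF that(2), of x] Lh[of x x'] Lxx
    by (cases x x' rule: linorder_cases) (auto simp: L_def)
  \<comment> \<open>Inserts the resolution of the identity on both sides of
    \<open>A\<close>.\<close>
  have rec: "A $$ (i, j) = (\<Sum>x<d. of_real (p x) * e x i * cnj (e x j))" if ij: "i < d" "j < d" for i j
  proof -
    have "(\<Sum>x<d. of_real (p x) * e x i * cnj (e x j)) = (\<Sum>x<d. \<Sum>x'<d. L x x' * e x i * cnj (e x' j))"
    proof (rule sum.cong[OF refl])
      fix x assume x: "x \<in> {..<d}"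
      have "(\<Sum>x'<d. L x x' * e x i * cnj (e x' j)) = (\<Sum>x'<d. if x' = x then of_real (p x) * e x i * cnj (e x j) else 0)"
        using x L by (intro sum.cong) auto
      then show "of_real (p x) * e x i * cnj (e x j) = (\<Sum>x'<d. L x x' * e x i * cnj (e x' j))" using x by simp
    qed
    also have "\<dots> = (\<Sum>x<d. \<Sum>x'<d. \<Sum>k<d. \<Sum>l<d. (e x i * cnj (e x k)) * (A $$ (k, l) * (e x' l * cnj (e x' j))))"
      unfolding L_def sum_distrib_right by (intro sum.cong refl) (simp add: mult_ac)
    also have "\<dots> = (\<Sum>x<d. \<Sum>k<d. \<Sum>x'<d. \<Sum>l<d. (e x i * cnj (e x k)) * (A $$ (k, l) * (e x' l * cnj (e x' j))))"
      by (intro sum.cong[OF refl] sum.swap)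
    also have "\<dots> = (\<Sum>x<d. \<Sum>k<d. \<Sum>l<d. \<Sum>x'<d. (e x i * cnj (e x k)) * (A $$ (k, l) * (e x' l * cnj (e x' j))))"
      by (intro sum.cong[OF refl] sum.swap)
    also have "\<dots> = (\<Sum>x<d. \<Sum>k<d. \<Sum>l<d. (e x i * cnj (e x k)) * (A $$ (k, l) * (if l = j then 1 else 0)))"
    proof (intro sum.cong refl)
      fix x k l assume "l \<in> {..<d}"
      then show "(\<Sum>x'<d. (e x i * cnj (e x k)) * (A $$ (k, l) * (e x' l * cnj (e x' j)))) = (e x i * cnj (e x k)) * (A $$ (k, l) * (if l = j then 1 else 0))"
        using comp[of l j] ij by (simp only: sum_distrib_left[symmetric] lessThan_iff)
    qed
    also have "\<dots> = (\<Sum>x<d. \<Sum>k<d. (e x i * cnj (e x k)) * A $$ (k, j))"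
    proof (intro sum.cong refl)
      fix x k
      have "(\<Sum>l<d. (e x i * cnj (e x k)) * (A $$ (k, l) * (if l = j then 1 else 0))) = (\<Sum>l<d. if l = j then (e x i * cnj (e x k)) * A $$ (k, l) else 0)"
        by (intro sum.cong) auto
      then show "(\<Sum>l<d. (e x i * cnj (e x k)) * (A $$ (k, l) * (if l = j then 1 else 0))) = (e x i * cnj (e x k)) * A $$ (k, j)"
        using ij by simp
    qed
    also have "\<dots> = (\<Sum>k<d. \<Sum>x<d. (e x i * cnj (e x k)) * A $$ (k, j))" by (rule sum.swap)
    also have "\<dots> = (\<Sum>k<d. if k = i then A $$ (k, j) else 0)"
      using comp ij by (intro sum.cong) (auto simp: sum_distrib_right[symmetric])
    also have "\<dots> = A $$ (i, j)" using ij by simp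
    finally show ?thesis by simp
  qed
  have "eigbasis d A e p"
    unfolding eigbasis_def using on comp p0 L rec by (simp add: L_def)
  then show ?thesis by blast
qed

text \<open>Unitary similarity to a diagonal matrix splits the characteristic polynomial into linear
  factors with roots \<open>p x\<close>. This ties eigenbases to the entropy, which is defined from
  \<open>eigs\<close>.\<close>

lemma eigbasis_eigs:
  assumes C: "A \<in> carrier_mat d d" and eb: "eigbasis d A e p"
  shows "eigs A = image_mset (\<lambda>x. complex_of_real (p x)) (mset [0..<d])"
proof -
  define E where "E = mat d d (\<lambda>(i, x). e x i)"
  define M where "M = mat d d (\<lambda>(x, x'). if x = x' then complex_of_real (p x) else 0)"
  have E: "E \<in> carrier_mat d d" and M: "M \<in> carrier_mat d d" by (simp_all add: E_def M_def)
  note aE = adj_carrier[OF E]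
  have Ei: "E $$ (i, x) = e x i" "adj E $$ (x, i) = cnj (e x i)" if "i < d" "x < d" for i x
    using that adj_index[OF E that(2,1)] by (simp_all add: E_def)
  have EE: "E * adj E = 1\<^sub>m d"
  proof (rule eq_matI)
    fix i j assume "i < dim_row (1\<^sub>m d :: complex mat)" "j < dim_col (1\<^sub>m d :: complex mat)"
    then have ij: "i < d" "j < d" by auto
    have "(E * adj E) $$ (i, j) = (\<Sum>x<d. e x i * cnj (e x j))"
      unfolding mult_mat_index[OF E aE ij] using ij by (intro sum.cong) (auto simp: Ei)
    then show "(E * adj E) $$ (i, j) = 1\<^sub>m d $$ (i, j)" using eb ij by (simp add: eigbasis_def)
  qed (use aE E in auto)
  have aEE: "adj E * E = 1\<^sub>m d" by (rule mat_mult_left_right_inverse[OF E aE EE])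
  have EM: "(E * M) $$ (i, x) = of_real (p x) * e x i" if "i < d" "x < d" for i x
  proof -
    have "(E * M) $$ (i, x) = (\<Sum>l<d. if l = x then of_real (p x) * e x i else 0)"
      unfolding mult_mat_index[OF E M that] using that by (intro sum.cong) (auto simp: E_def M_def)
    then show ?thesis using that by simp
  qed
  have "A = E * M * adj E"
  proof (rule eq_matI)
    fix i j assume "i < dim_row (E * M * adj E)" "j < dim_col (E * M * adj E)"
    then have ij: "i < d" "j < d" using E aE by auto
    have "(E * M * adj E) $$ (i, j) = (\<Sum>x<d. (E * M) $$ (i, x) * adj E $$ (x, j))"
      by (rule mult_mat_index[OF _ aE ij]) (use E M in simp)
    also have "\<dots> = (\<Sum>x<d. of_real (p x) * e x i * cnj (e x j))"
      using ij by (intro sum.cong) (auto simp: EM Ei)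
    finally show "A $$ (i, j) = (E * M * adj E) $$ (i, j)" using eb ij by (simp add: eigbasis_def)
  qed (use E aE C in auto)
  then have "similar_mat_wit A M E (adj E)"
    by (rule similar_mat_witI[OF EE aEE _ C M E aE])
  then have "char_poly A = char_poly M"
    by (intro char_poly_similar) (auto simp: similar_mat_def)
  also have "\<dots> = (\<Prod>a\<leftarrow>diag_mat M. [:- a, 1:])"
    by (rule char_poly_upper_triangular[OF M]) (auto simp: upper_triangular_def M_def)
  also have "diag_mat M = map (\<lambda>x. complex_of_real (p x)) [0..<d]"
    by (auto simp: diag_mat_def M_def)
  finally have "char_poly A = (\<Prod>q\<leftarrow>map (\<lambda>x. [:- complex_of_real (p x), 1:]) [0..<d]. q)"
    by (simp add: comp_def)
  then have "eigs A = (\<Sum>q\<leftarrow>map (\<lambda>x. [:- complex_of_real (p x), 1:]) [0..<d]. proots q)"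
    unfolding eigs_def by (simp only: proots_prod_list[of "map (\<lambda>x. [:- complex_of_real (p x), 1:]) [0..<d]"])
      (subst proots_prod_list; auto)
  also have "\<dots> = (\<Sum>x\<leftarrow>[0..<d]. {#complex_of_real (p x)#})"
    by (simp add: comp_def)
  also have "\<dots> = image_mset (\<lambda>x. complex_of_real (p x)) (mset [0..<d])"
  proof -
    have "(\<Sum>x\<leftarrow>xs. {#complex_of_real (p x)#}) = image_mset (\<lambda>x. complex_of_real (p x)) (mset xs)" for xs
      by (induction xs) auto
    then show ?thesis .
  qed
  finally show ?thesis .
qed

section \<open>Channel outputs in their eigenbases\<close>

lemma eigbasis_entropy:
  assumes "A \<in> carrier_mat d d" "eigbasis d A e p"
  shows "vn_entropy A = shan d p"
proof -
  have "vn_entropy A = - (\<Sum>x<d. eta (p x))"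
    unfolding vn_entropy_def eigbasis_eigs[OF assms]
    by (simp add: multiset.map_comp comp_def sum_unfold_sum_mset atLeast0LessThan)
  also have "\<dots> = shan d p"
    unfolding shan_def sum_negf[symmetric]
  proof (rule sum.cong[OF refl])
    fix x assume "x \<in> {..<d}"
    then have "0 \<le> p x" using assms(2) by (simp add: eigbasis_def)
    then show "- eta (p x) = p x * - log 2 (p x)" by (auto simp: eta_def)
  qed
  finally show ?thesis .
qed

lemma eigbasis_trace:
  assumes C: "A \<in> carrier_mat d d" and eb: "eigbasis d A e p"
  shows "mtrace A = of_real (\<Sum>x<d. p x)"
proof -
  have "mtrace A = (\<Sum>i<d. \<Sum>x<d. of_real (p x) * (cnj (e x i) * e x i))"
    unfolding mtrace_def using C eb by (intro sum.cong) (auto simp: eigbasis_def mult_ac)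
  also have "\<dots> = (\<Sum>x<d. of_real (p x) * (\<Sum>i<d. cnj (e x i) * e x i))"
    by (subst sum.swap) (simp add: sum_distrib_left)
  also have "\<dots> = (\<Sum>x<d. of_real (p x))"
    using eb by (intro sum.cong) (auto simp: eigbasis_def)
  finally show ?thesis by simp
qed

text \<open>Certifies positivity from an expansion into rank one operators with nonnegative weights,
  the form in which reduced states and tensor products appear.\<close>

lemma psd_gramI:
  assumes C: "A \<in> carrier_mat d d" and w: "\<And>s. s \<in> S \<Longrightarrow> 0 \<le> w s"
    and A: "\<And>i j. i < d \<Longrightarrow> j < d \<Longrightarrow> A $$ (i, j) = (\<Sum>s\<in>S. of_real (w s) * g s i * cnj (g s j))"
  shows "psd d A"
proof -
  have "qform A v = of_real (\<Sum>s\<in>S. w s * (cmod (\<Sum>j<d. cnj (g s j) * v $ j))\<^sup>2)" if v: "v \<in> carrier_vec d" for v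
  proof -
    have "qform A v = (\<Sum>i<d. \<Sum>j<d. \<Sum>s\<in>S. of_real (w s) * ((cnj (g s j) * v $ j) * cnj (cnj (g s i) * v $ i)))"
      unfolding qform_sum[OF C v] using A
      by (intro sum.cong refl) (simp add: sum_distrib_left sum_distrib_right mult_ac)
    also have "\<dots> = (\<Sum>i<d. \<Sum>s\<in>S. \<Sum>j<d. of_real (w s) * ((cnj (g s j) * v $ j) * cnj (cnj (g s i) * v $ i)))"
      by (intro sum.cong[OF refl] sum.swap)
    also have "\<dots> = (\<Sum>s\<in>S. \<Sum>i<d. \<Sum>j<d. of_real (w s) * ((cnj (g s j) * v $ j) * cnj (cnj (g s i) * v $ i)))"
      by (rule sum.swap)
    also have "\<dots> = (\<Sum>s\<in>S. \<Sum>j<d. \<Sum>i<d. of_real (w s) * ((cnj (g s j) * v $ j) * cnj (cnj (g s i) * v $ i)))"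
      by (intro sum.cong[OF refl] sum.swap)
    also have "\<dots> = (\<Sum>s\<in>S. of_real (w s) * of_real ((cmod (\<Sum>j<d. cnj (g s j) * v $ j))\<^sup>2))"
      unfolding of_real_cmod_sum_sq by (simp only: sum_distrib_left)
    finally show ?thesis by simp
  qed
  then show ?thesis unfolding psd_def using C w by (auto intro!: sum_nonneg)
qed

lemma parseval:
  fixes e :: "nat \<Rightarrow> nat \<Rightarrow> complex"
  assumes "\<And>i j. i < d \<Longrightarrow> j < d \<Longrightarrow> (\<Sum>x<d. e x i * cnj (e x j)) = (if i = j then 1 else 0)"
  shows "(\<Sum>x<d. (\<Sum>k<d. cnj (e x k) * f k) * cnj (\<Sum>k<d. cnj (e x k) * g k)) = (\<Sum>k<d. f k * cnj (g k))"
proof -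
  have "(\<Sum>x<d. (\<Sum>k<d. cnj (e x k) * f k) * cnj (\<Sum>k<d. cnj (e x k) * g k)) =
     (\<Sum>x<d. \<Sum>k<d. \<Sum>l<d. (f k * cnj (g l)) * (e x l * cnj (e x k)))"
    unfolding cnj_sum sum_product by (intro sum.cong refl) (simp add: mult_ac)
  also have "\<dots> = (\<Sum>k<d. \<Sum>l<d. \<Sum>x<d. (f k * cnj (g l)) * (e x l * cnj (e x k)))"
    by (subst sum.swap, rule sum.cong[OF refl], rule sum.swap)
  also have "\<dots> = (\<Sum>k<d. \<Sum>l<d. if l = k then f k * cnj (g k) else 0)"
    using assms by (intro sum.cong refl) (auto simp: sum_distrib_left[symmetric])
  also have "\<dots> = (\<Sum>k<d. f k * cnj (g k))" by simp
  finally show ?thesis .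
qed

text \<open>The matrix element of \<open>U\<close> between \<open>eA x\<close> and the product
  vector of \<open>eB b\<close> and \<open>eC c\<close>.\<close>

definition ampl :: "nat \<Rightarrow> nat \<Rightarrow> nat \<Rightarrow> complex mat \<Rightarrow> (nat \<Rightarrow> nat \<Rightarrow> complex) \<Rightarrow> (nat \<Rightarrow> nat \<Rightarrow> complex) \<Rightarrow> (nat \<Rightarrow> nat \<Rightarrow> complex) \<Rightarrow> nat \<Rightarrow> nat \<Rightarrow> nat \<Rightarrow> complex" where
  "ampl dA dB dC U eA eB eC x b c =
     (\<Sum>i<dB. \<Sum>k<dC. \<Sum>j<dA. cnj (eB b i) * cnj (eC c k) * U $$ (i * dC + k, j) * eA x j)"

lemma pair_index_less: "i < dB \<Longrightarrow> k < dC \<Longrightarrow> i * dC + k < dB * (dC::nat)"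
proof -
  assume "i < dB" "k < dC"
  then have "i * dC + k < Suc i * dC" by simp
  also have "\<dots> \<le> dB * dC" using \<open>i < dB\<close> by (intro mult_right_mono) auto
  finally show ?thesis .
qed

text \<open>A partial trace may be taken in any orthonormal basis, so summing over \<open>c\<close>
  gives the channel output, which is diagonal in its eigenbasis \<open>eB\<close>; likewise for
  \<open>b\<close> and \<open>eC\<close>. Hence the output eigenbases fulfil the marginal conditions
  of \<open>tripartite\<close>.\<close>

lemma channel_tripartite:
  assumes iso: "isometry dA dB dC U" and rho: "density dA \<rho>"
  shows "\<exists>eA p eB q eC r. eigbasis dA \<rho> eA p \<and> eigbasis dB (chan dB dC U \<rho>) eB q \<and>
    eigbasis dC (cchan dB dC U \<rho>) eC r \<and>
    tripartite {..<dA} {..<dB} {..<dC} p q r (ampl dA dB dC U eA eB eC) \<and>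
    vn_entropy \<rho> = shan dA p \<and> vn_entropy (chan dB dC U \<rho>) = shan dB q \<and> vn_entropy (cchan dB dC U \<rho>) = shan dC r"
proof -
  have UC: "U \<in> carrier_mat (dB * dC) dA" and UU: "adj U * U = 1\<^sub>m dA" using iso by (auto simp: isometry_def)
  have rC: "\<rho> \<in> carrier_mat dA dA" and rp: "psd dA \<rho>" and tr: "mtrace \<rho> = 1"
    using rho by (auto simp: density_def psd_def)
  obtain eA p where ea: "eigbasis dA \<rho> eA p" using psd_eigbasis[OF rp] by blast
  note aU = adj_carrier[OF UC]
  \<comment> \<open>\<open>\<phi> x\<close> is \<open>U\<close> applied to an eigenvector, in the
    original product basis; \<open>\<psi>\<close> only splits its index.\<close>
  define \<phi> where "\<phi> x m = (\<Sum>j<dA. U $$ (m, j) * eA x j)" for x m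
  define \<psi> where "\<psi> x i k = \<phi> x (i * dC + k)" for x i k
  let ?Y = "U * \<rho> * adj U"
  have Y: "?Y $$ (m, m') = (\<Sum>x<dA. of_real (p x) * \<phi> x m * cnj (\<phi> x m'))" if m: "m < dB * dC" "m' < dB * dC" for m m'
  proof -
    have Ur: "(U * \<rho>) $$ (m, l) = (\<Sum>x<dA. of_real (p x) * \<phi> x m * cnj (eA x l))" if l: "l < dA" for l
    proof -
      have "(U * \<rho>) $$ (m, l) = (\<Sum>j<dA. \<Sum>x<dA. U $$ (m, j) * (of_real (p x) * eA x j * cnj (eA x l)))"
        unfolding mult_mat_index[OF UC rC m(1) l] using ea l
        by (intro sum.cong refl) (simp add: eigbasis_def sum_distrib_left)
      also have "\<dots> = (\<Sum>x<dA. \<Sum>j<dA. U $$ (m, j) * (of_real (p x) * eA x j * cnj (eA x l)))" by (rule sum.swap)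
      also have "\<dots> = (\<Sum>x<dA. of_real (p x) * \<phi> x m * cnj (eA x l))"
        unfolding \<phi>_def sum_distrib_left sum_distrib_right by (intro sum.cong refl) (simp add: mult_ac)
      finally show ?thesis .
    qed
    have "?Y $$ (m, m') = (\<Sum>l<dA. (U * \<rho>) $$ (m, l) * adj U $$ (l, m'))"
      by (rule mult_mat_index[OF _ aU m]) (use UC rC in simp)
    also have "\<dots> = (\<Sum>l<dA. \<Sum>x<dA. of_real (p x) * \<phi> x m * cnj (eA x l) * cnj (U $$ (m', l)))"
      using m by (intro sum.cong refl) (simp add: Ur adj_index[OF UC] sum_distrib_right)
    also have "\<dots> = (\<Sum>x<dA. \<Sum>l<dA. of_real (p x) * \<phi> x m * cnj (eA x l) * cnj (U $$ (m', l)))" by (rule sum.swap)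
    also have "\<dots> = (\<Sum>x<dA. of_real (p x) * \<phi> x m * cnj (\<phi> x m'))"
      unfolding \<phi>_def[of _ m'] cnj_sum sum_distrib_left by (intro sum.cong refl) (simp add: mult_ac)
    finally show ?thesis .
  qed
  have rB: "chan dB dC U \<rho> $$ (i, i') = (\<Sum>k<dC. \<Sum>x<dA. of_real (p x) * \<psi> x i k * cnj (\<psi> x i' k))" if "i < dB" "i' < dB" for i i'
    unfolding chan_def ptrace_C_def using that by (simp add: Y pair_index_less \<psi>_def)
  have rCC: "cchan dB dC U \<rho> $$ (k, k') = (\<Sum>i<dB. \<Sum>x<dA. of_real (p x) * \<psi> x i k * cnj (\<psi> x i k'))" if "k < dC" "k' < dC" for k k'
    unfolding cchan_def ptrace_B_def using that by (simp add: Y pair_index_less \<psi>_def)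
  have CB: "chan dB dC U \<rho> \<in> carrier_mat dB dB" and CC: "cchan dB dC U \<rho> \<in> carrier_mat dC dC"
    by (simp_all add: chan_def cchan_def ptrace_C_def ptrace_B_def)
  have p0: "0 \<le> p x" if "x < dA" for x using ea that by (simp add: eigbasis_def)
  have "psd dB (chan dB dC U \<rho>)"
    by (rule psd_gramI[OF CB, where S = "{..<dC} \<times> {..<dA}" and w = "\<lambda>s. p (snd s)" and g = "\<lambda>s i. \<psi> (snd s) i (fst s)"])
      (auto simp: p0 rB sum.cartesian_product')
  then obtain eB q where eb: "eigbasis dB (chan dB dC U \<rho>) eB q" using psd_eigbasis by blast
  have "psd dC (cchan dB dC U \<rho>)"
    by (rule psd_gramI[OF CC, where S = "{..<dB} \<times> {..<dA}" and w = "\<lambda>s. p (snd s)" and g = "\<lambda>s k. \<psi> (snd s) (fst s) k"])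
      (auto simp: p0 rCC sum.cartesian_product')
  then obtain eC r where ec: "eigbasis dC (cchan dB dC U \<rho>) eC r" using psd_eigbasis by blast
  let ?u = "ampl dA dB dC U eA eB eC"
  have uC: "?u x b c = (\<Sum>k<dC. cnj (eC c k) * (\<Sum>i<dB. cnj (eB b i) * \<psi> x i k))" for x b c
  proof -
    have "?u x b c = (\<Sum>i<dB. \<Sum>k<dC. cnj (eC c k) * (cnj (eB b i) * \<psi> x i k))"
      unfolding ampl_def \<psi>_def \<phi>_def by (simp add: sum_distrib_left mult_ac)
    also have "\<dots> = (\<Sum>k<dC. \<Sum>i<dB. cnj (eC c k) * (cnj (eB b i) * \<psi> x i k))" by (rule sum.swap)
    finally show ?thesis by (simp add: sum_distrib_left)
  qed
  have uB: "?u x b c = (\<Sum>i<dB. cnj (eB b i) * (\<Sum>k<dC. cnj (eC c k) * \<psi> x i k))" for x b c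
    unfolding ampl_def \<psi>_def \<phi>_def by (simp add: sum_distrib_left mult_ac)
  have compB: "\<And>i j. i < dB \<Longrightarrow> j < dB \<Longrightarrow> (\<Sum>x<dB. eB x i * cnj (eB x j)) = (if i = j then 1 else 0)"
    using eb by (simp add: eigbasis_def)
  have compC: "\<And>i j. i < dC \<Longrightarrow> j < dC \<Longrightarrow> (\<Sum>x<dC. eC x i * cnj (eC x j)) = (if i = j then 1 else 0)"
    using ec by (simp add: eigbasis_def)
  have diagB: "\<forall>x<dB. \<forall>x'<dB. (\<Sum>i<dB. \<Sum>j<dB. cnj (eB x i) * chan dB dC U \<rho> $$ (i, j) * eB x' j) = (if x = x' then of_real (q x) else 0)"
    using eb unfolding eigbasis_def by (elim conjE)
  have diagC: "\<forall>x<dC. \<forall>x'<dC. (\<Sum>i<dC. \<Sum>j<dC. cnj (eC x i) * cchan dB dC U \<rho> $$ (i, j) * eC x' j) = (if x = x' then of_real (r x) else 0)"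
    using ec unfolding eigbasis_def by (elim conjE)
  \<comment> \<open>Parseval in \<open>eC\<close> undoes the change of basis on Charlie's side and
    leaves Bob's in place.\<close>
  have sC: "(\<Sum>c<dC. ?u x b c * cnj (?u x' b' c)) = (\<Sum>k<dC. (\<Sum>i<dB. cnj (eB b i) * \<psi> x i k) * cnj (\<Sum>i<dB. cnj (eB b' i) * \<psi> x' i k))" for x x' b b'
    unfolding uC by (rule parseval[OF compC])
  have sB: "(\<Sum>b<dB. ?u x b c * cnj (?u x' b c')) = (\<Sum>i<dB. (\<Sum>k<dC. cnj (eC c k) * \<psi> x i k) * cnj (\<Sum>k<dC. cnj (eC c' k) * \<psi> x' i k))" for x x' c c'
    unfolding uB by (rule parseval[OF compB])
  have Uiso: "(\<Sum>m<dB * dC. U $$ (m, j) * cnj (U $$ (m, j'))) = (if j = j' then 1 else 0)" if j: "j < dA" "j' < dA" for j j'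
  proof -
    have "(adj U * U) $$ (j', j) = (\<Sum>m<dB * dC. cnj (U $$ (m, j')) * U $$ (m, j))"
      unfolding mult_mat_index[OF aU UC j(2,1)] using j by (intro sum.cong refl) (simp add: adj_index[OF UC])
    then show ?thesis unfolding UU using j by (auto simp: mult.commute)
  qed
  have psiiso: "(\<Sum>i<dB. \<Sum>k<dC. \<psi> x i k * cnj (\<psi> x' i k)) = (if x = x' then 1 else 0)" if x: "x < dA" "x' < dA" for x x'
  proof -
    have "(\<Sum>i<dB. \<Sum>k<dC. \<psi> x i k * cnj (\<psi> x' i k)) = (\<Sum>m<dB * dC. \<phi> x m * cnj (\<phi> x' m))"
      unfolding \<psi>_def sum_lessThan_mult ..
    also have "\<dots> = (\<Sum>m<dB * dC. \<Sum>j<dA. \<Sum>j'<dA. (eA x j * cnj (eA x' j')) * (U $$ (m, j) * cnj (U $$ (m, j'))))"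
      unfolding \<phi>_def cnj_sum sum_product by (intro sum.cong refl) (simp add: mult_ac)
    also have "\<dots> = (\<Sum>j<dA. \<Sum>j'<dA. \<Sum>m<dB * dC. (eA x j * cnj (eA x' j')) * (U $$ (m, j) * cnj (U $$ (m, j'))))"
      by (subst sum.swap, rule sum.cong[OF refl], rule sum.swap)
    also have "\<dots> = (\<Sum>j<dA. \<Sum>j'<dA. if j' = j then eA x j * cnj (eA x' j) else 0)"
      by (intro sum.cong refl) (auto simp: sum_distrib_left[symmetric] Uiso)
    also have "\<dots> = (\<Sum>j<dA. cnj (eA x' j) * eA x j)" by (simp add: mult.commute)
    also have "\<dots> = (if x = x' then 1 else 0)" using ea x by (auto simp: eigbasis_def)
    finally show ?thesis .
  qed
  have sump: "(\<Sum>x<dA. p x) = 1"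
  proof -
    have "complex_of_real (\<Sum>x<dA. p x) = of_real 1" using eigbasis_trace[OF rC ea] tr by simp
    then show ?thesis using of_real_eq_iff by blast
  qed
  have "tripartite {..<dA} {..<dB} {..<dC} p q r ?u"
  proof
    fix x x' assume x: "x \<in> {..<dA}" "x' \<in> {..<dA}"
    have "(\<Sum>b<dB. \<Sum>c<dC. ?u x b c * cnj (?u x' b c)) = (\<Sum>k<dC. \<Sum>b<dB. (\<Sum>i<dB. cnj (eB b i) * \<psi> x i k) * cnj (\<Sum>i<dB. cnj (eB b i) * \<psi> x' i k))"
      unfolding sC by (rule sum.swap)
    also have "\<dots> = (\<Sum>k<dC. \<Sum>i<dB. \<psi> x i k * cnj (\<psi> x' i k))"
      by (intro sum.cong[OF refl] parseval[OF compB])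
    also have "\<dots> = (\<Sum>i<dB. \<Sum>k<dC. \<psi> x i k * cnj (\<psi> x' i k))" by (rule sum.swap)
    also have "\<dots> = (if x = x' then 1 else 0)" using psiiso x by simp
    finally show "(\<Sum>b<dB. \<Sum>c<dC. ?u x b c * cnj (?u x' b c)) = (if x = x' then 1 else 0)" .
  next
    fix b b' assume b: "b \<in> {..<dB}" "b' \<in> {..<dB}"
    have "(\<Sum>c<dC. \<Sum>x<dA. of_real (p x) * ?u x b c * cnj (?u x b' c)) = (\<Sum>x<dA. of_real (p x) * (\<Sum>c<dC. ?u x b c * cnj (?u x b' c)))"
      by (subst sum.swap) (simp add: sum_distrib_left mult.assoc)
    also have "\<dots> = (\<Sum>x<dA. \<Sum>k<dC. \<Sum>i<dB. \<Sum>i'<dB. of_real (p x) * ((cnj (eB b i) * \<psi> x i k) * (eB b' i' * cnj (\<psi> x i' k))))"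
      unfolding sC cnj_sum unfolding sum_product unfolding sum_distrib_left by simp
    also have "\<dots> = (\<Sum>x<dA. \<Sum>i<dB. \<Sum>k<dC. \<Sum>i'<dB. of_real (p x) * ((cnj (eB b i) * \<psi> x i k) * (eB b' i' * cnj (\<psi> x i' k))))"
      by (intro sum.cong[OF refl] sum.swap)
    also have "\<dots> = (\<Sum>i<dB. \<Sum>x<dA. \<Sum>k<dC. \<Sum>i'<dB. of_real (p x) * ((cnj (eB b i) * \<psi> x i k) * (eB b' i' * cnj (\<psi> x i' k))))"
      by (rule sum.swap)
    also have "\<dots> = (\<Sum>i<dB. \<Sum>x<dA. \<Sum>i'<dB. \<Sum>k<dC. of_real (p x) * ((cnj (eB b i) * \<psi> x i k) * (eB b' i' * cnj (\<psi> x i' k))))"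
      by (intro sum.cong[OF refl] sum.swap)
    also have "\<dots> = (\<Sum>i<dB. \<Sum>i'<dB. \<Sum>x<dA. \<Sum>k<dC. of_real (p x) * ((cnj (eB b i) * \<psi> x i k) * (eB b' i' * cnj (\<psi> x i' k))))"
      by (intro sum.cong[OF refl] sum.swap)
    also have "\<dots> = (\<Sum>i<dB. \<Sum>i'<dB. \<Sum>k<dC. \<Sum>x<dA. of_real (p x) * ((cnj (eB b i) * \<psi> x i k) * (eB b' i' * cnj (\<psi> x i' k))))"
      by (intro sum.cong[OF refl] sum.swap)
    also have "\<dots> = (\<Sum>i<dB. \<Sum>i'<dB. cnj (eB b i) * chan dB dC U \<rho> $$ (i, i') * eB b' i')"
      by (intro sum.cong refl) (simp add: rB sum_distrib_left sum_distrib_right mult_ac)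
    also have "\<dots> = (if b = b' then of_real (q b) else 0)" using diagB b by simp
    finally show "(\<Sum>c<dC. \<Sum>x<dA. of_real (p x) * ?u x b c * cnj (?u x b' c)) = (if b = b' then of_real (q b) else 0)" .
  next
    fix c c' assume c: "c \<in> {..<dC}" "c' \<in> {..<dC}"
    have "(\<Sum>b<dB. \<Sum>x<dA. of_real (p x) * ?u x b c * cnj (?u x b c')) = (\<Sum>x<dA. of_real (p x) * (\<Sum>b<dB. ?u x b c * cnj (?u x b c')))"
      by (subst sum.swap) (simp add: sum_distrib_left mult.assoc)
    also have "\<dots> = (\<Sum>x<dA. \<Sum>i<dB. \<Sum>k<dC. \<Sum>k'<dC. of_real (p x) * ((cnj (eC c k) * \<psi> x i k) * (eC c' k' * cnj (\<psi> x i k'))))"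
      unfolding sB cnj_sum unfolding sum_product unfolding sum_distrib_left by simp
    also have "\<dots> = (\<Sum>x<dA. \<Sum>k<dC. \<Sum>i<dB. \<Sum>k'<dC. of_real (p x) * ((cnj (eC c k) * \<psi> x i k) * (eC c' k' * cnj (\<psi> x i k'))))"
      by (intro sum.cong[OF refl] sum.swap)
    also have "\<dots> = (\<Sum>k<dC. \<Sum>x<dA. \<Sum>i<dB. \<Sum>k'<dC. of_real (p x) * ((cnj (eC c k) * \<psi> x i k) * (eC c' k' * cnj (\<psi> x i k'))))"
      by (rule sum.swap)
    also have "\<dots> = (\<Sum>k<dC. \<Sum>x<dA. \<Sum>k'<dC. \<Sum>i<dB. of_real (p x) * ((cnj (eC c k) * \<psi> x i k) * (eC c' k' * cnj (\<psi> x i k'))))"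
      by (intro sum.cong[OF refl] sum.swap)
    also have "\<dots> = (\<Sum>k<dC. \<Sum>k'<dC. \<Sum>x<dA. \<Sum>i<dB. of_real (p x) * ((cnj (eC c k) * \<psi> x i k) * (eC c' k' * cnj (\<psi> x i k'))))"
      by (intro sum.cong[OF refl] sum.swap)
    also have "\<dots> = (\<Sum>k<dC. \<Sum>k'<dC. \<Sum>i<dB. \<Sum>x<dA. of_real (p x) * ((cnj (eC c k) * \<psi> x i k) * (eC c' k' * cnj (\<psi> x i k'))))"
      by (intro sum.cong[OF refl] sum.swap)
    also have "\<dots> = (\<Sum>k<dC. \<Sum>k'<dC. cnj (eC c k) * cchan dB dC U \<rho> $$ (k, k') * eC c' k')"
      by (intro sum.cong refl) (simp add: rCC sum_distrib_left sum_distrib_right mult_ac)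
    also have "\<dots> = (if c = c' then of_real (r c) else 0)" using diagC c by simp
    finally show "(\<Sum>b<dB. \<Sum>x<dA. of_real (p x) * ?u x b c * cnj (?u x b c')) = (if c = c' then of_real (r c) else 0)" .
  qed (use p0 sump in auto)
  then show ?thesis
    using ea eb ec eigbasis_entropy[OF rC ea] eigbasis_entropy[OF CB eb] eigbasis_entropy[OF CC ec] by blast
qed

section \<open>Measurements as matrices\<close>

lemma psd_qformD:
  assumes "psd d A" "v \<in> carrier_vec d"
  shows "0 \<le> Re (qform A v)" "Im (qform A v) = 0"
  using assms by (auto simp: psd_def)

lemma psd_sum_mat:
  assumes "\<And>j. j \<in> J \<Longrightarrow> psd d (A j)"
  shows "psd d (mat d d (\<lambda>(r, c). \<Sum>j\<in>J. A j $$ (r, c)))"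
    and "v \<in> carrier_vec d \<Longrightarrow> qform (mat d d (\<lambda>(r, c). \<Sum>j\<in>J. A j $$ (r, c))) v = (\<Sum>j\<in>J. qform (A j) v)"
proof -
  have q: "qform (mat d d (\<lambda>(r, c). \<Sum>j\<in>J. A j $$ (r, c))) v = (\<Sum>j\<in>J. qform (A j) v)" if v: "v \<in> carrier_vec d" for v
  proof -
    have "qform (mat d d (\<lambda>(r, c). \<Sum>j\<in>J. A j $$ (r, c))) v = (\<Sum>r<d. \<Sum>c<d. \<Sum>j\<in>J. cnj (v $ r) * A j $$ (r, c) * v $ c)"
      by (subst qform_sum[OF _ v]) (auto simp: sum_distrib_left sum_distrib_right intro!: sum.cong)
    also have "\<dots> = (\<Sum>r<d. \<Sum>j\<in>J. \<Sum>c<d. cnj (v $ r) * A j $$ (r, c) * v $ c)"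
      by (intro sum.cong[OF refl] sum.swap)
    also have "\<dots> = (\<Sum>j\<in>J. \<Sum>r<d. \<Sum>c<d. cnj (v $ r) * A j $$ (r, c) * v $ c)"
      by (rule sum.swap)
    also have "\<dots> = (\<Sum>j\<in>J. qform (A j) v)"
      using assms by (intro sum.cong refl) (simp add: qform_sum[OF _ v] psd_def)
    finally show ?thesis .
  qed
  then show "v \<in> carrier_vec d \<Longrightarrow> qform (mat d d (\<lambda>(r, c). \<Sum>j\<in>J. A j $$ (r, c))) v = (\<Sum>j\<in>J. qform (A j) v)" .
  show "psd d (mat d d (\<lambda>(r, c). \<Sum>j\<in>J. A j $$ (r, c)))"
    unfolding psd_def using q assms by (auto intro!: sum_nonneg sum.neutral simp: psd_def)
qed

text \<open>Tensor products of eigenvectors, with multiplied eigenvalues, give an expansion that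
  \<open>psd_gramI\<close> accepts.\<close>

lemma psd_kron:
  assumes A: "psd d1 A" and B: "psd d2 B"
  shows "psd (d1 * d2) (kron A B)"
proof -
  have C: "A \<in> carrier_mat d1 d1" "B \<in> carrier_mat d2 d2" using A B by (auto simp: psd_def)
  obtain e p where e: "eigbasis d1 A e p" using psd_eigbasis[OF A] by blast
  obtain f q where f: "eigbasis d2 B f q" using psd_eigbasis[OF B] by blast
  have eA: "\<forall>i<d1. \<forall>j<d1. A $$ (i, j) = (\<Sum>x<d1. of_real (p x) * e x i * cnj (e x j))"
    using e unfolding eigbasis_def by (elim conjE)
  have fB: "\<forall>i<d2. \<forall>j<d2. B $$ (i, j) = (\<Sum>x<d2. of_real (q x) * f x i * cnj (f x j))"
    using f unfolding eigbasis_def by (elim conjE)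
  have p: "\<forall>x<d1. 0 \<le> p x" using e unfolding eigbasis_def by (elim conjE)
  have q: "\<forall>x<d2. 0 \<le> q x" using f unfolding eigbasis_def by (elim conjE)
  show ?thesis
  proof (rule psd_gramI[where S = "{..<d1} \<times> {..<d2}" and w = "\<lambda>s. p (fst s) * q (snd s)"
        and g = "\<lambda>s i. e (fst s) (i div d2) * f (snd s) (i mod d2)"])
    show "kron A B \<in> carrier_mat (d1 * d2) (d1 * d2)" using C by (auto simp: kron_def)
    show "0 \<le> p (fst s) * q (snd s)" if "s \<in> {..<d1} \<times> {..<d2}" for s using that p q by auto
    fix i j assume ij: "i < d1 * d2" "j < d1 * d2"
    then have d2: "0 < d2" by (cases d2) auto
    have "kron A B $$ (i, j) = A $$ (i div d2, j div d2) * B $$ (i mod d2, j mod d2)"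
      using C ij by (auto simp: kron_def)
    also have "\<dots> = (\<Sum>x<d1. of_real (p x) * e x (i div d2) * cnj (e x (j div d2))) * (\<Sum>y<d2. of_real (q y) * f y (i mod d2) * cnj (f y (j mod d2)))"
      using eA fB ij d2 by (simp add: less_mult_imp_div_less)
    also have "\<dots> = (\<Sum>s\<in>{..<d1} \<times> {..<d2}. of_real (p (fst s) * q (snd s)) * (e (fst s) (i div d2) * f (snd s) (i mod d2)) * cnj (e (fst s) (j div d2) * f (snd s) (j mod d2)))"
      unfolding sum2_prod[symmetric] by (intro sum.cong refl) (simp add: mult_ac)
    finally show "kron A B $$ (i, j) = (\<Sum>s\<in>{..<d1} \<times> {..<d2}. of_real (p (fst s) * q (snd s)) * (e (fst s) (i div d2) * f (snd s) (i mod d2)) * cnj (e (fst s) (j div d2) * f (snd s) (j mod d2)))" .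
  qed
qed

definition omat :: "nat \<Rightarrow> (nat \<Rightarrow> complex) \<Rightarrow> complex mat" where
  "omat d f = mat d d (\<lambda>(r, c). f r * cnj (f c))"

text \<open>The remainder that completes a rank one sub-measurement to a POVM.\<close>
definition rmat :: "nat \<Rightarrow> nat \<Rightarrow> (nat \<Rightarrow> nat \<Rightarrow> complex) \<Rightarrow> complex mat" where
  "rmat d m f = mat d d (\<lambda>(r, c). (if r = c then 1 else 0) - (\<Sum>y<m. f y r * cnj (f y c)))"

lemma omat_carrier [simp]: "omat d f \<in> carrier_mat d d" and rmat_carrier [simp]: "rmat d m g \<in> carrier_mat d d"
  by (simp_all add: omat_def rmat_def)

lemma qform_omat:
  assumes v: "v \<in> carrier_vec d"
  shows "qform (omat d f) v = of_real ((cmod (ip {..<d} f (($) v)))\<^sup>2)"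
proof -
  have "qform (omat d f) v = (\<Sum>r<d. \<Sum>c<d. (cnj (v $ r) * f r) * (cnj (f c) * v $ c))"
    by (subst qform_sum[OF _ v]) (auto simp: omat_def mult_ac intro!: sum.cong)
  also have "\<dots> = cnj (ip {..<d} f (($) v)) * ip {..<d} f (($) v)"
    unfolding ip_cnj by (simp add: ip_def sum_product)
  finally show ?thesis by (simp add: complex_norm_square mult.commute del: of_real_power)
qed

lemma psd_omat: "psd d (omat d f)"
  unfolding psd_def using qform_omat by auto

text \<open>The quadratic form of the remainder is the gap in the Bessel-type hypothesis.\<close>

lemma psd_rmat:
  assumes "\<And>v. (\<Sum>y<m. (cmod (ip {..<d} (f y) v))\<^sup>2) \<le> nsq {..<d} v"
  shows "psd d (rmat d m f)"
proof -
  have "qform (rmat d m f) v = of_real (nsq {..<d} (($) v) - (\<Sum>y<m. (cmod (ip {..<d} (f y) (($) v)))\<^sup>2))" if v: "v \<in> carrier_vec d" for v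
  proof -
    have "qform (rmat d m f) v = (\<Sum>r<d. \<Sum>c<d. (if c = r then cnj (v $ r) * v $ r else 0) - cnj (v $ r) * (\<Sum>y<m. omat d (f y) $$ (r, c)) * v $ c)"
      by (subst qform_sum[OF _ v]) (auto simp: rmat_def omat_def algebra_simps intro!: sum.cong)
    also have "\<dots> = (\<Sum>r<d. cnj (v $ r) * v $ r) - (\<Sum>r<d. \<Sum>c<d. cnj (v $ r) * (\<Sum>y<m. omat d (f y) $$ (r, c)) * v $ c)"
      by (simp add: sum_subtractf)
    also have "(\<Sum>r<d. cnj (v $ r) * v $ r) = of_real (nsq {..<d} (($) v))"
      unfolding ip_nsq[symmetric] ip_def ..
    also have "(\<Sum>r<d. \<Sum>c<d. cnj (v $ r) * (\<Sum>y<m. omat d (f y) $$ (r, c)) * v $ c) = qform (mat d d (\<lambda>(r, c). \<Sum>y<m. omat d (f y) $$ (r, c))) v"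
      by (subst qform_sum[OF _ v]) (auto intro!: sum.cong)
    also have "\<dots> = (\<Sum>y<m. of_real ((cmod (ip {..<d} (f y) (($) v)))\<^sup>2))"
      by (subst psd_sum_mat(2)[OF psd_omat v]) (simp add: qform_omat[OF v])
    finally show ?thesis by simp
  qed
  then show ?thesis unfolding psd_def using assms by auto
qed

lemma kron_index:
  assumes "A \<in> carrier_mat d1 d1" "B \<in> carrier_mat d2 d2" "r < d1 * d2" "c < d1 * d2"
  shows "kron A B $$ (r, c) = A $$ (r div d2, c div d2) * B $$ (r mod d2, c mod d2)"
  using assms by (auto simp: kron_def)

text \<open>A tensor product of rank one operators has rank one, and its amplitude can be evaluated
  in sequence: Charlie first, then Bob.\<close>

lemma qform_kron_omat:
  assumes v: "v \<in> carrier_vec (d1 * d2)"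
  shows "qform (kron (omat d1 f) (omat d2 g)) v =
    of_real ((cmod (ip {..<d1} f (\<lambda>a. ip {..<d2} g (\<lambda>b. v $ (a * d2 + b)))))\<^sup>2)"
proof -
  have "kron (omat d1 f) (omat d2 g) = omat (d1 * d2) (\<lambda>r. f (r div d2) * g (r mod d2))"
  proof (rule eq_matI)
    fix r c assume "r < dim_row (omat (d1 * d2) (\<lambda>r. f (r div d2) * g (r mod d2)))" "c < dim_col (omat (d1 * d2) (\<lambda>r. f (r div d2) * g (r mod d2)))"
    then have rc: "r < d1 * d2" "c < d1 * d2" by (auto simp: omat_def)
    then have "0 < d2" by (cases d2) auto
    then show "kron (omat d1 f) (omat d2 g) $$ (r, c) = omat (d1 * d2) (\<lambda>r. f (r div d2) * g (r mod d2)) $$ (r, c)"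
      unfolding kron_index[OF omat_carrier omat_carrier rc]
      using rc by (simp add: omat_def less_mult_imp_div_less mult_ac)
  qed (auto simp: kron_def omat_def)
  moreover have "ip {..<d1 * d2} (\<lambda>r. f (r div d2) * g (r mod d2)) (($) v) = ip {..<d1} f (\<lambda>a. ip {..<d2} g (\<lambda>b. v $ (a * d2 + b)))"
    unfolding ip_def sum_lessThan_mult sum_distrib_left by (intro sum.cong refl) (simp add: mult_ac)
  ultimately show ?thesis using qform_omat[OF v] by simp
qed

text \<open>Completes the sub-measurements to the POVMs that \<open>oneway_locc\<close> asks for.
  Everything added is positive, so success probabilities can only grow; \<open>0 < N\<close>
  provides a message that absorbs Bob's remainder.\<close>

lemma ea_code_vectors:
  fixes F :: "nat \<Rightarrow> nat \<Rightarrow> complex" and e :: "nat \<Rightarrow> nat \<Rightarrow> nat \<Rightarrow> complex" and a :: "nat \<Rightarrow> nat \<Rightarrow> complex"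
  assumes N: "0 < N" and a: "\<And>i. i < N \<Longrightarrow> nsq {..<dA ^ n} (a i) = 1"
    and F: "\<And>v. (\<Sum>y<m. (cmod (ip {..<dC ^ n} (F y) v))\<^sup>2) \<le> nsq {..<dC ^ n} v"
    and e: "\<And>y v. y < m \<Longrightarrow> (\<Sum>i<N. (cmod (ip {..<dB ^ n} (e y i) v))\<^sup>2) \<le> nsq {..<dB ^ n} v"
    and suc: "\<And>i. i < N \<Longrightarrow> 1 - \<epsilon> \<le> (\<Sum>y<m. (cmod (ip {..<dB ^ n} (e y i) (\<lambda>b. ip {..<dC ^ n} (F y)
        (\<lambda>c. \<Sum>j<dA ^ n. Utens dA dB dC U n $$ (b * dC ^ n + c, j) * a i j))))\<^sup>2)"
  shows "ea_code dA dB dC U n \<epsilon> N"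
proof -
  let ?DA = "dA ^ n" and ?DB = "dB ^ n" and ?DC = "dC ^ n"
  \<comment> \<open>Outcome \<open>m\<close> is an extra one that carries Charlie's
    remainder.\<close>
  define P where "P y = (if y < m then omat ?DC (F y) else rmat ?DC m F)" for y
  \<comment> \<open>Bob's remainder goes to message 0, and after Charlie's extra outcome he always
    answers 0.\<close>
  define R where "R y i = (if i = 0 then (if y < m then rmat ?DB N (e y) else 1\<^sub>m ?DB) else 0\<^sub>m ?DB ?DB)" for y and i :: nat
  define O1 where "O1 y i = (if y < m then omat ?DB (e y i) else 0\<^sub>m ?DB ?DB)" for y i
  define Q where "Q y i = mat ?DB ?DB (\<lambda>(r, c). O1 y i $$ (r, c) + R y i $$ (r, c))" for y i
  define M where "M i = mat (?DB * ?DC) (?DB * ?DC) (\<lambda>(r, c). \<Sum>j<Suc m. kron (Q j i) (P j) $$ (r, c))" for i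
  have z: "psd d (0\<^sub>m d d)" for d
    by (rule psd_gramI[where S = "{}" and w = "\<lambda>_. 0" and g = "\<lambda>_ _. 0"]) auto
  have one: "psd d (1\<^sub>m d)" for d
    by (rule psd_gramI[where S = "{..<d}" and w = "\<lambda>_. 1" and g = "\<lambda>s i. if i = s then 1 else 0"]) (auto simp: if_distrib cong: if_cong)
  have pP: "psd ?DC (P y)" for y using psd_omat psd_rmat[OF F] by (simp add: P_def)
  have pR: "psd ?DB (R y i)" for y i using psd_rmat[where m = N and d = "?DB" and f = "e y"] e z one by (simp add: R_def)
  have pO: "psd ?DB (O1 y i)" for y i using psd_omat z by (simp add: O1_def)
  have CO: "O1 y i \<in> carrier_mat ?DB ?DB" and CR: "R y i \<in> carrier_mat ?DB ?DB" and CP: "P y \<in> carrier_mat ?DC ?DC" for y i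
    using pO pR pP by (auto simp: psd_def)
  have pQ: "psd ?DB (Q y i)" for y i
  proof -
    have "Q y i = mat ?DB ?DB (\<lambda>(r, c). \<Sum>b\<in>{True, False}. (if b then O1 y i else R y i) $$ (r, c))"
      unfolding Q_def by simp
    then show ?thesis using psd_sum_mat(1)[of "{True, False}" ?DB "\<lambda>b. if b then O1 y i else R y i"] pO pR by simp
  qed
  have CQ: "Q y i \<in> carrier_mat ?DB ?DB" for y i by (simp add: Q_def)
  have sumQ: "(\<Sum>i<N. Q y i $$ (r, c)) = (if r = c then 1 else 0)" if rc: "r < ?DB" "c < ?DB" for y r c
  proof -
    have "(\<Sum>i<N. R y i $$ (r, c)) = (\<Sum>i<N. if i = 0 then (if y < m then rmat ?DB N (e y) else 1\<^sub>m ?DB) $$ (r, c) else 0)"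
      using rc by (intro sum.cong) (auto simp: R_def)
    also have "\<dots> = (if y < m then rmat ?DB N (e y) else 1\<^sub>m ?DB) $$ (r, c)" using N by simp
    finally show ?thesis using rc
      by (auto simp: Q_def sum.distrib O1_def rmat_def omat_def)
  qed
  have sumP: "(\<Sum>y<Suc m. P y $$ (r, c)) = (if r = c then 1 else 0)" if "r < ?DC" "c < ?DC" for r c
    using that by (simp add: P_def rmat_def omat_def)
  have povP: "povm ?DC P (Suc m)" using pP sumP by (simp add: povm_def)
  have povQ: "povm ?DB (Q y) N" for y using pQ sumQ by (simp add: povm_def)
  have locc: "oneway_locc dB dC n M N"
    unfolding oneway_locc_def using povP povQ by (intro exI[of _ "Suc m"] exI[of _ P] exI[of _ Q]) (simp add: M_def)
  have povM: "povm (?DB * ?DC) M N"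
    unfolding povm_def
  proof (intro conjI allI impI)
    fix i show "psd (?DB * ?DC) (M i)"
      unfolding M_def by (rule psd_sum_mat(1)) (intro psd_kron pQ pP)
  next
    fix r c assume rc: "r < ?DB * ?DC" "c < ?DB * ?DC"
    then have d: "0 < ?DC" by (cases "?DC") auto
    have rd: "r div ?DC < ?DB" "c div ?DC < ?DB" using rc by (simp_all add: less_mult_imp_div_less)
    have "(\<Sum>i<N. M i $$ (r, c)) = (\<Sum>i<N. \<Sum>j<Suc m. Q j i $$ (r div ?DC, c div ?DC) * P j $$ (r mod ?DC, c mod ?DC))"
      using rc by (intro sum.cong refl) (simp add: M_def kron_index[OF CQ CP])
    also have "\<dots> = (\<Sum>j<Suc m. (\<Sum>i<N. Q j i $$ (r div ?DC, c div ?DC)) * P j $$ (r mod ?DC, c mod ?DC))"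
      by (subst sum.swap) (simp add: sum_distrib_right)
    also have "\<dots> = (if r div ?DC = c div ?DC then 1 else 0) * (\<Sum>j<Suc m. P j $$ (r mod ?DC, c mod ?DC))"
      by (simp only: sumQ[OF rd] sum_distrib_left)
    also have "\<dots> = (if r div ?DC = c div ?DC then 1 else 0) * (if r mod ?DC = c mod ?DC then 1 else 0)"
      using d by (simp only: sumP mod_less_divisor)
    also have "\<dots> = (if r = c then 1 else 0)"
      by (auto) (metis div_mult_mod_eq)
    finally show "(\<Sum>i<N. M i $$ (r, c)) = (if r = c then 1 else 0)" .
  qed
  have UC: "Utens dA dB dC U n \<in> carrier_mat (?DB * ?DC) ?DA" by (simp add: Utens_def)
  have succ: "1 - \<epsilon> \<le> Re (qform (M i) (Utens dA dB dC U n *\<^sub>v vec ?DA (a i)))" if i: "i < N" for i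
  proof -
    let ?v = "Utens dA dB dC U n *\<^sub>v vec ?DA (a i)"
    have v: "?v \<in> carrier_vec (?DB * ?DC)" using UC by auto
    have vi: "?v $ z = (\<Sum>j<?DA. Utens dA dB dC U n $$ (z, j) * a i j)" if "z < ?DB * ?DC" for z
      using that UC by (auto simp: scalar_prod_def atLeast0LessThan intro!: sum.cong)
    let ?t = "\<lambda>y. (cmod (ip {..<?DB} (e y i) (\<lambda>b. ip {..<?DC} (F y) (\<lambda>c. ?v $ (b * ?DC + c)))))\<^sup>2"
    have t: "?t y = (cmod (ip {..<?DB} (e y i) (\<lambda>b. ip {..<?DC} (F y)
        (\<lambda>c. \<Sum>j<?DA. Utens dA dB dC U n $$ (b * ?DC + c, j) * a i j))))\<^sup>2" for y
      by (intro arg_cong[where f = "\<lambda>z. (cmod z)\<^sup>2"] ip_cong refl) (simp_all add: vi pair_index_less)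
    have q: "qform (kron (Q y i) (P y)) ?v = qform (kron (O1 y i) (P y)) ?v + qform (kron (R y i) (P y)) ?v" for y
    proof -
      have K: "kron (Q y i) (P y) \<in> carrier_mat (?DB * ?DC) (?DB * ?DC)" "kron (O1 y i) (P y) \<in> carrier_mat (?DB * ?DC) (?DB * ?DC)"
         "kron (R y i) (P y) \<in> carrier_mat (?DB * ?DC) (?DB * ?DC)"
        using psd_kron[OF pQ pP] psd_kron[OF pO pP] psd_kron[OF pR pP] by (auto simp: psd_def)
      have eq: "kron (Q y i) (P y) $$ (r, c) = kron (O1 y i) (P y) $$ (r, c) + kron (R y i) (P y) $$ (r, c)" if "r < ?DB * ?DC" "c < ?DB * ?DC" for r c
        unfolding kron_index[OF CQ CP that] kron_index[OF CO CP that] kron_index[OF CR CP that]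
        using that by (simp add: Q_def less_mult_imp_div_less distrib_right)
      show ?thesis
        unfolding qform_sum[OF K(1) v] qform_sum[OF K(2) v] qform_sum[OF K(3) v] sum.distrib[symmetric]
        by (intro sum.cong refl) (simp add: eq distrib_left distrib_right)
    qed
    have ge: "?t y \<le> Re (qform (kron (Q y i) (P y)) ?v)" if "y < m" for y
    proof -
      have "qform (kron (O1 y i) (P y)) ?v = of_real (?t y)"
        using qform_kron_omat[OF v] that by (simp add: O1_def P_def)
      moreover have "0 \<le> Re (qform (kron (R y i) (P y)) ?v)"
        by (rule psd_qformD(1)[OF psd_kron[OF pR pP] v])
      ultimately show ?thesis unfolding q by simp
    qed
    have "1 - \<epsilon> \<le> (\<Sum>y<m. ?t y)" unfolding t by (rule suc[OF i])
    also have "\<dots> \<le> (\<Sum>y<m. Re (qform (kron (Q y i) (P y)) ?v))" using ge by (intro sum_mono) simp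
    also have "\<dots> \<le> (\<Sum>y<Suc m. Re (qform (kron (Q y i) (P y)) ?v))"
      using psd_qformD(1)[OF psd_kron[OF pQ pP] v] by simp
    also have "\<dots> = Re (qform (M i) ?v)"
      unfolding M_def by (subst psd_sum_mat(2)[OF psd_kron[OF pQ pP] v]) simp
    finally show ?thesis .
  qed
  have unit: "scalar_prod (conjugate (vec ?DA (a i))) (vec ?DA (a i)) = 1" if "i < N" for i
  proof -
    have "scalar_prod (conjugate (vec ?DA (a i))) (vec ?DA (a i)) = ip {..<?DA} (a i) (a i)"
      by (auto simp: scalar_prod_def ip_def atLeast0LessThan intro!: sum.cong)
    then show ?thesis using a[OF that] by (simp add: ip_nsq)
  qed
  show ?thesis
    unfolding ea_code_def
    by (rule exI[of _ "\<lambda>i. vec ?DA (a i)"], rule exI[of _ M]) (use povM locc succ unit in auto)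
qed

section \<open>Product bases\<close>

lemma prod_split_add:
  fixes f g :: "nat \<Rightarrow> 'a::comm_monoid_mult"
  shows "(\<Prod>k<n1 + n2. if k < n1 then f k else g (k - n1)) = (\<Prod>k<n1. f k) * (\<Prod>k<n2. g k)"
  by (induction n2) (simp_all add: mult.assoc)

lemma sum_digits_prod3:
  fixes g :: "nat \<Rightarrow> nat \<Rightarrow> nat \<Rightarrow> nat \<Rightarrow> 'a::comm_semiring_1"
  shows "(\<Sum>x<d ^ n. \<Sum>y<d' ^ n. \<Sum>z<d'' ^ n. \<Prod>k<n. g k (digit d k x) (digit d' k y) (digit d'' k z)) =
    (\<Prod>k<n. \<Sum>a<d. \<Sum>b<d'. \<Sum>c<d''. g k a b c)"
proof -
  have "(\<Sum>x<d ^ n. \<Sum>y<d' ^ n. \<Sum>z<d'' ^ n. \<Prod>k<n. g k (digit d k x) (digit d' k y) (digit d'' k z)) =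
    (\<Sum>x<d ^ n. \<Prod>k<n. \<Sum>b<d'. \<Sum>c<d''. g k (digit d k x) b c)"
    by (intro sum.cong[OF refl] sum_digits_prod2)
  also have "\<dots> = (\<Prod>k<n. \<Sum>a<d. \<Sum>b<d'. \<Sum>c<d''. g k a b c)"
    by (rule sum_digits_prod)
  finally show ?thesis .
qed

text \<open>Product basis of \<open>n1 + n2\<close> copies, one eigenbasis on the first
  \<open>n1\<close> digits and another on the rest. The digitwise form fits \<open>Utens\<close>
  without reordering tensor factors, and the pair \<open>z\<close> keeps the two blocks
  apart.\<close>

definition pbasis :: "nat \<Rightarrow> nat \<Rightarrow> nat \<Rightarrow> (nat \<Rightarrow> nat \<Rightarrow> complex) \<Rightarrow> (nat \<Rightarrow> nat \<Rightarrow> complex) \<Rightarrow> nat \<times> nat \<Rightarrow> nat \<Rightarrow> complex" where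
  "pbasis d n1 n2 e1 e2 z j = (\<Prod>k<n1 + n2. if k < n1 then e1 (digit d k (fst z)) (digit d k j)
     else e2 (digit d (k - n1) (snd z)) (digit d k j))"

lemma pbasis_orthonormal:
  assumes e1: "\<And>x x'. x < d \<Longrightarrow> x' < d \<Longrightarrow> (\<Sum>i<d. cnj (e1 x i) * e1 x' i) = (if x = x' then 1 else 0)"
    and e2: "\<And>x x'. x < d \<Longrightarrow> x' < d \<Longrightarrow> (\<Sum>i<d. cnj (e2 x i) * e2 x' i) = (if x = x' then 1 else 0)"
    and z: "z \<in> {..<d ^ n1} \<times> {..<d ^ n2}" "z' \<in> {..<d ^ n1} \<times> {..<d ^ n2}"
  shows "ip {..<d ^ (n1 + n2)} (pbasis d n1 n2 e1 e2 z) (pbasis d n1 n2 e1 e2 z') = (if z = z' then 1 else 0)"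
proof -
  let ?g = "\<lambda>k a. cnj (if k < n1 then e1 (digit d k (fst z)) a else e2 (digit d (k - n1) (snd z)) a) *
     (if k < n1 then e1 (digit d k (fst z')) a else e2 (digit d (k - n1) (snd z')) a)"
  have "ip {..<d ^ (n1 + n2)} (pbasis d n1 n2 e1 e2 z) (pbasis d n1 n2 e1 e2 z') =
     (\<Sum>j<d ^ (n1 + n2). \<Prod>k<n1 + n2. ?g k (digit d k j))"
    by (simp add: ip_def pbasis_def prod.distrib)
  also have "\<dots> = (\<Prod>k<n1 + n2. \<Sum>a<d. ?g k a)"
    by (rule sum_digits_prod)
  also have "\<dots> = (\<Prod>k<n1 + n2. if k < n1 then (if digit d k (fst z) = digit d k (fst z') then 1 else 0)
      else (if digit d (k - n1) (snd z) = digit d (k - n1) (snd z') then 1 else 0))"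
  proof (rule prod.cong[OF refl])
    fix k assume k: "k \<in> {..<n1 + n2}"
    show "(\<Sum>a<d. ?g k a) = (if k < n1 then (if digit d k (fst z) = digit d k (fst z') then 1 else 0)
      else (if digit d (k - n1) (snd z) = digit d (k - n1) (snd z') then 1 else 0))"
    proof (cases "k < n1")
      case True
      then have "digit d k (fst z) < d" "digit d k (fst z') < d" using z by (auto intro: digit_less)
      then show ?thesis using True e1 by simp
    next
      case False
      then have "k - n1 < n2" using k by auto
      then have "digit d (k - n1) (snd z) < d" "digit d (k - n1) (snd z') < d" using z by (auto intro: digit_less)
      then show ?thesis using False e2 by simp
    qed
  qed
  also have "\<dots> = (\<Prod>k<n1. if digit d k (fst z) = digit d k (fst z') then 1 else 0) *
      (\<Prod>k<n2. if digit d k (snd z) = digit d k (snd z') then 1 else 0)"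
    by (rule prod_split_add)
  also have "\<dots> = (if fst z = fst z' then 1 else 0) * (if snd z = snd z' then 1 else 0)"
  proof -
    have b: "fst z < d ^ n1" "fst z' < d ^ n1" "snd z < d ^ n2" "snd z' < d ^ n2" using z by auto
    show ?thesis
      unfolding prod_digit_delta[OF b(1,2), where g = "\<lambda>_ _. 1::complex"]
        prod_digit_delta[OF b(3,4), where g = "\<lambda>_ _. 1::complex"] by simp
  qed
  also have "\<dots> = (if z = z' then 1 else 0)" by (auto simp: prod_eq_iff)
  finally show ?thesis .
qed

text \<open>\<open>Utens\<close> and the basis vectors are products over the copies, so the
  amplitude is a product of single-copy amplitudes, sorted into the two blocks.\<close>

lemma pbasis_amplitude:
  "(\<Sum>i<dB ^ (n1 + n2). \<Sum>l<dC ^ (n1 + n2). \<Sum>j<dA ^ (n1 + n2).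
      cnj (pbasis dB n1 n2 eB eB' b i) * cnj (pbasis dC n1 n2 eC eC' c l) *
      Utens dA dB dC U (n1 + n2) $$ (i * dC ^ (n1 + n2) + l, j) * pbasis dA n1 n2 eA eA' x j) =
    tpow3 dA dB dC n1 (ampl dA dB dC U eA eB eC) (fst x) (fst b) (fst c) *
    tpow3 dA dB dC n2 (ampl dA dB dC U eA' eB' eC') (snd x) (snd b) (snd c)"
proof -
  let ?n = "n1 + n2"
  let ?fA = "\<lambda>k a. if k < n1 then eA (digit dA k (fst x)) a else eA' (digit dA (k - n1) (snd x)) a"
  let ?fB = "\<lambda>k a. if k < n1 then eB (digit dB k (fst b)) a else eB' (digit dB (k - n1) (snd b)) a"
  let ?fC = "\<lambda>k a. if k < n1 then eC (digit dC k (fst c)) a else eC' (digit dC (k - n1) (snd c)) a"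
  let ?g = "\<lambda>k i l j. cnj (?fB k i) * cnj (?fC k l) * U $$ (i * dC + l, j) * ?fA k j"
  have U: "Utens dA dB dC U ?n $$ (i * dC ^ ?n + l, j) =
      (\<Prod>k<?n. U $$ (digit dB k i * dC + digit dC k l, digit dA k j))" if "i < dB ^ ?n" "l < dC ^ ?n" "j < dA ^ ?n" for i l j
  proof -
    have "(i * D + l) div D = i" if "l < D" for D using that by simp
    from this[OF that(2)] show ?thesis
      using that pair_index_less[OF that(1,2)] by (simp add: Utens_def)
  qed
  have "(\<Sum>i<dB ^ ?n. \<Sum>l<dC ^ ?n. \<Sum>j<dA ^ ?n. cnj (pbasis dB n1 n2 eB eB' b i) * cnj (pbasis dC n1 n2 eC eC' c l) *
      Utens dA dB dC U ?n $$ (i * dC ^ ?n + l, j) * pbasis dA n1 n2 eA eA' x j) =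
    (\<Sum>i<dB ^ ?n. \<Sum>l<dC ^ ?n. \<Sum>j<dA ^ ?n. \<Prod>k<?n. ?g k (digit dB k i) (digit dC k l) (digit dA k j))"
  proof (intro sum.cong refl)
    fix i l j assume "i \<in> {..<dB ^ ?n}" "l \<in> {..<dC ^ ?n}" "j \<in> {..<dA ^ ?n}"
    then show "cnj (pbasis dB n1 n2 eB eB' b i) * cnj (pbasis dC n1 n2 eC eC' c l) *
      Utens dA dB dC U ?n $$ (i * dC ^ ?n + l, j) * pbasis dA n1 n2 eA eA' x j = (\<Prod>k<?n. ?g k (digit dB k i) (digit dC k l) (digit dA k j))"
      unfolding pbasis_def prod.distrib cnj_prod by (simp only: U lessThan_iff)
  qed
  also have "\<dots> = (\<Prod>k<?n. \<Sum>i<dB. \<Sum>l<dC. \<Sum>j<dA. ?g k i l j)"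
    by (rule sum_digits_prod3)
  also have "\<dots> = (\<Prod>k<?n. if k < n1 then ampl dA dB dC U eA eB eC (digit dA k (fst x)) (digit dB k (fst b)) (digit dC k (fst c))
      else ampl dA dB dC U eA' eB' eC' (digit dA (k - n1) (snd x)) (digit dB (k - n1) (snd b)) (digit dC (k - n1) (snd c)))"
    by (intro prod.cong refl) (simp add: ampl_def)
  also have "\<dots> = tpow3 dA dB dC n1 (ampl dA dB dC U eA eB eC) (fst x) (fst b) (fst c) *
    tpow3 dA dB dC n2 (ampl dA dB dC U eA' eB' eC') (snd x) (snd b) (snd c)"
    unfolding tpow3_def by (rule prod_split_add)
  finally show ?thesis .
qed

section \<open>From codes in coordinates to codes on the original spaces\<close>

definition emb :: "'z set \<Rightarrow> ('z \<Rightarrow> 'j \<Rightarrow> complex) \<Rightarrow> ('z \<Rightarrow> complex) \<Rightarrow> 'j \<Rightarrow> complex" where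
  "emb I E f j = (\<Sum>z\<in>I. f z * E z j)"

lemma ip_emb: "ip S (emb I E f) v = ip I f (\<lambda>z. ip S (E z) v)"
proof -
  have "ip S (emb I E f) v = (\<Sum>j\<in>S. \<Sum>z\<in>I. cnj (f z) * (cnj (E z j) * v j))"
    by (simp add: ip_def emb_def sum_distrib_right mult.assoc)
  also have "\<dots> = ip I f (\<lambda>z. ip S (E z) v)"
    by (subst sum.swap) (simp add: ip_def sum_distrib_left)
  finally show ?thesis .
qed

lemma ip_swap: "ip S f (\<lambda>r. ip I g (\<lambda>c. h r c)) = ip I g (\<lambda>c. ip S f (\<lambda>r. h r c))"
  unfolding ip_def sum_distrib_left by (subst sum.swap) (simp add: mult.left_commute)

lemma orthonormal_bessel:
  assumes "finite S" "finite I" "\<And>z z'. z \<in> I \<Longrightarrow> z' \<in> I \<Longrightarrow> ip S (E z) (E z') = (if z = z' then 1 else 0)"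
  shows "nsq I (\<lambda>z. ip S (E z) v) \<le> nsq S v"
proof -
  have "pons S I E" using assms(3) by (auto simp: pons_def)
  from bessel[OF assms(1,2) this, of v] show ?thesis by (simp add: nsq_def[of I])
qed

lemma nsq_emb:
  assumes "finite I" "\<And>z z'. z \<in> I \<Longrightarrow> z' \<in> I \<Longrightarrow> ip S (E z) (E z') = (if z = z' then 1 else 0)"
  shows "nsq S (emb I E f) = nsq I f"
proof -
  have "ip S (E z) (emb I E f) = f z" if z: "z \<in> I" for z
  proof -
    have "ip S (E z) (emb I E f) = (\<Sum>z'\<in>I. f z' * ip S (E z) (E z'))"
      unfolding emb_def by (rule ip_sum_right)
    also have "\<dots> = (\<Sum>z'\<in>I. if z' = z then f z else 0)"
      using assms z by (intro sum.cong) auto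
    finally show ?thesis using assms z by simp
  qed
  then have "ip S (emb I E f) (emb I E f) = ip I f f"
    unfolding ip_emb by (intro ip_cong) auto
  then show ?thesis unfolding ip_nsq using of_real_eq_iff by blast
qed

text \<open>The product eigenbases embed coordinate vectors isometrically: codewords keep their
  norm, Bessel's inequality keeps the measurements below the identity, and the amplitudes agree by
  \<open>pbasis_amplitude\<close>.\<close>

lemma abs_code_ea_code:
  assumes eA: "\<And>x x'. x < dA \<Longrightarrow> x' < dA \<Longrightarrow> (\<Sum>i<dA. cnj (eA x i) * eA x' i) = (if x = x' then 1 else 0)"
    and eA': "\<And>x x'. x < dA \<Longrightarrow> x' < dA \<Longrightarrow> (\<Sum>i<dA. cnj (eA' x i) * eA' x' i) = (if x = x' then 1 else 0)"
    and eB: "\<And>x x'. x < dB \<Longrightarrow> x' < dB \<Longrightarrow> (\<Sum>i<dB. cnj (eB x i) * eB x' i) = (if x = x' then 1 else 0)"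
    and eB': "\<And>x x'. x < dB \<Longrightarrow> x' < dB \<Longrightarrow> (\<Sum>i<dB. cnj (eB' x i) * eB' x' i) = (if x = x' then 1 else 0)"
    and eC: "\<And>x x'. x < dC \<Longrightarrow> x' < dC \<Longrightarrow> (\<Sum>i<dC. cnj (eC x i) * eC x' i) = (if x = x' then 1 else 0)"
    and eC': "\<And>x x'. x < dC \<Longrightarrow> x' < dC \<Longrightarrow> (\<Sum>i<dC. cnj (eC' x i) * eC' x' i) = (if x = x' then 1 else 0)"
    and N: "0 < N"
    and code: "abs_code ({..<dA ^ n1} \<times> {..<dA ^ n2}) ({..<dB ^ n1} \<times> {..<dB ^ n2}) ({..<dC ^ n1} \<times> {..<dC ^ n2})
      (\<lambda>x b c. tpow3 dA dB dC n1 (ampl dA dB dC U eA eB eC) (fst x) (fst b) (fst c) *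
        tpow3 dA dB dC n2 (ampl dA dB dC U eA' eB' eC') (snd x) (snd b) (snd c)) \<epsilon> N"
  shows "ea_code dA dB dC U (n1 + n2) \<epsilon> N"
proof -
  let ?n = "n1 + n2"
  let ?XX = "{..<dA ^ n1} \<times> {..<dA ^ n2}" and ?BB = "{..<dB ^ n1} \<times> {..<dB ^ n2}" and ?CC = "{..<dC ^ n1} \<times> {..<dC ^ n2}"
  let ?u = "\<lambda>x b c. tpow3 dA dB dC n1 (ampl dA dB dC U eA eB eC) (fst x) (fst b) (fst c) *
        tpow3 dA dB dC n2 (ampl dA dB dC U eA' eB' eC') (snd x) (snd b) (snd c)"
  define EA where "EA = pbasis dA n1 n2 eA eA'"
  define EB where "EB = pbasis dB n1 n2 eB eB'"
  define EC where "EC = pbasis dC n1 n2 eC eC'"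
  have oA: "ip {..<dA ^ ?n} (EA z) (EA z') = (if z = z' then 1 else 0)" if "z \<in> ?XX" "z' \<in> ?XX" for z z'
    unfolding EA_def by (rule pbasis_orthonormal[OF eA eA' that])
  have oB: "ip {..<dB ^ ?n} (EB z) (EB z') = (if z = z' then 1 else 0)" if "z \<in> ?BB" "z' \<in> ?BB" for z z'
    unfolding EB_def by (rule pbasis_orthonormal[OF eB eB' that])
  have oC: "ip {..<dC ^ ?n} (EC z) (EC z') = (if z = z' then 1 else 0)" if "z \<in> ?CC" "z' \<in> ?CC" for z z'
    unfolding EC_def by (rule pbasis_orthonormal[OF eC eC' that])
  obtain a m F e where a: "\<forall>i<N. nsq ?XX (a i) = 1"
    and F: "\<forall>v. (\<Sum>y<m::nat. (cmod (ip ?CC (F y) v))\<^sup>2) \<le> nsq ?CC v"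
    and e: "\<forall>y<m. \<forall>v. (\<Sum>i<N. (cmod (ip ?BB (e y i) v))\<^sup>2) \<le> nsq ?BB v"
    and suc: "\<forall>i<N. 1 - \<epsilon> \<le> (\<Sum>y<m. (cmod (ip ?BB (e y i) (\<lambda>b. ip ?CC (F y) (\<lambda>c. \<Sum>x\<in>?XX. a i x * ?u x b c))))\<^sup>2)"
    using code unfolding abs_code_def by (elim exE conjE)
  show ?thesis
  proof (rule ea_code_vectors[OF N, where a = "\<lambda>i. emb ?XX EA (a i)" and m = m and F = "\<lambda>y. emb ?CC EC (F y)" and e = "\<lambda>y i. emb ?BB EB (e y i)"])
    fix i assume "i < N"
    then show "nsq {..<dA ^ ?n} (emb ?XX EA (a i)) = 1"
      using a nsq_emb[of ?XX "{..<dA ^ ?n}" EA, OF _ oA] by simp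
  next
    fix v :: "nat \<Rightarrow> complex"
    have "(\<Sum>y<m. (cmod (ip {..<dC ^ ?n} (emb ?CC EC (F y)) v))\<^sup>2) \<le> nsq ?CC (\<lambda>z. ip {..<dC ^ ?n} (EC z) v)"
      unfolding ip_emb using F by blast
    also have "\<dots> \<le> nsq {..<dC ^ ?n} v"
      by (rule orthonormal_bessel[OF _ _ oC]) auto
    finally show "(\<Sum>y<m. (cmod (ip {..<dC ^ ?n} (emb ?CC EC (F y)) v))\<^sup>2) \<le> nsq {..<dC ^ ?n} v" .
  next
    fix y and v :: "nat \<Rightarrow> complex" assume "y < m"
    then have "(\<Sum>i<N. (cmod (ip {..<dB ^ ?n} (emb ?BB EB (e y i)) v))\<^sup>2) \<le> nsq ?BB (\<lambda>z. ip {..<dB ^ ?n} (EB z) v)"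
      unfolding ip_emb using e by blast
    also have "\<dots> \<le> nsq {..<dB ^ ?n} v"
      by (rule orthonormal_bessel[OF _ _ oB]) auto
    finally show "(\<Sum>i<N. (cmod (ip {..<dB ^ ?n} (emb ?BB EB (e y i)) v))\<^sup>2) \<le> nsq {..<dB ^ ?n} v" .
  next
    fix i assume i: "i < N"
    let ?G = "\<lambda>r s. \<Sum>j<dA ^ ?n. Utens dA dB dC U ?n $$ (r * dC ^ ?n + s, j) * emb ?XX EA (a i) j"
    have am: "ip {..<dB ^ ?n} (EB b) (\<lambda>r. ip {..<dC ^ ?n} (EC c) (\<lambda>s. ?G r s)) = (\<Sum>x\<in>?XX. a i x * ?u x b c)" for b c
    proof -
      have G: "?G r s = (\<Sum>x\<in>?XX. a i x * (\<Sum>j<dA ^ ?n. Utens dA dB dC U ?n $$ (r * dC ^ ?n + s, j) * EA x j))" for r s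
        unfolding emb_def sum_distrib_left by (subst sum.swap) (simp add: mult.left_commute)
      have "ip {..<dB ^ ?n} (EB b) (\<lambda>r. ip {..<dC ^ ?n} (EC c) (\<lambda>s. ?G r s)) =
        (\<Sum>x\<in>?XX. a i x * ip {..<dB ^ ?n} (EB b) (\<lambda>r. ip {..<dC ^ ?n} (EC c) (\<lambda>s. \<Sum>j<dA ^ ?n. Utens dA dB dC U ?n $$ (r * dC ^ ?n + s, j) * EA x j)))"
        unfolding G ip_sum_right ..
      also have "\<dots> = (\<Sum>x\<in>?XX. a i x * ?u x b c)"
      proof (intro sum.cong refl arg_cong2[where f = "(*)"])
        fix x
        have "ip {..<dB ^ ?n} (EB b) (\<lambda>r. ip {..<dC ^ ?n} (EC c) (\<lambda>s. \<Sum>j<dA ^ ?n. Utens dA dB dC U ?n $$ (r * dC ^ ?n + s, j) * EA x j)) =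
          (\<Sum>r<dB ^ ?n. \<Sum>s<dC ^ ?n. \<Sum>j<dA ^ ?n. cnj (EB b r) * cnj (EC c s) * Utens dA dB dC U ?n $$ (r * dC ^ ?n + s, j) * EA x j)"
          by (simp add: ip_def sum_distrib_left mult.assoc)
        also have "\<dots> = ?u x b c"
          unfolding EA_def EB_def EC_def by (rule pbasis_amplitude)
        finally show "ip {..<dB ^ ?n} (EB b) (\<lambda>r. ip {..<dC ^ ?n} (EC c) (\<lambda>s. \<Sum>j<dA ^ ?n. Utens dA dB dC U ?n $$ (r * dC ^ ?n + s, j) * EA x j)) = ?u x b c" .
      qed
      finally show ?thesis .
    qed
    have "ip {..<dB ^ ?n} (emb ?BB EB (e y i)) (\<lambda>r. ip {..<dC ^ ?n} (emb ?CC EC (F y)) (\<lambda>s. ?G r s)) =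
        ip ?BB (e y i) (\<lambda>b. ip ?CC (F y) (\<lambda>c. \<Sum>x\<in>?XX. a i x * ?u x b c))" for y
    proof -
      have "ip {..<dB ^ ?n} (emb ?BB EB (e y i)) (\<lambda>r. ip {..<dC ^ ?n} (emb ?CC EC (F y)) (\<lambda>s. ?G r s)) =
        ip ?BB (e y i) (\<lambda>b. ip {..<dB ^ ?n} (EB b) (\<lambda>r. ip ?CC (F y) (\<lambda>c. ip {..<dC ^ ?n} (EC c) (\<lambda>s. ?G r s))))"
        by (simp only: ip_emb)
      also have "\<dots> = ip ?BB (e y i) (\<lambda>b. ip ?CC (F y) (\<lambda>c. ip {..<dB ^ ?n} (EB b) (\<lambda>r. ip {..<dC ^ ?n} (EC c) (\<lambda>s. ?G r s))))"
        by (intro ip_cong refl ip_swap)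
      also have "\<dots> = ip ?BB (e y i) (\<lambda>b. ip ?CC (F y) (\<lambda>c. \<Sum>x\<in>?XX. a i x * ?u x b c))"
        by (simp only: am)
      finally show ?thesis .
    qed
    then show "1 - \<epsilon> \<le> (\<Sum>y<m. (cmod (ip {..<dB ^ ?n} (emb ?BB EB (e y i)) (\<lambda>r. ip {..<dC ^ ?n} (emb ?CC EC (F y)) (\<lambda>s. ?G r s))))\<^sup>2)"
      using suc i by simp
  qed
qed

section \<open>Subadditivity of entropy\<close>

text \<open>Gibbs' inequality: \<open>T i j k\<close> is compared with
  \<open>p2 j * p3 k * T i j k / p1 i\<close>, whose total is at most 1 by \<open>cond\<close>,
  using ln x <= x - 1. Working with the label distribution yields quantum subadditivity without
  logarithms of operators.\<close>

lemma entropy_le_sum: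
  fixes T :: "nat \<Rightarrow> nat \<Rightarrow> nat \<Rightarrow> real"
  assumes T0: "\<And>i j k. i < d1 \<Longrightarrow> j < d2 \<Longrightarrow> k < d3 \<Longrightarrow> 0 \<le> T i j k"
    and p1: "\<And>i. i < d1 \<Longrightarrow> (\<Sum>j<d2. \<Sum>k<d3. T i j k) = p1 i"
    and p2: "\<And>j. j < d2 \<Longrightarrow> (\<Sum>i<d1. \<Sum>k<d3. T i j k) = p2 j"
    and p3: "\<And>k. k < d3 \<Longrightarrow> (\<Sum>i<d1. \<Sum>j<d2. T i j k) = p3 k"
    and tot: "(\<Sum>i<d1. p1 i) = 1"
    and cond: "\<And>j k. j < d2 \<Longrightarrow> k < d3 \<Longrightarrow> (\<Sum>i<d1. T i j k / p1 i) \<le> 1"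
  shows "shan d1 p1 \<le> shan d2 p2 + shan d3 p3"
proof -
  have le1: "T i j k \<le> p1 i" and le2: "T i j k \<le> p2 j" and le3: "T i j k \<le> p3 k" if ijk: "i < d1" "j < d2" "k < d3" for i j k
  proof -
    have "T i j k \<le> (\<Sum>k<d3. T i j k)" using ijk T0 by (intro member_le_sum) auto
    also have "\<dots> \<le> (\<Sum>j<d2. \<Sum>k<d3. T i j k)"
      using ijk T0 by (intro member_le_sum[where f = "\<lambda>j. \<Sum>k<d3. T i j k"]) (auto intro!: sum_nonneg)
    finally show "T i j k \<le> p1 i" using p1 ijk by simp
    have "T i j k \<le> (\<Sum>k<d3. T i j k)" using ijk T0 by (intro member_le_sum) auto
    also have "\<dots> \<le> (\<Sum>i<d1. \<Sum>k<d3. T i j k)"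
      using ijk T0 by (intro member_le_sum[where f = "\<lambda>i. \<Sum>k<d3. T i j k"]) (auto intro!: sum_nonneg)
    finally show "T i j k \<le> p2 j" using p2 ijk by simp
    have "T i j k \<le> (\<Sum>j<d2. T i j k)" using ijk T0 by (intro member_le_sum[where f = "\<lambda>j. T i j k"]) auto
    also have "\<dots> \<le> (\<Sum>i<d1. \<Sum>j<d2. T i j k)"
      using ijk T0 by (intro member_le_sum[where f = "\<lambda>i. \<Sum>j<d2. T i j k"]) (auto intro!: sum_nonneg)
    finally show "T i j k \<le> p3 k" using p3 ijk by simp
  qed
  have s1: "shan d1 p1 = (\<Sum>i<d1. \<Sum>j<d2. \<Sum>k<d3. T i j k * (- log 2 (p1 i)))"
    unfolding shan_def by (intro sum.cong refl) (simp only: sum_distrib_right[symmetric] p1 lessThan_iff)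
  have s2: "shan d2 p2 = (\<Sum>i<d1. \<Sum>j<d2. \<Sum>k<d3. T i j k * (- log 2 (p2 j)))"
  proof -
    have "shan d2 p2 = (\<Sum>j<d2. \<Sum>i<d1. \<Sum>k<d3. T i j k * (- log 2 (p2 j)))"
      unfolding shan_def by (intro sum.cong refl) (simp only: sum_distrib_right[symmetric] p2 lessThan_iff)
    also have "\<dots> = (\<Sum>i<d1. \<Sum>j<d2. \<Sum>k<d3. T i j k * (- log 2 (p2 j)))" by (rule sum.swap)
    finally show ?thesis .
  qed
  have s3: "shan d3 p3 = (\<Sum>i<d1. \<Sum>j<d2. \<Sum>k<d3. T i j k * (- log 2 (p3 k)))"
  proof -
    have "shan d3 p3 = (\<Sum>k<d3. \<Sum>i<d1. \<Sum>j<d2. T i j k * (- log 2 (p3 k)))"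
      unfolding shan_def by (intro sum.cong refl) (simp only: sum_distrib_right[symmetric] p3 lessThan_iff)
    also have "\<dots> = (\<Sum>i<d1. \<Sum>k<d3. \<Sum>j<d2. T i j k * (- log 2 (p3 k)))" by (rule sum.swap)
    also have "\<dots> = (\<Sum>i<d1. \<Sum>j<d2. \<Sum>k<d3. T i j k * (- log 2 (p3 k)))" by (intro sum.cong[OF refl] sum.swap)
    finally show ?thesis .
  qed
  have sp2: "(\<Sum>j<d2. p2 j) = 1"
  proof -
    have "(\<Sum>j<d2. p2 j) = (\<Sum>j<d2. \<Sum>i<d1. \<Sum>k<d3. T i j k)" using p2 by simp
    also have "\<dots> = (\<Sum>i<d1. \<Sum>j<d2. \<Sum>k<d3. T i j k)" by (rule sum.swap)
    finally show ?thesis using p1 tot by simp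
  qed
  have sp3: "(\<Sum>k<d3. p3 k) = 1"
  proof -
    have "(\<Sum>k<d3. p3 k) = (\<Sum>k<d3. \<Sum>i<d1. \<Sum>j<d2. T i j k)" using p3 by simp
    also have "\<dots> = (\<Sum>i<d1. \<Sum>k<d3. \<Sum>j<d2. T i j k)" by (rule sum.swap)
    also have "\<dots> = (\<Sum>i<d1. \<Sum>j<d2. \<Sum>k<d3. T i j k)" by (intro sum.cong[OF refl] sum.swap)
    finally show ?thesis using p1 tot by simp
  qed
  have p20: "0 \<le> p2 j" if "j < d2" for j using p2[OF that, symmetric] T0 that by (auto intro!: sum_nonneg)
  have p30: "0 \<le> p3 k" if "k < d3" for k using p3[OF that, symmetric] T0 that by (auto intro!: sum_nonneg)
  \<comment> \<open>A positive \<open>T i j k\<close> forces all three marginals to be positive, so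
    the logarithm splits; for \<open>T i j k = 0\<close> both sides vanish.\<close>
  have pointwise: "T i j k * (- log 2 (p1 i)) - T i j k * (- log 2 (p2 j)) - T i j k * (- log 2 (p3 k))
      \<le> (p2 j * p3 k * (T i j k / p1 i) - T i j k) / ln 2" if ijk: "i < d1" "j < d2" "k < d3" for i j k
  proof (cases "T i j k = 0")
    case False
    then have t: "0 < T i j k" using T0[OF ijk] by simp
    then have pos: "0 < p1 i" "0 < p2 j" "0 < p3 k" using le1[OF ijk] le2[OF ijk] le3[OF ijk] by linarith+
    have "ln (p2 j * p3 k / p1 i) \<le> p2 j * p3 k / p1 i - 1"
      using pos by (intro ln_le_minus_one) simp
    then have "T i j k * ln (p2 j * p3 k / p1 i) / ln 2 \<le> T i j k * (p2 j * p3 k / p1 i - 1) / ln 2"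
      using t by (intro divide_right_mono mult_left_mono) auto
    moreover have "ln (p2 j * p3 k / p1 i) = ln (p2 j) + ln (p3 k) - ln (p1 i)"
      using pos by (simp add: ln_div ln_mult_pos)
    ultimately show ?thesis
      unfolding log_def by (simp add: algebra_simps diff_divide_distrib add_divide_distrib)
  qed simp
  have "shan d1 p1 - shan d2 p2 - shan d3 p3 =
     (\<Sum>i<d1. \<Sum>j<d2. \<Sum>k<d3. T i j k * (- log 2 (p1 i)) - T i j k * (- log 2 (p2 j)) - T i j k * (- log 2 (p3 k)))"
    unfolding s1 s2 s3 by (simp only: sum_subtractf)
  also have "\<dots> \<le> (\<Sum>i<d1. \<Sum>j<d2. \<Sum>k<d3. (p2 j * p3 k * (T i j k / p1 i) - T i j k) / ln 2)"
    using pointwise by (intro sum_mono) simp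
  also have "\<dots> = ((\<Sum>i<d1. \<Sum>j<d2. \<Sum>k<d3. p2 j * p3 k * (T i j k / p1 i)) - (\<Sum>i<d1. \<Sum>j<d2. \<Sum>k<d3. T i j k)) / ln 2"
    by (simp only: sum_divide_distrib[symmetric] sum_subtractf)
  also have "(\<Sum>i<d1. \<Sum>j<d2. \<Sum>k<d3. T i j k) = 1" using p1 tot by simp
  also have "(\<Sum>i<d1. \<Sum>j<d2. \<Sum>k<d3. p2 j * p3 k * (T i j k / p1 i)) = (\<Sum>j<d2. \<Sum>k<d3. \<Sum>i<d1. p2 j * p3 k * (T i j k / p1 i))"
    by (subst sum.swap, rule sum.cong[OF refl], rule sum.swap)
  also have "\<dots> = (\<Sum>j<d2. \<Sum>k<d3. p2 j * p3 k * (\<Sum>i<d1. T i j k / p1 i))"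
    by (simp only: sum_distrib_left)
  also have "((\<Sum>j<d2. \<Sum>k<d3. p2 j * p3 k * (\<Sum>i<d1. T i j k / p1 i)) - 1) / ln 2 \<le> ((\<Sum>j<d2. \<Sum>k<d3. p2 j * p3 k) - 1) / ln 2"
    using cond p20 p30 by (intro divide_right_mono diff_right_mono sum_mono mult_left_le) auto
  also have "(\<Sum>j<d2. \<Sum>k<d3. p2 j * p3 k) = 1"
    using sp2 sp3 by (simp flip: sum_product)
  finally show ?thesis by simp
qed

text \<open>With R the purifying system, these are subadditivity for BC, where S(BC) = S(A), and for
  RC, where S(RC) = S(B). The condition on the distribution is Bessel's inequality for one
  coordinate vector against an orthonormal family.\<close>

lemma tripartite_subadditive:
  assumes "tripartite {..<dA} {..<dB} {..<dC} p q r u"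
  shows "shan dA p \<le> shan dB q + shan dC r" and "shan dB q \<le> shan dA p + shan dC r"
proof -
  interpret t: tripartite "{..<dA}" "{..<dB}" "{..<dC}" p q r u by (rule assms)
  have TX: "\<And>x. x < dA \<Longrightarrow> (\<Sum>b<dB. \<Sum>c<dC. t.T x b c) = p x" using t.T_X by simp
  have TB: "\<And>b. b < dB \<Longrightarrow> (\<Sum>x<dA. \<Sum>c<dC. t.T x b c) = q b"
    using t.T_B by (subst sum.swap) simp
  have TC: "\<And>c. c < dC \<Longrightarrow> (\<Sum>x<dA. \<Sum>b<dB. t.T x b c) = r c"
    using t.T_C by (subst sum.swap) simp
  show "shan dA p \<le> shan dB q + shan dC r"
  proof (rule entropy_le_sum[where T = t.T, OF _ TX TB TC])
    fix b c assume bc: "b < dB" "c < dC"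
    let ?S = "{..<dB} \<times> {..<dC}"
    let ?E = "\<lambda>x z. u x (fst z) (snd z)"
    have on: "ip ?S (?E x) (?E x') = (if x = x' then 1 else 0)" if "x \<in> {..<dA}" "x' \<in> {..<dA}" for x x'
      using t.iso[OF that(2,1)] by (auto simp: ip_def sum.cartesian_product' mult.commute)
    have "nsq {..<dA} (\<lambda>x. ip ?S (?E x) (\<lambda>z. if z = (b, c) then 1 else 0)) \<le> nsq ?S (\<lambda>z. if z = (b, c) then 1 else 0)"
      by (rule orthonormal_bessel[OF _ _ on]) auto
    also have "\<dots> = (\<Sum>z\<in>?S. if z = (b, c) then 1 else 0)"
      unfolding nsq_def by (intro sum.cong) auto
    also have "\<dots> = 1" using bc by simp
    also have "nsq {..<dA} (\<lambda>x. ip ?S (?E x) (\<lambda>z. if z = (b, c) then 1 else 0)) = (\<Sum>x<dA. (cmod (u x b c))\<^sup>2)"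
      unfolding nsq_def
    proof (rule sum.cong[OF refl])
      fix x
      have "ip ?S (?E x) (\<lambda>z. if z = (b, c) then 1 else 0) = (\<Sum>z\<in>?S. if z = (b, c) then cnj (?E x z) else 0)"
        unfolding ip_def by (intro sum.cong) auto
      then show "(cmod (ip ?S (?E x) (\<lambda>z. if z = (b, c) then 1 else 0)))\<^sup>2 = (cmod (u x b c))\<^sup>2"
        using bc by simp
    qed
    finally have "(\<Sum>x<dA. (cmod (u x b c))\<^sup>2) \<le> 1" .
    moreover have "(\<Sum>x<dA. t.T x b c / p x) \<le> (\<Sum>x<dA. (cmod (u x b c))\<^sup>2)"
      by (intro sum_mono) (simp add: t.T_def)
    ultimately show "(\<Sum>x<dA. t.T x b c / p x) \<le> 1" by linarith
  qed (use t.T_nonneg t.p_sum in auto)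
  have TC': "\<And>c. c < dC \<Longrightarrow> (\<Sum>b<dB. \<Sum>x<dA. t.T x b c) = r c" using t.T_C by simp
  show "shan dB q \<le> shan dA p + shan dC r"
  proof (rule entropy_le_sum[where T = "\<lambda>b x c. t.T x b c", OF _ TB TX TC'])
    fix x c assume xc: "x < dA" "c < dC"
    let ?S = "{..<dC} \<times> {..<dA}"
    \<comment> \<open>Normalised conditional vectors of R and Charlie given \<open>b\<close>. For
      \<open>q b = 0\<close> the division gives the zero vector, which \<open>pons\<close>
      admits.\<close>
    let ?E = "\<lambda>b z. of_real (sqrt (p (snd z) / q b)) * u (snd z) b (fst z)"
    have EE: "ip ?S (?E b) (?E b') = (if b = b' \<and> q b \<noteq> 0 then 1 else 0)" if b: "b \<in> {..<dB}" "b' \<in> {..<dB}" for b b'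
    proof -
      have "ip ?S (?E b) (?E b') = (\<Sum>c<dC. \<Sum>x<dA. of_real (1 / (sqrt (q b) * sqrt (q b'))) * (of_real (p x) * u x b' c * cnj (u x b c)))"
        unfolding ip_def sum.cartesian_product'
      proof (intro sum.cong refl)
        fix c x assume "x \<in> {..<dA}"
        then have "sqrt (p x) * sqrt (p x) = p x" using t.p_nonneg by simp
        then have "complex_of_real (p x) = of_real (sqrt (p x)) * of_real (sqrt (p x))" by (simp flip: of_real_mult)
        then show "cnj (of_real (sqrt (p (snd (c, x)) / q b)) * u (snd (c, x)) b (fst (c, x))) * (of_real (sqrt (p (snd (c, x)) / q b')) * u (snd (c, x)) b' (fst (c, x)))
           = of_real (1 / (sqrt (q b) * sqrt (q b'))) * (of_real (p x) * u x b' c * cnj (u x b c))"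
          by (simp add: real_sqrt_divide)
      qed
      also have "\<dots> = of_real (1 / (sqrt (q b) * sqrt (q b'))) * (\<Sum>c<dC. \<Sum>x<dA. of_real (p x) * u x b' c * cnj (u x b c))"
        by (simp only: sum_distrib_left)
      also have "\<dots> = (if b = b' \<and> q b \<noteq> 0 then 1 else 0)"
        using t.margB[OF b(2,1)] t.q_nonneg[OF b(1)] by (auto simp flip: of_real_mult)
      finally show ?thesis .
    qed
    have "pons ?S {..<dB} ?E" unfolding pons_def using EE by auto
    from bessel[OF _ _ this, of "\<lambda>z. if z = (c, x) then 1 else 0"]
    have "(\<Sum>b<dB. (cmod (ip ?S (?E b) (\<lambda>z. if z = (c, x) then 1 else 0)))\<^sup>2) \<le> nsq ?S (\<lambda>z. if z = (c, x) then 1 else 0)"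
      by simp
    also have "\<dots> = (\<Sum>z\<in>?S. if z = (c, x) then 1 else 0)"
      unfolding nsq_def by (intro sum.cong) auto
    also have "\<dots> = 1" using xc by simp
    also have "(\<Sum>b<dB. (cmod (ip ?S (?E b) (\<lambda>z. if z = (c, x) then 1 else 0)))\<^sup>2) = (\<Sum>b<dB. t.T x b c / q b)"
    proof (rule sum.cong[OF refl])
      fix b assume b: "b \<in> {..<dB}"
      have "ip ?S (?E b) (\<lambda>z. if z = (c, x) then 1 else 0) = (\<Sum>z\<in>?S. if z = (c, x) then cnj (?E b z) else 0)"
        unfolding ip_def by (intro sum.cong) auto
      also have "\<dots> = cnj (?E b (c, x))" using xc by simp
      finally show "(cmod (ip ?S (?E b) (\<lambda>z. if z = (c, x) then 1 else 0)))\<^sup>2 = t.T x b c / q b"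
        using t.p_nonneg[of x] t.q_nonneg[OF b] xc
        by (simp add: t.T_def norm_mult norm_divide power_mult_distrib real_sqrt_divide power_divide)
    qed
    finally show "(\<Sum>b<dB. t.T x b c / q b) \<le> 1" .
  qed (use t.T_nonneg t.q_sum in auto)
qed

section \<open>Asymptotic rates\<close>

lemma powr_floor_bounds:
  fixes x :: real
  shows "real (nat \<lfloor>2 powr x\<rfloor>) \<le> 2 powr x" "2 powr x \<le> real (Suc (nat \<lfloor>2 powr x\<rfloor>))"
proof -
  have "0 \<le> 2 powr x" by simp
  then show "real (nat \<lfloor>2 powr x\<rfloor>) \<le> 2 powr x" "2 powr x \<le> real (Suc (nat \<lfloor>2 powr x\<rfloor>))"
    by linarith+
qed

text \<open>\<open>V\<close> is the total surprisal variance and bounds the atypical masses. The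
  factor \<open>n1\<close> in the comparison of \<open>SB\<close> and \<open>SC\<close> makes it
  trivial for \<open>n1 = 0\<close>. The bound by 1 gives the typical set of the first input
  spectrum positive mass, so codewords can be normalised. Of the five terms
  \<open>2 powr (- D)\<close>, two come from the first stage and three from the second.\<close>

lemma block_code_exists:
  assumes iso: "isometry dA dB dC U" and rho: "density dA \<rho>" and rho': "density dA \<rho>'"
  defines "SB \<equiv> vn_entropy (chan dB dC U \<rho>)" and "SC \<equiv> vn_entropy (cchan dB dC U \<rho>)"
    and "SA' \<equiv> vn_entropy \<rho>'" and "SB' \<equiv> vn_entropy (chan dB dC U \<rho>')"
  shows "\<exists>V. \<forall>n1 n2 D \<epsilon>. 0 < D \<longrightarrow> real n1 * SB \<le> real n1 * SC \<longrightarrow> real (n1 + n2) * V / D\<^sup>2 < 1 \<longrightarrow>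
     2 * real (n1 + n2) * V / D\<^sup>2 + 5 * 2 powr (- D) \<le> \<epsilon> \<longrightarrow>
     (\<exists>N. ea_code dA dB dC U (n1 + n2) \<epsilon> N \<and>
       2 powr (real n1 * (SC - SB) + min (real n1 * SB + real n2 * SB') (real n2 * SA') - 8 * D) \<le> real N)"
proof -
  obtain eA p eB q eC r where b: "eigbasis dA \<rho> eA p" "eigbasis dB (chan dB dC U \<rho>) eB q"
      "eigbasis dC (cchan dB dC U \<rho>) eC r"
    and t: "tripartite {..<dA} {..<dB} {..<dC} p q r (ampl dA dB dC U eA eB eC)"
    and S: "vn_entropy (chan dB dC U \<rho>) = shan dB q" "vn_entropy (cchan dB dC U \<rho>) = shan dC r"
    using channel_tripartite[OF iso rho] by (elim exE conjE)
  obtain eA' p' eB' q' eC' r' where b': "eigbasis dA \<rho>' eA' p'" "eigbasis dB (chan dB dC U \<rho>') eB' q'"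
      "eigbasis dC (cchan dB dC U \<rho>') eC' r'"
    and t': "tripartite {..<dA} {..<dB} {..<dC} p' q' r' (ampl dA dB dC U eA' eB' eC')"
    and S': "vn_entropy \<rho>' = shan dA p'" "vn_entropy (chan dB dC U \<rho>') = shan dB q'"
    using channel_tripartite[OF iso rho'] by (elim exE conjE)
  interpret t: tripartite "{..<dA}" "{..<dB}" "{..<dC}" p q r "ampl dA dB dC U eA eB eC" by (rule t)
  interpret t': tripartite "{..<dA}" "{..<dB}" "{..<dC}" p' q' r' "ampl dA dB dC U eA' eB' eC'" by (rule t')
  interpret p: distribution dA p using t.p_nonneg t.p_sum by unfold_locales auto
  interpret q: distribution dB q using t.q_nonneg t.q_sum by unfold_locales auto
  interpret r: distribution dC r using t.r_nonneg t.r_sum by unfold_locales auto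
  interpret p': distribution dA p' using t'.p_nonneg t'.p_sum by unfold_locales auto
  interpret q': distribution dB q' using t'.q_nonneg t'.q_sum by unfold_locales auto
  interpret r': distribution dC r' using t'.r_nonneg t'.r_sum by unfold_locales auto
  have e: "SB = shan dB q" "SC = shan dC r" "SA' = shan dA p'" "SB' = shan dB q'"
    by (simp_all add: SB_def SC_def SA'_def SB'_def S S')
  define V1 where "V1 = svar dA p + svar dB q + svar dC r"
  define V2 where "V2 = svar dA p' + svar dB q' + svar dC r'"
  define V where "V = V1 + V2"
  have V: "0 \<le> V1" "0 \<le> V2" "svar dA p \<le> V"
    using p.svar_nonneg q.svar_nonneg r.svar_nonneg p'.svar_nonneg q'.svar_nonneg r'.svar_nonneg
    by (auto simp: V1_def V2_def V_def)
  have "\<exists>N. ea_code dA dB dC U (n1 + n2) \<epsilon> N \<and>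
       2 powr (real n1 * (SC - SB) + min (real n1 * SB + real n2 * SB') (real n2 * SA') - 8 * D) \<le> real N"
    if D: "0 < D" and n1: "real n1 * SB \<le> real n1 * SC" and V1: "real (n1 + n2) * V / D\<^sup>2 < 1"
      and eps: "2 * real (n1 + n2) * V / D\<^sup>2 + 5 * 2 powr (- D) \<le> \<epsilon>" for n1 n2 D \<epsilon>
  proof -
    \<comment> \<open>Size and purity of a typical set each cost a factor \<open>2 powr D\<close>,
      and \<open>2 powr (- 2 * D)\<close> has to remain under the root: hence
      \<open>4 * D\<close>.\<close>
    define g where "g = real n1 * (SC - SB) - 4 * D"
    \<comment> \<open>The two limits come from the purity on Bob's side and the purity of the joint
      state; the margin \<open>4 * D\<close> arises as in \<open>g\<close>.\<close>
    define h where "h = min (real n1 * SB + real n2 * SB') (real n2 * SA') - 4 * D"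
    \<comment> \<open>The codes have \<open>Suc M1\<close> and \<open>Suc M2\<close> members, so
      rounding loses nothing and a negative exponent still leaves one message.\<close>
    define M1 where "M1 = nat \<lfloor>2 powr g\<rfloor>"
    define M2 where "M2 = nat \<lfloor>2 powr h\<rfloor>"
    let ?X0 = "typical dA n1 p D" and ?B0 = "typical dB n1 q D" and ?C0 = "typical dC n1 r D"
    let ?X0' = "typical dA n2 p' D" and ?B0' = "typical dB n2 q' D" and ?C0' = "typical dC n2 r' D"
    define e1 where "e1 = real n1 * V1 / D\<^sup>2 + 2 powr (- D)"
    \<comment> \<open>Since \<open>n1 * SB <= n1 * SC\<close>, the bound on Bob's purity also covers
      Charlie's; the factor 2 adds the two.\<close>
    define e2 where "e2 = 2 * 2 powr (D - real n1 * SB)"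
    have D2: "0 < D\<^sup>2" using D by simp
    have m1: "sum (tpow dA n1 p) ({..<dA ^ n1} - ?X0) + sum (tpow dB n1 q) ({..<dB ^ n1} - ?B0) + sum (tpow dC n1 r) ({..<dC ^ n1} - ?C0) \<le> real n1 * V1 / D\<^sup>2"
      using p.atypical_mass[OF D, of n1] q.atypical_mass[OF D, of n1] r.atypical_mass[OF D, of n1]
      by (simp add: V1_def distrib_left add_divide_distrib)
    have m2: "sum (tpow dA n2 p') ({..<dA ^ n2} - ?X0') + sum (tpow dB n2 q') ({..<dB ^ n2} - ?B0') + sum (tpow dC n2 r') ({..<dC ^ n2} - ?C0') \<le> real n2 * V2 / D\<^sup>2"
      using p'.atypical_mass[OF D, of n2] q'.atypical_mass[OF D, of n2] r'.atypical_mass[OF D, of n2]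
      by (simp add: V2_def distrib_left add_divide_distrib)
    have P0: "0 < sum (tpow dA n1 p) ?X0"
    proof -
      have "sum (tpow dA n1 p) ({..<dA ^ n1} - ?X0) \<le> real n1 * svar dA p / D\<^sup>2" by (rule p.atypical_mass[OF D])
      also have "\<dots> \<le> real (n1 + n2) * V / D\<^sup>2"
        using V p.svar_nonneg D2 by (intro divide_right_mono mult_mono) auto
      also have "\<dots> < 1" by (rule V1)
      finally have "sum (tpow dA n1 p) ({..<dA ^ n1} - ?X0) < 1" .
      moreover have "sum (tpow dA n1 p) {..<dA ^ n1} = 1" by (simp add: sum_tpow p.total)
      ultimately show ?thesis
        using sum.subset_diff[OF p.typical_subset[of n1 D] finite_lessThan, where g = "tpow dA n1 p"] by simp
    qed
    have "abs_code ({..<dA ^ n1} \<times> {..<dA ^ n2}) ({..<dB ^ n1} \<times> {..<dB ^ n2}) ({..<dC ^ n1} \<times> {..<dC ^ n2})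
      (\<lambda>x b c. tpow3 dA dB dC n1 (ampl dA dB dC U eA eB eC) (fst x) (fst b) (fst c) *
        tpow3 dA dB dC n2 (ampl dA dB dC U eA' eB' eC') (snd x) (snd b) (snd c)) \<epsilon> (Suc M1 * Suc M2)"
    proof (rule oneshot_code[OF tripartite_tpow[OF t] tripartite_tpow[OF t'] p.typical_subset q.typical_subset r.typical_subset
          p'.typical_subset q'.typical_subset r'.typical_subset P0])
      show "Suc M1 \<le> Suc M1" "0 < Suc M2" "Suc M2 \<le> Suc M2" by auto
      show "0 < e1" using V(1) D2 by (auto simp: e1_def intro!: add_nonneg_pos)
      have "sqrt (real M1 * real (card ?B0) * (\<Sum>c\<in>?C0. (tpow dC n1 r c)\<^sup>2)) \<le> sqrt (2 powr g * 2 powr (real n1 * SB + D) * 2 powr (D - real n1 * SC))"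
        unfolding M1_def e using powr_floor_bounds(1)[of g] q.card_typical[of n1 D] r.typical_purity[of n1 D]
        by (intro real_sqrt_le_mono mult_mono) (auto intro!: mult_nonneg_nonneg sum_nonneg)
      also have "2 powr g * 2 powr (real n1 * SB + D) * 2 powr (D - real n1 * SC) = (2 powr (- D))\<^sup>2"
        by (simp add: g_def power2_eq_square algebra_simps flip: powr_add)
      finally have "sqrt (real M1 * real (card ?B0) * (\<Sum>c\<in>?C0. (tpow dC n1 r c)\<^sup>2)) \<le> 2 powr (- D)" by simp
      then show "sum (tpow dA n1 p) ({..<dA ^ n1} - ?X0) + sum (tpow dB n1 q) ({..<dB ^ n1} - ?B0) + sum (tpow dC n1 r) ({..<dC ^ n1} - ?C0)
          + sqrt (real M1 * real (card ?B0) * (\<Sum>c\<in>?C0. (tpow dC n1 r c)\<^sup>2)) \<le> e1"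
        using m1 by (simp add: e1_def)
      show "0 < e2" by (simp add: e2_def)
      have "2 powr (D - real n1 * SC) \<le> 2 powr (D - real n1 * SB)" using n1 by simp
      then show "(\<Sum>b\<in>?B0. (tpow dB n1 q b)\<^sup>2) + (\<Sum>c\<in>?C0. (tpow dC n1 r c)\<^sup>2) \<le> e2"
        using q.typical_purity[of n1 D] r.typical_purity[of n1 D] unfolding e2_def e by linarith
      let ?w = "2 powr (- D)"
      have w: "0 < ?w" by simp
      have hB: "2 powr h * (2 powr (D - real n1 * SB) * 2 powr (D - real n2 * SB')) \<le> ?w\<^sup>2"
      proof -
        have "2 powr h * (2 powr (D - real n1 * SB) * 2 powr (D - real n2 * SB')) = 2 powr (h + (D - real n1 * SB) + (D - real n2 * SB'))"
          by (simp only: powr_add mult.assoc)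
        also have "\<dots> \<le> 2 powr (- D + - D)" by (rule powr_mono) (auto simp: h_def)
        finally show ?thesis by (simp add: power2_eq_square flip: powr_add)
      qed
      have hA: "2 powr h * 2 powr (D - real n2 * SA') \<le> ?w\<^sup>2"
      proof -
        have "2 powr h * 2 powr (D - real n2 * SA') = 2 powr (h + (D - real n2 * SA'))"
          by (simp only: powr_add)
        also have "\<dots> \<le> 2 powr (- D + - D)" using D by (intro powr_mono) (auto simp: h_def)
        finally show ?thesis by (simp add: power2_eq_square flip: powr_add)
      qed
      have "real M2 * (2 * e2 * (\<Sum>b\<in>?B0'. (tpow dB n2 q' b)\<^sup>2) + (\<Sum>x\<in>?X0'. (tpow dA n2 p' x)\<^sup>2))
          \<le> 2 powr h * (2 * e2 * 2 powr (D - real n2 * SB') + 2 powr (D - real n2 * SA'))"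
        unfolding M2_def e(3,4)
        using powr_floor_bounds(1)[of h] q'.typical_purity[of n2 D] p'.typical_purity[of n2 D]
        by (intro mult_mono add_mono mult_left_mono) (auto simp: e2_def intro!: add_nonneg_nonneg mult_nonneg_nonneg sum_nonneg)
      also have "\<dots> = 4 * (2 powr h * (2 powr (D - real n1 * SB) * 2 powr (D - real n2 * SB'))) + 2 powr h * 2 powr (D - real n2 * SA')"
        by (simp add: e2_def algebra_simps)
      also have "\<dots> \<le> 4 * ?w\<^sup>2 + ?w\<^sup>2" using hA hB by linarith
      \<comment> \<open>The total 5 is rounded up to the square 9, which leaves
        \<open>3 * ?w\<close> after taking the root.\<close>
      also have "\<dots> \<le> (3 * ?w)\<^sup>2" by (simp add: power_mult_distrib)
      finally have "sqrt (real M2 * (2 * e2 * (\<Sum>b\<in>?B0'. (tpow dB n2 q' b)\<^sup>2) + (\<Sum>x\<in>?X0'. (tpow dA n2 p' x)\<^sup>2))) \<le> 3 * ?w"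
        using w by (intro real_le_lsqrt) auto
      moreover have "2 * e1 + real n2 * V2 / D\<^sup>2 + 3 * ?w \<le> 2 * real (n1 + n2) * V / D\<^sup>2 + 5 * ?w"
      proof -
        have "2 * (real n1 * V1) + real n2 * V2 \<le> 2 * real (n1 + n2) * V"
        proof -
          have "real n1 * V1 \<le> real n1 * V" "real n2 * V2 \<le> real n2 * V" "0 \<le> real n2 * V"
            using V by (auto simp: V_def intro!: mult_left_mono)
          then show ?thesis by (simp add: algebra_simps)
        qed
        then have "(2 * (real n1 * V1) + real n2 * V2) / D\<^sup>2 \<le> 2 * real (n1 + n2) * V / D\<^sup>2"
          using D2 by (intro divide_right_mono) auto
        then show ?thesis by (simp add: e1_def add_divide_distrib)
      qed
      ultimately show "2 * e1 + sum (tpow dA n2 p') ({..<dA ^ n2} - ?X0') + sum (tpow dB n2 q') ({..<dB ^ n2} - ?B0') + sum (tpow dC n2 r') ({..<dC ^ n2} - ?C0')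
        + sqrt (real M2 * (2 * e2 * (\<Sum>b\<in>?B0'. (tpow dB n2 q' b)\<^sup>2) + (\<Sum>x\<in>?X0'. (tpow dA n2 p' x)\<^sup>2))) \<le> \<epsilon>"
        using m2 eps by linarith
    qed
    then have "ea_code dA dB dC U (n1 + n2) \<epsilon> (Suc M1 * Suc M2)"
      by (rule abs_code_ea_code[rotated 7]) (use b b' in \<open>simp_all add: eigbasis_def\<close>)
    moreover have "2 powr (real n1 * (SC - SB) + min (real n1 * SB + real n2 * SB') (real n2 * SA') - 8 * D) \<le> real (Suc M1 * Suc M2)"
    proof -
      have "2 powr (real n1 * (SC - SB) + min (real n1 * SB + real n2 * SB') (real n2 * SA') - 8 * D) = 2 powr g * 2 powr h"
        by (simp add: g_def h_def flip: powr_add)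
      also have "\<dots> \<le> real (Suc M1) * real (Suc M2)"
        unfolding M1_def M2_def by (intro mult_mono powr_floor_bounds) auto
      finally show ?thesis by (simp only: of_nat_mult)
    qed
    ultimately show ?thesis by blast
  qed
  then show ?thesis by blast
qed

text \<open>The deviation grows linearly, \<open>D = \<eta> * n\<close>: the Chebyshev term is then
  of order 1/n and the rate loss is proportional to \<open>\<eta>\<close>. The constant
  \<open>K\<close> absorbs the rounding of the split \<open>k n\<close>.\<close>

lemma capacity_ge:
  assumes iso: "isometry dA dB dC U" and rho: "density dA \<rho>" and rho': "density dA \<rho>'"
  defines "SB \<equiv> vn_entropy (chan dB dC U \<rho>)" and "SC \<equiv> vn_entropy (cchan dB dC U \<rho>)"
    and "SA' \<equiv> vn_entropy \<rho>'" and "SB' \<equiv> vn_entropy (chan dB dC U \<rho>')"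
  assumes split: "\<And>n. k n \<le> n" "\<And>n. real (k n) * SB \<le> real (k n) * SC"
    and rate: "\<And>n. real n * R - K \<le> real (k n) * (SC - SB) + min (real (k n) * SB + real (n - k n) * SB') (real (n - k n) * SA')"
  shows "ereal R \<le> CA dA dB dC U"
proof -
  obtain V where V: "\<And>n1 n2 D \<epsilon>. 0 < D \<Longrightarrow> real n1 * SB \<le> real n1 * SC \<Longrightarrow> real (n1 + n2) * V / D\<^sup>2 < 1 \<Longrightarrow>
     2 * real (n1 + n2) * V / D\<^sup>2 + 5 * 2 powr (- D) \<le> \<epsilon> \<Longrightarrow>
     \<exists>N. ea_code dA dB dC U (n1 + n2) \<epsilon> N \<and>
       2 powr (real n1 * (SC - SB) + min (real n1 * SB + real n2 * SB') (real n2 * SA') - 8 * D) \<le> real N"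
    using block_code_exists[OF iso rho rho'] unfolding SB_def SC_def SA'_def SB'_def by blast
  have main: "ereal (R - \<delta>) \<le> liminf (\<lambda>n. elog2 (NA dA dB dC U n \<epsilon>) / ereal (real n))" if \<epsilon>: "0 < \<epsilon>" and \<delta>: "0 < \<delta>" for \<epsilon> \<delta>
  proof (rule Liminf_bounded)
    \<comment> \<open>Nine parts of \<open>\<delta>\<close>: eight for \<open>8 * D\<close>, one for
      \<open>K / n\<close>.\<close>
    define \<eta> where "\<eta> = \<delta> / 9"
    have \<eta>: "0 < \<eta>" using \<delta> by (simp add: \<eta>_def)
    have "(\<lambda>n. 2 * real n * V / (\<eta> * real n)\<^sup>2 + 5 * 2 powr (- (\<eta> * real n))) \<longlonglongrightarrow> 0"
      using \<eta> by real_asymp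
    then have ev1: "\<forall>\<^sub>F n in sequentially. 2 * real n * V / (\<eta> * real n)\<^sup>2 + 5 * 2 powr (- (\<eta> * real n)) < \<epsilon>"
      using \<epsilon> by (rule order_tendstoD(2))
    have "(\<lambda>n. real n * V / (\<eta> * real n)\<^sup>2) \<longlonglongrightarrow> 0" using \<eta> by real_asymp
    then have ev2: "\<forall>\<^sub>F n in sequentially. real n * V / (\<eta> * real n)\<^sup>2 < 1"
      by (rule order_tendstoD(2)) simp
    have "(\<lambda>n. K / real n) \<longlonglongrightarrow> 0" by real_asymp
    then have ev3: "\<forall>\<^sub>F n in sequentially. K / real n < \<eta>"
      using \<eta> by (rule order_tendstoD(2))
    show "\<forall>\<^sub>F n in sequentially. ereal (R - \<delta>) \<le> elog2 (NA dA dB dC U n \<epsilon>) / ereal (real n)"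
      using ev1 ev2 ev3 eventually_gt_at_top[of 0]
    proof eventually_elim
      case (elim n)
      let ?D = "\<eta> * real n"
      have n: "0 < real n" and D: "0 < ?D" using elim(4) \<eta> by auto
      have kn: "k n + (n - k n) = n" using split(1)[of n] by simp
      obtain N where N: "ea_code dA dB dC U n \<epsilon> N"
        and NR: "2 powr (real (k n) * (SC - SB) + min (real (k n) * SB + real (n - k n) * SB') (real (n - k n) * SA') - 8 * ?D) \<le> real N"
        using V[OF D split(2)[of n], of "n - k n" \<epsilon>] elim(1,2) unfolding kn by auto
      have N0: "0 < real N" by (rule less_le_trans[OF _ NR]) simp
      have "real n * R - K - 8 * ?D \<le> log 2 (real N)"
        using NR rate[of n] N0 by (subst (asm) le_log_iff[symmetric]) auto
      moreover have "K \<le> real n * \<eta>" using elim(3) n by (simp add: field_simps)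
      ultimately have "real n * (R - \<delta>) \<le> log 2 (real N)"
        unfolding \<eta>_def by (simp add: algebra_simps)
      then have "R - \<delta> \<le> log 2 (real N) / real n" using n by (simp add: field_simps)
      then have "ereal (R - \<delta>) \<le> ereal (log 2 (real N)) / ereal (real n)" using n by simp
      also have "\<dots> \<le> elog2 (NA dA dB dC U n \<epsilon>) / ereal (real n)"
      proof (rule ereal_divide_right_mono)
        have le: "ereal (real N) \<le> NA dA dB dC U n \<epsilon>"
          unfolding NA_def using N by (intro Sup_upper) auto
        show "ereal (log 2 (real N)) \<le> elog2 (NA dA dB dC U n \<epsilon>)"
        \<comment> \<open>\<open>NA\<close> is a supremum in the extended reals, so the infinite
          value has to be treated; \<open>elog2\<close> sends it to infinity.\<close>
        proof (cases "NA dA dB dC U n \<epsilon>")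
          case (real s)
          then have "real N \<le> s" using le by simp
          then show ?thesis using N0 real by (simp add: elog2_def)
        next
          case PInf
          then show ?thesis by (simp add: elog2_def)
        next
          case MInf
          then show ?thesis using le by simp
        qed
      qed (use n in simp)
      finally show ?case .
    qed
  qed
  show ?thesis
    unfolding CA_def
  proof (rule INF_greatest)
    fix \<epsilon> :: real assume "\<epsilon> \<in> {0<..}"
    then have \<epsilon>: "0 < \<epsilon>" by simp
    show "ereal R \<le> liminf (\<lambda>n. elog2 (NA dA dB dC U n \<epsilon>) / ereal (real n))"
    proof (rule ereal_le_epsilon2)
      fix \<delta> :: real assume "0 < \<delta>"
      from add_right_mono[OF main[OF \<epsilon> this], of "ereal \<delta>"]
      show "ereal R \<le> liminf (\<lambda>n. elog2 (NA dA dB dC U n \<epsilon>) / ereal (real n)) + ereal \<delta>" by simp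
    qed
  qed
qed

text \<open>All copies go to the second stage: with \<open>k = 0\<close> the comparison of
  \<open>S(B)\<close> and \<open>S(C)\<close> is trivial, and one state plays both parts.\<close>

lemma capacity_ge_min:
  assumes "isometry dA dB dC U" "density dA \<rho>"
  shows "ereal (min (vn_entropy \<rho>) (vn_entropy (chan dB dC U \<rho>))) \<le> CA dA dB dC U"
proof (rule capacity_ge[OF assms(1) assms(2) assms(2), where k = "\<lambda>_. 0" and K = 0])
  fix n
  show "real n * min (vn_entropy \<rho>) (vn_entropy (chan dB dC U \<rho>)) - 0 \<le> real 0 * (vn_entropy (cchan dB dC U \<rho>) - vn_entropy (chan dB dC U \<rho>))
      + min (real 0 * vn_entropy (chan dB dC U \<rho>) + real (n - 0) * vn_entropy (chan dB dC U \<rho>)) (real (n - 0) * vn_entropy \<rho>)"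
    by (simp add: min_def mult_left_mono)
qed auto

lemma output_entropy_facts:
  assumes "isometry dA dB dC U" "density dA \<rho>"
  shows "0 \<le> vn_entropy (chan dB dC U \<rho>)"
    and "vn_entropy \<rho> \<le> vn_entropy (chan dB dC U \<rho>) + vn_entropy (cchan dB dC U \<rho>)"
    and "vn_entropy (chan dB dC U \<rho>) \<le> vn_entropy \<rho> + vn_entropy (cchan dB dC U \<rho>)"
proof -
  obtain eA p eB q eC r where t: "tripartite {..<dA} {..<dB} {..<dC} p q r (ampl dA dB dC U eA eB eC)"
    and S: "vn_entropy \<rho> = shan dA p" "vn_entropy (chan dB dC U \<rho>) = shan dB q" "vn_entropy (cchan dB dC U \<rho>) = shan dC r"
    using channel_tripartite[OF assms] by (elim exE conjE)
  interpret tripartite "{..<dA}" "{..<dB}" "{..<dC}" p q r "ampl dA dB dC U eA eB eC" by (rule t)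
  interpret q: distribution dB q using q_nonneg q_sum by unfold_locales auto
  show "0 \<le> vn_entropy (chan dB dC U \<rho>)" using q.shan_nonneg S by simp
  show "vn_entropy \<rho> \<le> vn_entropy (chan dB dC U \<rho>) + vn_entropy (cchan dB dC U \<rho>)"
    "vn_entropy (chan dB dC U \<rho>) \<le> vn_entropy \<rho> + vn_entropy (cchan dB dC U \<rho>)"
    using tripartite_subadditive[OF t] S by simp_all
qed

text \<open>\<open>t\<close> is the ratio of second-stage to first-stage copies at which both limits
  in the minimum agree, \<open>n1 * SB + n2 * SB' = n2 * SA'\<close>. Rounding \<open>n1\<close>
  down loses at most one copy, at a cost of at most (SC - SB) + SB = SC, the constant
  \<open>K\<close>.\<close>

lemma capacity_ge_two_states:
  assumes iso: "isometry dA dB dC U" and rho: "density dA \<rho>" and rho': "density dA \<rho>'"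
  defines "SB \<equiv> vn_entropy (chan dB dC U \<rho>)" and "SC \<equiv> vn_entropy (cchan dB dC U \<rho>)"
    and "SA' \<equiv> vn_entropy \<rho>'" and "SB' \<equiv> vn_entropy (chan dB dC U \<rho>')"
  assumes BC: "SB < SC" and AB': "SB' < SA'"
  defines "t \<equiv> SB / (SA' - SB')"
  shows "ereal ((SC - SB + t * SA') / (1 + t)) \<le> CA dA dB dC U"
proof (rule capacity_ge[OF iso rho rho', where k = "\<lambda>n. nat \<lfloor>real n / (1 + t)\<rfloor>" and K = "SC",
      folded SB_def SC_def SA'_def SB'_def])
  have SB0: "0 \<le> SB" unfolding SB_def by (rule output_entropy_facts(1)[OF iso rho])
  have SB'0: "0 \<le> SB'" unfolding SB'_def by (rule output_entropy_facts(1)[OF iso rho'])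
  have t0: "0 \<le> t" using SB0 AB' by (simp add: t_def)
  \<comment> \<open>The balance of the two limits, per first-stage copy.\<close>
  have tS: "t * SA' = SB + t * SB'" using AB' by (simp add: t_def field_simps)
  fix n
  let ?k = "nat \<lfloor>real n / (1 + t)\<rfloor>"
  have k1: "real ?k \<le> real n / (1 + t)" and k2: "real n / (1 + t) - 1 \<le> real ?k"
    using t0 by simp_all
  have "real n / (1 + t) \<le> real n" using t0 by (simp add: divide_le_eq mult_left_le algebra_simps)
  then have "real ?k \<le> real n" using k1 by linarith
  then show kn: "?k \<le> n" by simp
  show "real ?k * SB \<le> real ?k * SC" using BC by (intro mult_left_mono) auto
  have nk: "real (n - ?k) = real n - real ?k" using kn by simp
  have nt: "real n - real n / (1 + t) = real n * t / (1 + t)" using t0 by (simp add: field_simps)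
  have n2: "real n * t / (1 + t) \<le> real n - real ?k" using k1 nt by linarith
  have a: "(real n / (1 + t) - 1) * (SC - SB) \<le> real ?k * (SC - SB)"
    using k2 BC by (intro mult_right_mono) auto
  have b: "(real n / (1 + t) - 1) * SB + real n * t / (1 + t) * SB' \<le> real ?k * SB + (real n - real ?k) * SB'"
    using k2 n2 SB0 SB'0 by (intro add_mono mult_right_mono) auto
  have c: "real n * t / (1 + t) * SA' \<le> (real n - real ?k) * SA'"
    using n2 SB'0 AB' by (intro mult_right_mono) auto
  have d: "real n / (1 + t) * SB + real n * t / (1 + t) * SB' = real n * t / (1 + t) * SA'"
  proof -
    have "real n / (1 + t) * SB + real n * t / (1 + t) * SB' = real n / (1 + t) * (SB + t * SB')"
      by (simp add: algebra_simps add_divide_distrib)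
    also have "\<dots> = real n / (1 + t) * (t * SA')" by (simp only: tS)
    finally show ?thesis by (simp add: algebra_simps)
  qed
  have eq: "real n * ((SC - SB + t * SA') / (1 + t)) = real n / (1 + t) * (SC - SB) + real n * t / (1 + t) * SA'"
    by (simp add: algebra_simps add_divide_distrib diff_divide_distrib)
  have mn: "real n * t / (1 + t) * SA' - SB \<le> min (real ?k * SB + (real n - real ?k) * SB') ((real n - real ?k) * SA')"
    using b c d SB0 by (simp add: algebra_simps)
  have add: "x + y - SC \<le> v + w" if "y - SB \<le> w" "x - 1 * (SC - SB) \<le> v" for v w x y :: real
    using add_mono[OF that] by simp
  show "real n * ((SC - SB + t * SA') / (1 + t)) - SC \<le> real ?k * (SC - SB) + min (real ?k * SB + real (n - ?k) * SB') (real (n - ?k) * SA')"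
    unfolding nk eq by (rule add[OF mn a[unfolded left_diff_distrib[of "real n / (1 + t)" 1 "SC - SB"]]])
qed

theorem mainTheorem1:
  fixes dA dB dC :: nat and U :: "complex mat"
  assumes "isometry dA dB dC U"
  shows
   "(\<forall>\<rho>. density dA \<rho> \<longrightarrow>
       (vn_entropy \<rho> \<le> vn_entropy (chan dB dC U \<rho>) \<longrightarrow>
          CA dA dB dC U \<ge> ereal (vn_entropy \<rho>)) \<and>
       CA dA dB dC U \<ge> ereal ((vn_entropy \<rho> + vn_entropy (chan dB dC U \<rho>)
                                 - vn_entropy (cchan dB dC U \<rho>)) / 2))
    \<and>
    (\<forall>\<rho> \<rho>'. density dA \<rho> \<longrightarrow> density dA \<rho>' \<longrightarrow>
       vn_entropy (chan dB dC U \<rho>) < vn_entropy (cchan dB dC U \<rho>) \<longrightarrow>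
       vn_entropy (chan dB dC U \<rho>') < vn_entropy \<rho>' \<longrightarrow>
       (let SA' = vn_entropy \<rho>'; SB' = vn_entropy (chan dB dC U \<rho>');
            SB = vn_entropy (chan dB dC U \<rho>); SC = vn_entropy (cchan dB dC U \<rho>);
            t = SB / (SA' - SB')
        in CA dA dB dC U \<ge> ereal ((SC - SB + t * SA') / (1 + t))))
    \<and>
    (\<forall>\<rho>. density dA \<rho> \<longrightarrow>
       vn_entropy (chan dB dC U \<rho>) < vn_entropy (cchan dB dC U \<rho>) \<longrightarrow>
       vn_entropy (chan dB dC U \<rho>) < vn_entropy \<rho> \<longrightarrow>
       (let SA = vn_entropy \<rho>; SB = vn_entropy (chan dB dC U \<rho>);
            SC = vn_entropy (cchan dB dC U \<rho>)
        in CA dA dB dC U \<ge> ereal ((1 - SB / SA) * SC + (SB / SA) * SB)))"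
proof (intro conjI allI impI)
  fix \<rho> assume rho: "density dA \<rho>"
  let ?A = "vn_entropy \<rho>" and ?B = "vn_entropy (chan dB dC U \<rho>)" and ?C = "vn_entropy (cchan dB dC U \<rho>)"
  note cap = capacity_ge_min[OF assms rho]
  show "ereal ?A \<le> CA dA dB dC U" if "?A \<le> ?B" using cap that by (simp add: min_def)
  \<comment> \<open>Half of the mutual information is at most \<open>?A\<close> because
    \<open>?B <= ?A + ?C\<close>, and at most \<open>?B\<close> because
    \<open>?A <= ?B + ?C\<close>.\<close>
  have "(?A + ?B - ?C) / 2 \<le> min ?A ?B"
    using output_entropy_facts[OF assms rho] by simp
  then have "ereal ((?A + ?B - ?C) / 2) \<le> ereal (min ?A ?B)" by (simp only: ereal_less_eq)
  then show "ereal ((?A + ?B - ?C) / 2) \<le> CA dA dB dC U" using cap by (rule order_trans)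
next
  fix \<rho> \<rho>' assume "density dA \<rho>" "density dA \<rho>'" "vn_entropy (chan dB dC U \<rho>) < vn_entropy (cchan dB dC U \<rho>)"
    "vn_entropy (chan dB dC U \<rho>') < vn_entropy \<rho>'"
  then show "let SA' = vn_entropy \<rho>'; SB' = vn_entropy (chan dB dC U \<rho>');
            SB = vn_entropy (chan dB dC U \<rho>); SC = vn_entropy (cchan dB dC U \<rho>);
            t = SB / (SA' - SB')
        in CA dA dB dC U \<ge> ereal ((SC - SB + t * SA') / (1 + t))"
    unfolding Let_def by (rule capacity_ge_two_states[OF assms])
next
  fix \<rho> assume rho: "density dA \<rho>" and BC: "vn_entropy (chan dB dC U \<rho>) < vn_entropy (cchan dB dC U \<rho>)"
    and BA: "vn_entropy (chan dB dC U \<rho>) < vn_entropy \<rho>"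
  let ?A = "vn_entropy \<rho>" and ?B = "vn_entropy (chan dB dC U \<rho>)" and ?C = "vn_entropy (cchan dB dC U \<rho>)"
  have B0: "0 \<le> ?B" by (rule output_entropy_facts(1)[OF assms rho])
  \<comment> \<open>With equal states the fraction 1 / (1 + t) of first-stage copies is
    \<open>(?A - ?B) / ?A\<close>, which brings the two-state bound into the form of (iii).\<close>
  have "1 + ?B / (?A - ?B) = ?A / (?A - ?B)" using BA by (simp add: field_simps)
  then have "(?C - ?B + ?B / (?A - ?B) * ?A) / (1 + ?B / (?A - ?B)) = (1 - ?B / ?A) * ?C + (?B / ?A) * ?B"
    using BA B0 by (simp add: field_simps)
  then show "let SA = vn_entropy \<rho>; SB = vn_entropy (chan dB dC U \<rho>);
            SC = vn_entropy (cchan dB dC U \<rho>)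
        in CA dA dB dC U \<ge> ereal ((1 - SB / SA) * SC + (SB / SA) * SB)"
    unfolding Let_def using capacity_ge_two_states[OF assms rho rho BC BA] by simp
qed

end
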